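(* Let $(M,L)$ be a Finsler spacetime with time orientation $T$, let $q\in M$, let $c\le 0$ be a constant, and let $\gamma:I\to M$ be a future pointed timelike curve. Let $\lambda:[0,1]\to M$ be a causal geodesic belonging to $\mathcal{C}_{q,\gamma,c}$, and let $\Lambda(\epsilon,s)$ be an allowed variation of $\lambda$ with $A(s)=\frac{d}{d\epsilon}\big|_{\epsilon=0}\Lambda(\epsilon,s)$. Then $$\frac{d^2}{d\epsilon^2}\Big|_{\epsilon=0}\tau(\Lambda(\epsilon,\cdot))=\frac{J_\lambda(A,A)}{g_{\dot\lambda(1)}\big(\gamma'(\tau(\lambda)),\dot\lambda(1)\big)}.$$
   Context: A Finsler spacetime is a pair $(M,L)$ where $M$ is an $n$-dimensional real, second countable, Hausdorff $C^\infty$ manifold and $L:N\to\mathbb{R}$, $N=TM\setminus\{0\}$ (slit tangent bundle), is a smooth function such that $L(x,ky)=k^2L(x,y)$ for all $k>0$, and the vertical Hessian $g_{ij}(x,y)=\frac{\partial^2L(x,y)}{\partial y^i\partial y^j}$ is non-degenerate with signature $(-,+,\dots,+)$ for all $(x,y)\in N$. For $v\in T_xM\setminus\{0\}$ and $X,Y\in T_xM$ write $g_v(X,Y)=g_{ij}(x,v)X^iY^j$; thus $L(x,y)=\frac12 g_y(y,y)$. A nonzero vector $v\in T_xM$ is timelike if $L(x,v)<0$ and lightlike if $L(x,v)=0$; a curve is timelike (lightlike) if all its tangent vectors are. A curve $\lambda$ is causal if it is either timelike with $L(\lambda,\dot\lambda)$ constant, or lightlike. A time orientation is a smooth timelike vector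 field $T$ on $M$. A causal vector $v\in T_xM$ is future pointed if $g_v(v,T(x))<0$; a curve is future pointed if its tangent vectors are. Fix $q\in M$, a constant $c\le 0$ and a future pointed timelike smooth curve $\gamma:I\to M$ ($I\subseteq\mathbb{R}$ an interval) without self-intersections. The space of admissible curves $\mathcal{C}_{q,\gamma,c}$ is the set of smooth curves $\lambda:[0,1]\to M$ such that: (1) $\lambda(0)=q$; (2) there is $\tau(\lambda)\in I$ with $\lambda(1)=\gamma(\tau(\lambda))$; (3) $L(\lambda(s),\dot\lambda(s))=-c^2$ for all $s\in[0,1]$; (4) $g_{\dot\lambda(s)}(\dot\lambda(s),T(\lambda(s)))<0$ for all $s\in[0,1]$. The time arrival functional is $\tau:\mathcal{C}_{q,\gamma,c}\to\mathbb{R}$, $\lambda\mapsto\tau(\lambda)$. An allowed variation of $\lambda\in\mathcal{C}_{q,\gamma,c}$ is a smooth map $\Lambda:(-\epsilon_0,\epsilon_0)\times[0,1]\to M$, $\epsilon_0>0$, with $\Lambda(\epsilon,\cdot)\in\mathcal{C}_{q,\gamma,c}$ for all $\epsilon$ and $\Lambda(0,s)=\lambda(s)$. A geodesic of $L$ is a solution of the Euler–Lagrange equations $\frac{d}{ds}\frac{\partial L}{\partial\dot\lambda^i}-\frac{\partial L}{\partial\lambda^i}=0$. Chern connection: let $C_{ijk}=\frac12\frac{\partial g_{ij}}{\partial y^k}$, $C^i{}_{jk}=g^{il}C_{ljk}$, $\gamma^i{}_{jk}=\frac12g^{is}\big(\frac{\partial g_{sj}}{\partial x^k}-\frac{\partial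 g_{jk}}{\partial x^s}+\frac{\partial g_{sk}}{\partial x^j}\big)$, $N^i{}_j=\gamma^i{}_{jk}y^k-C^i{}_{jk}\gamma^k{}_{rs}y^ry^s$, $\frac{\delta}{\delta x^j}=\frac{\partial}{\partial x^j}-N^i{}_j\frac{\partial}{\partial y^i}$, $\delta y^k=dy^k+N^k{}_jdx^j$. The Chern connection is the unique linear connection on the pull-back bundle $\pi^*TM\to N$ whose connection forms $\omega_j{}^i$ satisfy $dx^j\wedge\omega_j{}^i=0$ and $dg_{ij}-g_{kj}\omega_i{}^k-g_{ik}\omega_j{}^k=2C_{ijk}\delta y^k$; then $\omega_j{}^i=\Gamma^i{}_{jk}dx^k$. For a vector field $A$ along $\lambda$, $\nabla_{\dot\lambda}A$ denotes the covariant derivative with reference vector $\dot\lambda$, with components $\dot A^i+\Gamma^i{}_{jk}(\lambda,\dot\lambda)A^j\dot\lambda^k$. The $hh$-curvature is $R^i{}_{jkl}=\frac{\delta\Gamma^i{}_{jl}}{\delta x^k}-\frac{\delta\Gamma^i{}_{jk}}{\delta x^l}+\Gamma^i{}_{hk}\Gamma^h{}_{jl}-\Gamma^i{}_{hl}\Gamma^h{}_{jk}$, and $\big(R_{\dot\lambda}(A,\dot\lambda)\dot\lambda\big)^i=R^i{}_{jkl}(\lambda,\dot\lambda)\dot\lambda^jA^k\dot\lambda^l$ (so that formally $R(X,Y)Z=\nabla_X\nabla_YZ-\nabla_Y\nabla_XZ-\nabla_{[X,Y]}Z$). The index form along $\lambda$ is $$J_\lambda(A,B)=\int_0^1\Bi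g(g_{\dot\lambda}\big(B,R_{\dot\lambda}(A,\dot\lambda)\dot\lambda\big)-g_{\dot\lambda}(\nabla_{\dot\lambda}A,\nabla_{\dot\lambda}B)\Big)ds.$$
   Formalization: The formal statement additionally assumes that the denominator g_{λ'(1)}(γ'(τ(λ)), λ'(1)) is nonzero and that ε ↦ τ(Λ(ε,·)) is continuous at ε = 0; neither follows from the stated hypotheses, and without them the formula can be undefined or false. *)

theory Defs
  imports "HOL-Analysis.Analysis"
begin

section \<open>Smooth maps between subsets of Euclidean spaces\<close>

primrec Ck_on :: "nat \<Rightarrow> 'a::euclidean_space set \<Rightarrow> ('a \<Rightarrow> 'b::real_normed_vector) \<Rightarrow> bool" where
  "Ck_on 0 U f \<longleftrightarrow> continuous_on U f"
| "Ck_on (Suc k) U f \<longleftrightarrow>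
     (\<forall>x\<in>U. f differentiable (at x)) \<and> (\<forall>v. Ck_on k U (\<lambda>x. frechet_derivative f (at x) v))"

text \<open>\<open>Ck_on\<close> is meant for open sets only. On an arbitrary set \<open>S\<close> (a closed interval, a strip)
  smoothness means that \<open>f\<close> extends smoothly to an open neighbourhood of each point of \<open>S\<close>.\<close>

definition smooth_on :: "'a::euclidean_space set \<Rightarrow> ('a \<Rightarrow> 'b::real_normed_vector) \<Rightarrow> bool" where
  "smooth_on S f \<longleftrightarrow>
     (\<forall>x\<in>S. \<exists>U F. open U \<and> x \<in> U \<and> (\<forall>k. Ck_on k U F) \<and> (\<forall>z\<in>U \<inter> S. F z = f z))"

text \<open>The value \<open>D\<close> is the second derivative of \<open>f\<close> at \<open>x\<close>; in particular \<open>f\<close> is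
  differentiable near \<open>x\<close>.\<close>

definition has_second_derivative :: "(real \<Rightarrow> real) \<Rightarrow> real \<Rightarrow> real \<Rightarrow> bool" where
  "has_second_derivative f D x \<longleftrightarrow>
     (\<exists>f'. (\<forall>\<^sub>F t in nhds x. (f has_real_derivative f' t) (at t)) \<and>
           (f' has_real_derivative D) (at x))"

section \<open>Manifolds and tangent vectors\<close>

text \<open>The manifold is the whole type \<open>'m\<close>, which is Hausdorff and second countable by its sort,
  together with a smooth atlas modelled on \<open>real ^ 'n\<close>. A chart is a pair of its domain and its
  coordinate map (irrelevant outside the domain).\<close>

type_synonym ('m, 'n) chart = "'m set \<times> ('m \<Rightarrow> real ^ 'n)"

definition chart_inv :: "('m, 'n::finite) chart \<Rightarrow> real ^ 'n \<Rightarrow> 'm" where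
  "chart_inv c = inv_into (fst c) (snd c)"

definition is_chart :: "('m::topological_space, 'n::finite) chart \<Rightarrow> bool" where
  "is_chart c \<longleftrightarrow> open (fst c) \<and> open (snd c ` fst c) \<and>
     homeomorphism (fst c) (snd c ` fst c) (snd c) (chart_inv c)"

definition transition :: "('m, 'n::finite) chart \<Rightarrow> ('m, 'n) chart \<Rightarrow> real ^ 'n \<Rightarrow> real ^ 'n" where
  "transition c d = snd d \<circ> chart_inv c"

definition smooth_atlas ::
  "('m::{t2_space, second_countable_topology}, 'n::finite) chart set \<Rightarrow> bool" where
  "smooth_atlas \<A> \<longleftrightarrow> (\<Union>c\<in>\<A>. fst c) = UNIV \<and> (\<forall>c\<in>\<A>. is_chart c) \<and>
     (\<forall>c\<in>\<A>. \<forall>d\<in>\<A>. smooth_on (snd c ` (fst c \<inter> fst d)) (transition c d))"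

definition smooth_map :: "('m::topological_space, 'n::finite) chart set \<Rightarrow>
    'a::euclidean_space set \<Rightarrow> ('a \<Rightarrow> 'm) \<Rightarrow> bool" where
  "smooth_map \<A> S f \<longleftrightarrow> continuous_on S f \<and>
     (\<forall>c\<in>\<A>. smooth_on {z \<in> S. f z \<in> fst c} (\<lambda>z. snd c (f z)))"

text \<open>A tangent vector at \<open>p\<close> is the family of its components in the charts of the atlas around \<open>p\<close>,
  subject to the usual transformation law (and set to 0 at all other indices).\<close>

type_synonym ('m, 'n) tvec = "('m, 'n) chart \<Rightarrow> real ^ 'n"

definition tvec_of :: "('m, 'n::finite) chart set \<Rightarrow> ('m, 'n) chart \<Rightarrow> 'm \<Rightarrow> real ^ 'n \<Rightarrow>
    ('m, 'n) tvec" where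
  "tvec_of \<A> c p y = (\<lambda>d. if d \<in> \<A> \<and> p \<in> fst d
     then frechet_derivative (transition c d) (at (snd c p)) y else 0)"

definition tangent_space :: "('m, 'n::finite) chart set \<Rightarrow> 'm \<Rightarrow> ('m, 'n) tvec set" where
  "tangent_space \<A> p = {v.
     (\<forall>c. \<not> (c \<in> \<A> \<and> p \<in> fst c) \<longrightarrow> v c = 0) \<and>
     (\<forall>c\<in>\<A>. \<forall>d\<in>\<A>. p \<in> fst c \<and> p \<in> fst d \<longrightarrow>
        v d = frechet_derivative (transition c d) (at (snd c p)) (v c))}"

definition slit_tangent_space :: "('m, 'n::finite) chart set \<Rightarrow> 'm \<Rightarrow> ('m, 'n) tvec set" where
  "slit_tangent_space \<A> p = tangent_space \<A> p - {\<lambda>_. 0}"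

text \<open>Velocity at \<open>t\<close> of a curve with parameter interval \<open>S\<close> (one-sided at endpoints of \<open>S\<close>).\<close>

definition velocity :: "('m, 'n::finite) chart set \<Rightarrow> real set \<Rightarrow> (real \<Rightarrow> 'm) \<Rightarrow> real \<Rightarrow>
    ('m, 'n) tvec" where
  "velocity \<A> S \<mu> t = (\<lambda>c. if c \<in> \<A> \<and> \<mu> t \<in> fst c
     then vector_derivative (\<lambda>r. snd c (\<mu> r)) (at t within S) else 0)"

section \<open>Local geometry: the Chern connection in coordinates\<close>

text \<open>In this section \<open>F x y\<close> is the coordinate expression of \<open>L\<close>.\<close>

type_synonym 'n lagr = "real ^ 'n \<Rightarrow> real ^ 'n \<Rightarrow> real"

definition partial_x :: "'n::finite \<Rightarrow> 'n lagr \<Rightarrow> 'n lagr" where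
  "partial_x i F x y = deriv (\<lambda>t. F (x + t *\<^sub>R axis i 1) y) 0"

definition partial_y :: "'n::finite \<Rightarrow> 'n lagr \<Rightarrow> 'n lagr" where
  "partial_y i F x y = deriv (\<lambda>t. F x (y + t *\<^sub>R axis i 1)) 0"

definition g_low :: "'n::finite lagr \<Rightarrow> 'n \<Rightarrow> 'n \<Rightarrow> 'n lagr" where
  "g_low F i j = partial_y i (partial_y j F)"

definition g_matrix :: "'n::finite lagr \<Rightarrow> real ^ 'n \<Rightarrow> real ^ 'n \<Rightarrow> real ^ 'n ^ 'n" where
  "g_matrix F x y = (\<chi> i j. g_low F i j x y)"

definition g_up :: "'n::finite lagr \<Rightarrow> 'n \<Rightarrow> 'n \<Rightarrow> 'n lagr" where
  "g_up F i j x y = matrix_inv (g_matrix F x y) $ i $ j"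

definition cartan_low :: "'n::finite lagr \<Rightarrow> 'n \<Rightarrow> 'n \<Rightarrow> 'n \<Rightarrow> 'n lagr" where
  "cartan_low F i j k x y = (1/2) * partial_y k (g_low F i j) x y"

definition cartan_up :: "'n::finite lagr \<Rightarrow> 'n \<Rightarrow> 'n \<Rightarrow> 'n \<Rightarrow> 'n lagr" where
  "cartan_up F i j k x y = (\<Sum>l\<in>UNIV. g_up F i l x y * cartan_low F l j k x y)"

definition formal_christoffel :: "'n::finite lagr \<Rightarrow> 'n \<Rightarrow> 'n \<Rightarrow> 'n \<Rightarrow> 'n lagr" where
  "formal_christoffel F i j k x y = (1/2) * (\<Sum>s\<in>UNIV. g_up F i s x y *
     (partial_x k (g_low F s j) x y - partial_x s (g_low F j k) x y + partial_x j (g_low F s k) x y))"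

definition nonlinear_connection :: "'n::finite lagr \<Rightarrow> 'n \<Rightarrow> 'n \<Rightarrow> 'n lagr" where
  "nonlinear_connection F i j x y =
     (\<Sum>k\<in>UNIV. formal_christoffel F i j k x y * y $ k) -
     (\<Sum>k\<in>UNIV. \<Sum>r\<in>UNIV. \<Sum>s\<in>UNIV.
        cartan_up F i j k x y * formal_christoffel F k r s x y * y $ r * y $ s)"

definition delta_x :: "'n::finite lagr \<Rightarrow> 'n \<Rightarrow> 'n lagr \<Rightarrow> 'n lagr" where
  "delta_x F j f x y =
     partial_x j f x y - (\<Sum>i\<in>UNIV. nonlinear_connection F i j x y * partial_y i f x y)"

text \<open>One-forms on the slit tangent bundle at the point \<open>(x, y)\<close> are linear functionals of
  \<open>(u, w)\<close>, where \<open>u\<close> are the \<open>\<partial>/\<partial>x\<close>- and \<open>w\<close> the \<open>\<partial>/\<partial>y\<close>-components.\<close>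

type_synonym 'n form = "(real ^ 'n) \<times> (real ^ 'n) \<Rightarrow> real"

definition dx :: "'n::finite \<Rightarrow> 'n form" where
  "dx j X = fst X $ j"

definition d_fun :: "'n::finite lagr \<Rightarrow> real ^ 'n \<Rightarrow> real ^ 'n \<Rightarrow> 'n form" where
  "d_fun f x y X = (\<Sum>k\<in>UNIV. partial_x k f x y * fst X $ k + partial_y k f x y * snd X $ k)"

definition delta_y :: "'n::finite lagr \<Rightarrow> 'n \<Rightarrow> real ^ 'n \<Rightarrow> real ^ 'n \<Rightarrow> 'n form" where
  "delta_y F k x y X = snd X $ k + (\<Sum>j\<in>UNIV. nonlinear_connection F k j x y * fst X $ j)"

text \<open>\<open>\<omega> j i\<close> is the connection form with lower index \<open>j\<close> and upper index \<open>i\<close>; the first equation is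
  \<open>dx\<^sup>j \<and> \<omega>\<^sub>j\<^sup>i = 0\<close> (summed over \<open>j\<close>).\<close>

definition is_chern_form ::
  "'n::finite lagr \<Rightarrow> real ^ 'n \<Rightarrow> real ^ 'n \<Rightarrow> ('n \<Rightarrow> 'n \<Rightarrow> 'n form) \<Rightarrow> bool" where
  "is_chern_form F x y \<omega> \<longleftrightarrow>
     (\<forall>i j. linear (\<omega> j i)) \<and>
     (\<forall>i X Y. (\<Sum>j\<in>UNIV. dx j X * \<omega> j i Y - dx j Y * \<omega> j i X) = 0) \<and>
     (\<forall>i j X. d_fun (g_low F i j) x y X
        - (\<Sum>k\<in>UNIV. g_low F k j x y * \<omega> i k X)
        - (\<Sum>k\<in>UNIV. g_low F i k x y * \<omega> j k X)
        = 2 * (\<Sum>k\<in>UNIV. cartan_low F i j k x y * delta_y F k x y X))"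

definition chern_form ::
  "'n::finite lagr \<Rightarrow> real ^ 'n \<Rightarrow> real ^ 'n \<Rightarrow> 'n \<Rightarrow> 'n \<Rightarrow> 'n form" where
  "chern_form F x y = (THE \<omega>. is_chern_form F x y \<omega>)"

text \<open>\<open>chern_gamma F i j k\<close> is \<open>\<Gamma>\<^sup>i\<^sub>j\<^sub>k\<close>, the coefficient of \<open>dx\<^sup>k\<close> in \<open>\<omega>\<^sub>j\<^sup>i\<close>.\<close>

definition chern_gamma :: "'n::finite lagr \<Rightarrow> 'n \<Rightarrow> 'n \<Rightarrow> 'n \<Rightarrow> 'n lagr" where
  "chern_gamma F i j k x y = chern_form F x y j i (axis k 1, 0)"

definition hh_curvature :: "'n::finite lagr \<Rightarrow> 'n \<Rightarrow> 'n \<Rightarrow> 'n \<Rightarrow> 'n \<Rightarrow> 'n lagr" where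
  "hh_curvature F i j k l x y =
     delta_x F k (chern_gamma F i j l) x y - delta_x F l (chern_gamma F i j k) x y
     + (\<Sum>h\<in>UNIV. chern_gamma F i h k x y * chern_gamma F h j l x y)
     - (\<Sum>h\<in>UNIV. chern_gamma F i h l x y * chern_gamma F h j k x y)"

section \<open>Finsler spacetimes\<close>

text \<open>\<open>L\<close> takes a point and a tangent vector at it; only its values on nonzero tangent vectors
  matter.\<close>

definition coord_rep :: "('m, 'n::finite) chart set \<Rightarrow> ('m \<Rightarrow> ('m, 'n) tvec \<Rightarrow> real) \<Rightarrow>
    ('m, 'n) chart \<Rightarrow> 'n lagr" where
  "coord_rep \<A> L c x y = L (chart_inv c x) (tvec_of \<A> c (chart_inv c x) y)"

definition lorentzian_signature :: "real ^ 'n ^ 'n::finite \<Rightarrow> bool" where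
  "lorentzian_signature G \<longleftrightarrow> (\<exists>(P :: real ^ 'n ^ 'n) i0. invertible P \<and>
     transpose P ** G ** P = (\<chi> i j. if i \<noteq> j then 0 else if i = i0 then -1 else 1))"

definition finsler_spacetime :: "('m::{t2_space, second_countable_topology}, 'n::finite) chart set \<Rightarrow>
    ('m \<Rightarrow> ('m, 'n) tvec \<Rightarrow> real) \<Rightarrow> bool" where
  "finsler_spacetime \<A> L \<longleftrightarrow> smooth_atlas \<A> \<and>
     (\<forall>c\<in>\<A>. smooth_on ((snd c ` fst c) \<times> (- {0})) (\<lambda>(x, y). coord_rep \<A> L c x y)) \<and>
     (\<forall>p. \<forall>v\<in>slit_tangent_space \<A> p. \<forall>k>0. L p (\<lambda>c. k *\<^sub>R v c) = k\<^sup>2 * L p v) \<and>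
     (\<forall>c\<in>\<A>. \<forall>x\<in>snd c ` fst c. \<forall>y. y \<noteq> 0 \<longrightarrow>
        lorentzian_signature (g_matrix (coord_rep \<A> L c) x y))"

definition chart_at :: "('m, 'n::finite) chart set \<Rightarrow> 'm \<Rightarrow> ('m, 'n) chart" where
  "chart_at \<A> p = (SOME c. c \<in> \<A> \<and> p \<in> fst c)"

text \<open>\<open>fund_tensor \<A> L p v X Y\<close> is \<open>g\<^sub>v(X, Y)\<close> at the point \<open>p\<close>. The value does not depend on the chart in
  which it is computed.\<close>

definition fund_tensor :: "('m, 'n::finite) chart set \<Rightarrow> ('m \<Rightarrow> ('m, 'n) tvec \<Rightarrow> real) \<Rightarrow> 'm \<Rightarrow>
    ('m, 'n) tvec \<Rightarrow> ('m, 'n) tvec \<Rightarrow> ('m, 'n) tvec \<Rightarrow> real" where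
  "fund_tensor \<A> L p v X Y = (let c = chart_at \<A> p in
     \<Sum>i\<in>UNIV. \<Sum>j\<in>UNIV. g_low (coord_rep \<A> L c) i j (snd c p) (v c) * X c $ i * Y c $ j)"

definition timelike_vec :: "('m, 'n::finite) chart set \<Rightarrow> ('m \<Rightarrow> ('m, 'n) tvec \<Rightarrow> real) \<Rightarrow> 'm \<Rightarrow>
    ('m, 'n) tvec \<Rightarrow> bool" where
  "timelike_vec \<A> L p v \<longleftrightarrow> v \<in> slit_tangent_space \<A> p \<and> L p v < 0"

definition lightlike_vec :: "('m, 'n::finite) chart set \<Rightarrow> ('m \<Rightarrow> ('m, 'n) tvec \<Rightarrow> real) \<Rightarrow> 'm \<Rightarrow>
    ('m, 'n) tvec \<Rightarrow> bool" where
  "lightlike_vec \<A> L p v \<longleftrightarrow> v \<in> slit_tangent_space \<A> p \<and> L p v = 0"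

definition time_orientation :: "('m, 'n::finite) chart set \<Rightarrow> ('m \<Rightarrow> ('m, 'n) tvec \<Rightarrow> real) \<Rightarrow>
    ('m \<Rightarrow> ('m, 'n) tvec) \<Rightarrow> bool" where
  "time_orientation \<A> L T \<longleftrightarrow> (\<forall>p. timelike_vec \<A> L p (T p)) \<and>
     (\<forall>c\<in>\<A>. smooth_on (snd c ` fst c) (\<lambda>x. T (chart_inv c x) c))"

definition future_pointed :: "('m, 'n::finite) chart set \<Rightarrow> ('m \<Rightarrow> ('m, 'n) tvec \<Rightarrow> real) \<Rightarrow>
    ('m \<Rightarrow> ('m, 'n) tvec) \<Rightarrow> 'm \<Rightarrow> ('m, 'n) tvec \<Rightarrow> bool" where
  "future_pointed \<A> L T p v \<longleftrightarrow> fund_tensor \<A> L p v v (T p) < 0"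

section \<open>Curves\<close>

definition timelike_curve :: "('m, 'n::finite) chart set \<Rightarrow> ('m \<Rightarrow> ('m, 'n) tvec \<Rightarrow> real) \<Rightarrow>
    real set \<Rightarrow> (real \<Rightarrow> 'm) \<Rightarrow> bool" where
  "timelike_curve \<A> L S \<mu> \<longleftrightarrow> (\<forall>s\<in>S. timelike_vec \<A> L (\<mu> s) (velocity \<A> S \<mu> s))"

definition lightlike_curve :: "('m, 'n::finite) chart set \<Rightarrow> ('m \<Rightarrow> ('m, 'n) tvec \<Rightarrow> real) \<Rightarrow>
    real set \<Rightarrow> (real \<Rightarrow> 'm) \<Rightarrow> bool" where
  "lightlike_curve \<A> L S \<mu> \<longleftrightarrow> (\<forall>s\<in>S. lightlike_vec \<A> L (\<mu> s) (velocity \<A> S \<mu> s))"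

definition causal_curve :: "('m, 'n::finite) chart set \<Rightarrow> ('m \<Rightarrow> ('m, 'n) tvec \<Rightarrow> real) \<Rightarrow>
    real set \<Rightarrow> (real \<Rightarrow> 'm) \<Rightarrow> bool" where
  "causal_curve \<A> L S \<mu> \<longleftrightarrow>
     timelike_curve \<A> L S \<mu> \<and> (\<exists>k. \<forall>s\<in>S. L (\<mu> s) (velocity \<A> S \<mu> s) = k) \<or>
     lightlike_curve \<A> L S \<mu>"

definition future_pointed_curve :: "('m, 'n::finite) chart set \<Rightarrow> ('m \<Rightarrow> ('m, 'n) tvec \<Rightarrow> real) \<Rightarrow>
    ('m \<Rightarrow> ('m, 'n) tvec) \<Rightarrow> real set \<Rightarrow> (real \<Rightarrow> 'm) \<Rightarrow> bool" where
  "future_pointed_curve \<A> L T S \<mu> \<longleftrightarrow>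
     (\<forall>s\<in>S. future_pointed \<A> L T (\<mu> s) (velocity \<A> S \<mu> s))"

definition geodesic :: "('m, 'n::finite) chart set \<Rightarrow> ('m \<Rightarrow> ('m, 'n) tvec \<Rightarrow> real) \<Rightarrow>
    real set \<Rightarrow> (real \<Rightarrow> 'm) \<Rightarrow> bool" where
  "geodesic \<A> L S \<mu> \<longleftrightarrow> (\<forall>s\<in>S. \<forall>c\<in>\<A>. \<mu> s \<in> fst c \<longrightarrow> (\<forall>i.
     ((\<lambda>r. partial_y i (coord_rep \<A> L c) (snd c (\<mu> r)) (velocity \<A> S \<mu> r c))
        has_real_derivative
      partial_x i (coord_rep \<A> L c) (snd c (\<mu> s)) (velocity \<A> S \<mu> s c)) (at s within S)))"

definition admissible_curves :: "('m::topological_space, 'n::finite) chart set \<Rightarrow>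
    ('m \<Rightarrow> ('m, 'n) tvec \<Rightarrow> real) \<Rightarrow> ('m \<Rightarrow> ('m, 'n) tvec) \<Rightarrow> 'm \<Rightarrow> real set \<Rightarrow> (real \<Rightarrow> 'm) \<Rightarrow> real \<Rightarrow>
    (real \<Rightarrow> 'm) set" where
  "admissible_curves \<A> L T q I \<gamma> c = {\<mu>. smooth_map \<A> {0..1} \<mu> \<and>
     \<mu> 0 = q \<and>
     (\<exists>t\<in>I. \<mu> 1 = \<gamma> t) \<and>
     (\<forall>s\<in>{0..1}. velocity \<A> {0..1} \<mu> s \<in> slit_tangent_space \<A> (\<mu> s) \<and>
        L (\<mu> s) (velocity \<A> {0..1} \<mu> s) = - c\<^sup>2 \<and>
        fund_tensor \<A> L (\<mu> s) (velocity \<A> {0..1} \<mu> s) (velocity \<A> {0..1} \<mu> s) (T (\<mu> s)) < 0)}"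

text \<open>The time arrival functional; unique if \<open>\<gamma>\<close> is injective on \<open>I\<close> and \<open>\<mu>\<close> is admissible.\<close>

definition time_arrival :: "real set \<Rightarrow> (real \<Rightarrow> 'm) \<Rightarrow> (real \<Rightarrow> 'm) \<Rightarrow> real" where
  "time_arrival I \<gamma> \<mu> = (THE t. t \<in> I \<and> \<mu> 1 = \<gamma> t)"

definition allowed_variation :: "('m::topological_space, 'n::finite) chart set \<Rightarrow>
    ('m \<Rightarrow> ('m, 'n) tvec \<Rightarrow> real) \<Rightarrow> ('m \<Rightarrow> ('m, 'n) tvec) \<Rightarrow> 'm \<Rightarrow> real set \<Rightarrow> (real \<Rightarrow> 'm) \<Rightarrow> real \<Rightarrow>
    (real \<Rightarrow> 'm) \<Rightarrow> real \<Rightarrow> (real \<Rightarrow> real \<Rightarrow> 'm) \<Rightarrow> bool" where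
  "allowed_variation \<A> L T q I \<gamma> c \<mu> \<epsilon>0 \<Lambda> \<longleftrightarrow> \<epsilon>0 > 0 \<and>
     smooth_map \<A> ({-\<epsilon>0<..<\<epsilon>0} \<times> {0..1}) (\<lambda>(\<epsilon>, s). \<Lambda> \<epsilon> s) \<and>
     (\<forall>\<epsilon>\<in>{-\<epsilon>0<..<\<epsilon>0}. \<Lambda> \<epsilon> \<in> admissible_curves \<A> L T q I \<gamma> c) \<and>
     (\<forall>s\<in>{0..1}. \<Lambda> 0 s = \<mu> s)"

definition variation_field :: "('m, 'n::finite) chart set \<Rightarrow> real \<Rightarrow> (real \<Rightarrow> real \<Rightarrow> 'm) \<Rightarrow> real \<Rightarrow>
    ('m, 'n) tvec" where
  "variation_field \<A> \<epsilon>0 \<Lambda> s = velocity \<A> {-\<epsilon>0<..<\<epsilon>0} (\<lambda>\<epsilon>. \<Lambda> \<epsilon> s) 0"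

section \<open>The index form\<close>

text \<open>Covariant derivative of a vector field \<open>A\<close> along the curve \<open>\<mu>\<close> on \<open>[0, 1]\<close>, with reference
  vector the velocity of \<open>\<mu>\<close>.\<close>

definition covariant_deriv :: "('m, 'n::finite) chart set \<Rightarrow> ('m \<Rightarrow> ('m, 'n) tvec \<Rightarrow> real) \<Rightarrow>
    (real \<Rightarrow> 'm) \<Rightarrow> (real \<Rightarrow> ('m, 'n) tvec) \<Rightarrow> real \<Rightarrow> ('m, 'n) tvec" where
  "covariant_deriv \<A> L \<mu> A s = (\<lambda>c. if c \<in> \<A> \<and> \<mu> s \<in> fst c then
     vector_derivative (\<lambda>r. A r c) (at s within {0..1}) +
     (\<chi> i. \<Sum>j\<in>UNIV. \<Sum>k\<in>UNIV.
        chern_gamma (coord_rep \<A> L c) i j k (snd c (\<mu> s)) (velocity \<A> {0..1} \<mu> s c) *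
        A s c $ j * velocity \<A> {0..1} \<mu> s c $ k)
   else 0)"

text \<open>\<open>R\<^sub>v(A, v)v\<close> at the point \<open>p\<close>.\<close>

definition jacobi_curvature :: "('m, 'n::finite) chart set \<Rightarrow> ('m \<Rightarrow> ('m, 'n) tvec \<Rightarrow> real) \<Rightarrow> 'm \<Rightarrow>
    ('m, 'n) tvec \<Rightarrow> ('m, 'n) tvec \<Rightarrow> ('m, 'n) tvec" where
  "jacobi_curvature \<A> L p v A = (\<lambda>c. if c \<in> \<A> \<and> p \<in> fst c then
     (\<chi> i. \<Sum>j\<in>UNIV. \<Sum>k\<in>UNIV. \<Sum>l\<in>UNIV.
        hh_curvature (coord_rep \<A> L c) i j k l (snd c p) (v c) * v c $ j * A c $ k * v c $ l)
   else 0)"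

definition index_form :: "('m, 'n::finite) chart set \<Rightarrow> ('m \<Rightarrow> ('m, 'n) tvec \<Rightarrow> real) \<Rightarrow>
    (real \<Rightarrow> 'm) \<Rightarrow> (real \<Rightarrow> ('m, 'n) tvec) \<Rightarrow> (real \<Rightarrow> ('m, 'n) tvec) \<Rightarrow> real" where
  "index_form \<A> L \<mu> A B = integral {0..1} (\<lambda>s. let v = velocity \<A> {0..1} \<mu> s in
     fund_tensor \<A> L (\<mu> s) v (B s) (jacobi_curvature \<A> L (\<mu> s) v (A s)) -
     fund_tensor \<A> L (\<mu> s) v (covariant_deriv \<A> L \<mu> A s) (covariant_deriv \<A> L \<mu> B s))"

end

theory Submission
  imports Defs
begin

text \<open>
  For the admissible curves \<open>\<Lambda>(\<epsilon>, \<cdot>)\<close> with velocity \<open>v\<close> put \<open>\<psi>(\<epsilon>, s) = g\<^sub>v(v, \<partial>\<Lambda>/\<partial>\<epsilon>)\<close>, and along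
  the geodesic put \<open>\<chi>(s) = g\<^sub>v(A, A)\<close>. Both are chart-free, being vertical derivatives of \<open>L\<close> on a
  single tangent space. Since \<open>L\<close> is constant along every \<open>\<Lambda>(\<epsilon>, \<cdot>)\<close>, the derivative \<open>\<partial>\<psi>/\<partial>s\<close> is the
  Euler-Lagrange expression paired with \<open>\<partial>\<Lambda>/\<partial>\<epsilon>\<close>; hence \<open>\<psi>(0, s)\<close> is constant, which makes the first
  derivative of the arrival time vanish. Differentiating once more, \<open>\<phi> = \<partial>\<psi>/\<partial>\<epsilon> - \<chi>'/2\<close> at \<open>\<epsilon> = 0\<close> has
  the integrand of the index form as its derivative; this rests on the identity
  \<open>R\<^sup>i\<^sub>j\<^sub>m\<^sub>l y\<^sup>j y\<^sup>l = \<partial>S\<^sup>i/\<partial>x\<^sup>m - (y\<^sup>l \<partial>/\<partial>x\<^sup>l - S\<^sup>l \<partial>/\<partial>y\<^sup>l) N\<^sup>i\<^sub>m - N\<^sup>i\<^sub>l N\<^sup>l\<^sub>m\<close> for the geodesic spray \<open>S\<close>.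
  So the index form equals \<open>\<phi>(1) - \<phi>(0)\<close>, where \<open>\<phi>(0) = 0\<close> and \<open>\<phi>(1)\<close> is the second derivative of
  the arrival time times \<open>g\<^sub>v(\<gamma>', v)\<close>. As \<open>\<phi>\<close> is chart-free, its derivative can be computed at each \<open>s\<close>
  in the chart in which the integrand is evaluated, and no transformation law of the connection is
  needed.
\<close>

section \<open>Smooth functions on open sets\<close>

text \<open>The index form sees the Chern connection only contracted with the velocity:
  \<open>Gam_y\<close> turns the covariant derivative D along the geodesic into one by the nonlinear
  connection \<open>N\<close>, and the doubly contracted curvature involves only \<open>S\<close>
  and \<open>N\<close>. The term \<chi>'/2 is an integration by parts. It equals g(A, DA), while the
  mixed second derivative of \<psi> is g(A, DDA + R); subtracting trades g(A, DDA) for -g(DA, DA).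
  The start is fixed, so \<psi>(0, 0) = 0, while \<psi>(0, 1) is the first derivative of the arrival
  time times g(\<gamma>', v). Once that derivative is 0, the acceleration of \<gamma> drops out of
  the second derivative. The arrival time must itself be shown twice differentiable. An injective
  \<gamma> may return arbitrarily close to one of its own points, so that the arrival time could
  jump; continuity at \<epsilon> = 0 rules this out, and as \<gamma>' does not vanish, the inverse
  function theorem gives the rest.\<close>

definition dird :: "('a::real_normed_vector \<Rightarrow> 'b::real_normed_vector) \<Rightarrow> 'a \<Rightarrow> 'a \<Rightarrow> 'b" where
  "dird f v = (\<lambda>x. frechet_derivative f (at x) v)"

definition smooth_in :: "'a::euclidean_space set \<Rightarrow> ('a \<Rightarrow> 'b::real_normed_vector) \<Rightarrow> bool" where
  "smooth_in U f \<longleftrightarrow> (\<forall>k. Ck_on k U f)"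

text \<open>With the direction as an early argument, \<open>dird f v\<close> is again a function of
  the point, so higher derivatives are nested \<open>dird\<close>s. This form of the recursion
  replaces the simp rule \<open>Ck_on.simps(2)\<close>, which is withdrawn below.\<close>

lemma Ck_on_Suc_dird:
  "Ck_on (Suc k) U f \<longleftrightarrow> (\<forall>x\<in>U. f differentiable (at x)) \<and> (\<forall>v. Ck_on k U (dird f v))"
  by (simp add: dird_def)

declare Ck_on.simps(2) [simp del]

lemma dird_eqI: "(f has_derivative f') (at x) \<Longrightarrow> dird f v x = f' v"
  by (simp add: dird_def frechet_derivative_at[symmetric])

lemma Ck_on_imp_continuous_on: "Ck_on k U f \<Longrightarrow> continuous_on U f"
  by (cases k) (auto simp: Ck_on_Suc_dird intro!: differentiable_imp_continuous_on
      differentiable_at_imp_differentiable_on)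

lemma Ck_on_Suc_has_derivative:
  "Ck_on (Suc k) U f \<Longrightarrow> x \<in> U \<Longrightarrow> (f has_derivative (\<lambda>v. dird f v x)) (at x)"
  unfolding Ck_on_Suc_dird dird_def using frechet_derivative_works[of f "at x"] by simp

lemma Ck_on_dird: "Ck_on (Suc k) U f \<Longrightarrow> Ck_on k U (dird f v)"
  by (simp add: Ck_on_Suc_dird)

lemma Ck_on_SucD: "Ck_on (Suc k) U f \<Longrightarrow> Ck_on k U f"
proof (induction k arbitrary: f)
  case 0
  then show ?case using Ck_on_imp_continuous_on[of "Suc 0" U f] by simp
next
  case (Suc k)
  have "Ck_on k U (dird f v)" for v by (rule Suc.IH[OF Ck_on_dird[OF Suc.prems]])
  moreover have "\<forall>x\<in>U. f differentiable (at x)"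
    using Suc.prems Ck_on_Suc_dird[of "Suc k" U f] by simp
  ultimately show ?case by (simp add: Ck_on_Suc_dird)
qed

lemma smooth_in_has_derivative:
  "smooth_in U f \<Longrightarrow> x \<in> U \<Longrightarrow> (f has_derivative (\<lambda>v. dird f v x)) (at x)"
  unfolding smooth_in_def by (rule Ck_on_Suc_has_derivative[of 0]) auto

lemma smooth_in_dird: "smooth_in U f \<Longrightarrow> smooth_in U (dird f v)"
  unfolding smooth_in_def by (blast intro: Ck_on_dird)

lemma smooth_in_continuous_on: "smooth_in U f \<Longrightarrow> continuous_on U f"
  unfolding smooth_in_def by (blast intro: Ck_on_imp_continuous_on)

lemma Ck_on_cong:
  assumes "open U" "\<And>x. x \<in> U \<Longrightarrow> f x = g x" "Ck_on k U f"
  shows "Ck_on k U g"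
  using assms(2,3)
proof (induction k arbitrary: f g)
  case 0
  then show ?case by (simp cong: continuous_on_cong)
next
  case (Suc k)
  have gd: "(g has_derivative (\<lambda>v. dird f v x)) (at x)" if "x \<in> U" for x
    by (rule has_derivative_transform_within_open[OF Ck_on_Suc_has_derivative[OF Suc.prems(2) that]
        assms(1) that Suc.prems(1)])
  have "Ck_on k U (dird g v)" for v
    by (rule Suc.IH[OF _ Ck_on_dird[OF Suc.prems(2), of v]]) (simp add: dird_eqI[OF gd])
  then show ?case unfolding Ck_on_Suc_dird using gd differentiableI[OF gd] by simp
qed

text \<open>The inductive step of the closure rules below: a \<open>has_derivative\<close> rule
  supplies the formula \<open>D\<close>, and \<open>D x v\<close> only has to be recognised as
  C^k.\<close>

lemma Ck_on_SucI:
  assumes "open U" "\<And>x. x \<in> U \<Longrightarrow> (f has_derivative D x) (at x)"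
    and "\<And>v. Ck_on k U (\<lambda>x. D x v)"
  shows "Ck_on (Suc k) U f"
  unfolding Ck_on_Suc_dird
proof (intro conjI allI ballI)
  show "f differentiable (at x)" if "x \<in> U" for x by (rule differentiableI[OF assms(2)[OF that]])
  show "Ck_on k U (dird f v)" for v
    by (rule Ck_on_cong[OF assms(1) _ assms(3)[of v]]) (simp add: dird_eqI[OF assms(2)])
qed

lemma smooth_in_cong:
  "open U \<Longrightarrow> smooth_in U f \<Longrightarrow> (\<And>x. x \<in> U \<Longrightarrow> f x = g x) \<Longrightarrow> smooth_in U g"
  unfolding smooth_in_def by (auto intro: Ck_on_cong)

lemma Ck_on_subset: "Ck_on k U f \<Longrightarrow> V \<subseteq> U \<Longrightarrow> Ck_on k V f"
  by (induction k arbitrary: f) (auto simp: Ck_on_Suc_dird intro: continuous_on_subset)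

lemma smooth_in_subset: "smooth_in U f \<Longrightarrow> V \<subseteq> U \<Longrightarrow> smooth_in V f"
  unfolding smooth_in_def by (auto intro: Ck_on_subset)

text \<open>Continuity and differentiability at a point depend on a neighbourhood only, and by
  induction so does everything about the directional derivatives. Needed because
  \<open>smooth_on\<close> may supply a different extension around every point.\<close>

lemma Ck_on_local:
  assumes "\<And>x. x \<in> U \<Longrightarrow> \<exists>V. open V \<and> x \<in> V \<and> Ck_on k V f"
  shows "Ck_on k U f"
  using assms
proof (induction k arbitrary: f)
  case 0
  show ?case
  proof (simp, rule continuous_at_imp_continuous_on, rule ballI)
    fix x assume "x \<in> U"
    then obtain V where "open V" "x \<in> V" "continuous_on V f" using 0 by auto
    then show "isCont f x" by (simp add: continuous_on_eq_continuous_at)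
  qed
next
  case (Suc k)
  show ?case
    unfolding Ck_on_Suc_dird
  proof (intro conjI allI ballI)
    show "f differentiable (at x)" if "x \<in> U" for x
      using Suc.prems[OF that] by (auto simp: Ck_on_Suc_dird)
    show "Ck_on k U (dird f v)" for v
      by (rule Suc.IH) (use Suc.prems Ck_on_dird in fast)
  qed
qed

text \<open>On an open set each local extension agrees with \<open>f\<close> near its point, so
  differentiating the extension is differentiating \<open>f\<close>.\<close>

lemma smooth_on_open:
  assumes "open S" "smooth_on S f"
  shows "smooth_in S f"
  unfolding smooth_in_def
proof (intro allI Ck_on_local)
  fix k x assume "x \<in> S"
  then obtain U F where UF: "open U" "x \<in> U" "Ck_on k U F" "\<forall>z\<in>U \<inter> S. F z = f z"
    using assms(2) unfolding smooth_on_def by blast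
  have "Ck_on k (U \<inter> S) f"
    by (rule Ck_on_cong[of _ F]) (use UF assms in \<open>auto intro: Ck_on_subset\<close>)
  then show "\<exists>V. open V \<and> x \<in> V \<and> Ck_on k V f"
    using UF assms \<open>x \<in> S\<close> by (intro exI[of _ "U \<inter> S"]) auto
qed

lemma Ck_on_const: "Ck_on k U (\<lambda>x. c)"
proof (induction k arbitrary: c)
  case (Suc k)
  have "dird (\<lambda>x::'a. c) v = (\<lambda>x. 0)" for v by (auto simp: dird_def)
  then show ?case using Suc by (auto simp: Ck_on_Suc_dird)
qed auto

lemma Ck_on_bounded_linear:
  assumes "bounded_linear f" shows "Ck_on k U f"
proof (cases k)
  case 0
  then show ?thesis using assms by (simp add: linear_continuous_on)
next
  case (Suc n)
  have D: "(f has_derivative f) (at x)" for x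
    using bounded_linear.has_derivative[OF assms has_derivative_ident] .
  have "f differentiable (at x)" for x by (rule differentiableI[OF D])
  moreover have "dird f v = (\<lambda>x. f v)" for v by (rule ext, rule dird_eqI[OF D])
  ultimately show ?thesis using Suc Ck_on_const by (auto simp: Ck_on_Suc_dird)
qed

lemma Ck_on_linear_compose:
  assumes "bounded_linear L" "Ck_on k U f" "open U"
  shows "Ck_on k U (\<lambda>x. L (f x))"
  using assms(2)
proof (induction k arbitrary: f)
  case 0
  then show ?case using assms bounded_linear.continuous_on by fastforce
next
  case (Suc k)
  show ?case
    by (rule Ck_on_SucI[OF assms(3) bounded_linear.has_derivative[OF assms(1)
        Ck_on_Suc_has_derivative[OF Suc.prems]] Suc.IH[OF Ck_on_dird[OF Suc.prems]]])
qed

lemma Ck_on_add: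
  assumes "Ck_on k U f" "Ck_on k U g" "open U"
  shows "Ck_on k U (\<lambda>x. f x + g x)"
  using assms(1,2)
proof (induction k arbitrary: f g)
  case 0
  then show ?case by (auto intro: continuous_intros)
next
  case (Suc k)
  show ?case
    by (rule Ck_on_SucI[OF assms(3) has_derivative_add[OF
        Ck_on_Suc_has_derivative[OF Suc.prems(1)] Ck_on_Suc_has_derivative[OF Suc.prems(2)]]
        Suc.IH[OF Ck_on_dird[OF Suc.prems(1)] Ck_on_dird[OF Suc.prems(2)]]])
qed

lemma Ck_on_scaleR:
  fixes f :: "'a::euclidean_space \<Rightarrow> real" and g :: "'a \<Rightarrow> 'b::real_normed_vector"
  assumes "Ck_on k U f" "Ck_on k U g" "open U"
  shows "Ck_on k U (\<lambda>x. f x *\<^sub>R g x)"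
  using assms(1,2)
proof (induction k arbitrary: f g)
  case 0
  then show ?case by (auto intro: continuous_intros)
next
  case (Suc k)
  note [intro] = Ck_on_SucD[OF Suc.prems(1)] Ck_on_SucD[OF Suc.prems(2)]
  show ?case
    by (rule Ck_on_SucI[OF assms(3) has_derivative_scaleR[OF
        Ck_on_Suc_has_derivative[OF Suc.prems(1)] Ck_on_Suc_has_derivative[OF Suc.prems(2)]]
        Ck_on_add[OF Suc.IH[OF _ Ck_on_dird[OF Suc.prems(2)]]
          Suc.IH[OF Ck_on_dird[OF Suc.prems(1)]] assms(3)]]) auto
qed

lemma smooth_in_const [intro]: "smooth_in U (\<lambda>x. c)"
  by (simp add: smooth_in_def Ck_on_const)

lemma smooth_in_bounded_linear: "bounded_linear f \<Longrightarrow> smooth_in U f"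
  by (simp add: smooth_in_def Ck_on_bounded_linear)

lemma smooth_in_linear_compose:
  "bounded_linear L \<Longrightarrow> smooth_in U f \<Longrightarrow> open U \<Longrightarrow> smooth_in U (\<lambda>x. L (f x))"
  by (simp add: smooth_in_def Ck_on_linear_compose)

lemma smooth_in_add:
  "smooth_in U f \<Longrightarrow> smooth_in U g \<Longrightarrow> open U \<Longrightarrow> smooth_in U (\<lambda>x. f x + g x)"
  by (simp add: smooth_in_def Ck_on_add)

lemma smooth_in_scaleR:
  fixes f :: "'a::euclidean_space \<Rightarrow> real"
  shows "smooth_in U f \<Longrightarrow> smooth_in U g \<Longrightarrow> open U \<Longrightarrow> smooth_in U (\<lambda>x. f x *\<^sub>R g x)"
  by (simp add: smooth_in_def Ck_on_scaleR)

lemma smooth_in_mult: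
  fixes f g :: "'a::euclidean_space \<Rightarrow> real"
  shows "smooth_in U f \<Longrightarrow> smooth_in U g \<Longrightarrow> open U \<Longrightarrow> smooth_in U (\<lambda>x. f x * g x)"
  using smooth_in_scaleR[of U f g] by simp

lemma smooth_in_diff:
  fixes f g :: "'a::euclidean_space \<Rightarrow> real"
  shows "smooth_in U f \<Longrightarrow> smooth_in U g \<Longrightarrow> open U \<Longrightarrow> smooth_in U (\<lambda>x. f x - g x)"
  using smooth_in_add[of U f "\<lambda>x. (-1) * g x"] smooth_in_mult[of U "\<lambda>x. -1" g, OF smooth_in_const]
  by simp

lemma smooth_in_sum:
  assumes "open U" "\<And>i. i \<in> A \<Longrightarrow> smooth_in U (f i)"
  shows "smooth_in U (\<lambda>x. \<Sum>i\<in>A. f i x)"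
  using assms(2)
  by (induction A rule: infinite_finite_induct) (auto intro: smooth_in_add assms(1))

lemma smooth_in_prod:
  fixes f :: "'i \<Rightarrow> 'a::euclidean_space \<Rightarrow> real"
  assumes "open U" "\<And>i. i \<in> A \<Longrightarrow> smooth_in U (f i)"
  shows "smooth_in U (\<lambda>x. \<Prod>i\<in>A. f i x)"
  using assms(2)
  by (induction A rule: infinite_finite_induct) (auto intro: smooth_in_mult assms(1))

text \<open>The derivative of 1/f is -(1/f)^2 df, so the induction hypothesis for 1/f and the
  product rule give one more order.\<close>

lemma Ck_on_inverse:
  fixes f :: "'a::euclidean_space \<Rightarrow> real"
  assumes "Ck_on k U f" "open U" "\<And>x. x \<in> U \<Longrightarrow> f x \<noteq> 0"
  shows "Ck_on k U (\<lambda>x. inverse (f x))"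
  using assms(1)
proof (induction k)
  case 0
  then show ?case using assms(3) by (auto intro: continuous_intros)
next
  case (Suc k)
  have D: "((\<lambda>x. inverse (f x)) has_derivative
      (\<lambda>v. (-1) *\<^sub>R ((inverse (f x) * inverse (f x)) *\<^sub>R dird f v x))) (at x)" if "x \<in> U" for x
    by (rule has_derivative_eq_rhs[OF Deriv.has_derivative_inverse[OF assms(3)[OF that]
        Ck_on_Suc_has_derivative[OF Suc.prems that]]]) auto
  have k: "Ck_on k U (\<lambda>x. inverse (f x))" by (rule Suc.IH[OF Ck_on_SucD[OF Suc.prems]])
  have kk: "Ck_on k U (\<lambda>x. inverse (f x) * inverse (f x))"
    using Ck_on_scaleR[OF k k assms(2)] by simp
  show ?case
    by (rule Ck_on_SucI[OF assms(2) D Ck_on_scaleR[OF Ck_on_const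
        Ck_on_scaleR[OF kk Ck_on_dird[OF Suc.prems] assms(2)] assms(2)]])
qed

lemma smooth_in_divide:
  fixes f g :: "'a::euclidean_space \<Rightarrow> real"
  shows "smooth_in U f \<Longrightarrow> smooth_in U g \<Longrightarrow> open U \<Longrightarrow> (\<And>x. x \<in> U \<Longrightarrow> g x \<noteq> 0) \<Longrightarrow>
    smooth_in U (\<lambda>x. f x / g x)"
  unfolding divide_inverse
  by (rule smooth_in_mult) (simp_all add: smooth_in_def Ck_on_inverse)

text \<open>In df(h(x))(dh(x) v) both the point and the direction vary with x. Expanding the
  direction in \<open>Basis\<close> gives a finite sum of scalars times
  \<open>dird f b (h x)\<close>, and the induction hypothesis applies to each
  \<open>dird f b\<close>.\<close>

lemma Ck_on_compose:
  fixes h :: "'a::euclidean_space \<Rightarrow> 'b::euclidean_space"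
  assumes "Ck_on k V f" "Ck_on k U h" "open U" "open V" "h ` U \<subseteq> V"
  shows "Ck_on k U (\<lambda>x. f (h x))"
  using assms(1,2)
proof (induction k arbitrary: f)
  case 0
  then show ?case using assms(5) continuous_on_compose2[of V f U h] by simp
next
  case (Suc k)
  have D: "((\<lambda>x. f (h x)) has_derivative
      (\<lambda>v. \<Sum>b\<in>Basis. (dird h v x \<bullet> b) *\<^sub>R dird f b (h x))) (at x)" if x: "x \<in> U" for x
  proof -
    have f': "(f has_derivative (\<lambda>w. dird f w (h x))) (at (h x))"
      by (rule Ck_on_Suc_has_derivative[OF Suc.prems(1)]) (use assms(5) x in auto)
    have l: "linear (\<lambda>w. dird f w (h x))" using f' by (rule has_derivative_linear)
    have w: "dird f w (h x) = (\<Sum>b\<in>Basis. (w \<bullet> b) *\<^sub>R dird f b (h x))" for w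
    proof -
      have "dird f w (h x) = dird f (\<Sum>b\<in>Basis. (w \<bullet> b) *\<^sub>R b) (h x)"
        by (simp add: euclidean_representation)
      also have "\<dots> = (\<Sum>b\<in>Basis. (w \<bullet> b) *\<^sub>R dird f b (h x))"
        by (simp add: linear_sum[OF l] linear_scale[OF l])
      finally show ?thesis .
    qed
    show ?thesis
      using diff_chain_at[OF Ck_on_Suc_has_derivative[OF Suc.prems(2) x] f']
      by (simp only: o_def w[of "dird h v x" for v])
  qed
  have s: "Ck_on k U (\<lambda>x. \<Sum>b\<in>B. F b x)" if "\<And>b. Ck_on k U (F b)"
    for B :: "'b set" and F :: "'b \<Rightarrow> 'a \<Rightarrow> 'c"
  proof (induction B rule: infinite_finite_induct)
    case (insert b B)
    then show ?case using Ck_on_add[OF that[of b] insert.IH assms(3)] by simp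
  qed (simp_all add: Ck_on_const)
  have t: "Ck_on k U (\<lambda>x. (dird h v x \<bullet> b) *\<^sub>R dird f b (h x))" for v b
  proof (rule Ck_on_scaleR[OF _ _ assms(3)])
    show "Ck_on k U (\<lambda>x. dird h v x \<bullet> b)"
      by (rule Ck_on_linear_compose[OF bounded_linear_inner_left Ck_on_dird[OF Suc.prems(2)] assms(3)])
    show "Ck_on k U (\<lambda>x. dird f b (h x))"
      by (rule Suc.IH[OF Ck_on_dird[OF Suc.prems(1)] Ck_on_SucD[OF Suc.prems(2)]])
  qed
  have st: "Ck_on k U (\<lambda>x. \<Sum>b\<in>Basis. (dird h v x \<bullet> b) *\<^sub>R dird f b (h x))" for v
    by (rule s) (rule t)
  show ?case by (rule Ck_on_SucI[OF assms(3) D st])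
qed

lemma smooth_in_compose:
  fixes h :: "'a::euclidean_space \<Rightarrow> 'b::euclidean_space"
  shows "smooth_in V f \<Longrightarrow> smooth_in U h \<Longrightarrow> open U \<Longrightarrow> open V \<Longrightarrow> h ` U \<subseteq> V \<Longrightarrow>
    smooth_in U (\<lambda>x. f (h x))"
  by (simp add: smooth_in_def Ck_on_compose[where V = V])

lemma smooth_in_Pair:
  assumes "smooth_in U f" "smooth_in U g" "open U"
  shows "smooth_in U (\<lambda>x. (f x, g x))"
proof -
  have "bounded_linear (\<lambda>x. (x, 0))" "bounded_linear (\<lambda>x. (0, x))"
    by (intro bounded_linear_Pair bounded_linear_ident bounded_linear_zero)+
  then have "smooth_in U (\<lambda>x. (f x, 0) + (0, g x))"
    by (intro smooth_in_add smooth_in_linear_compose[of "\<lambda>x. (x, 0)"]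
        smooth_in_linear_compose[of "\<lambda>x. (0, x)"] assms)
  then show ?thesis by simp
qed

lemma smooth_in_nth:
  fixes f :: "'a::euclidean_space \<Rightarrow> real ^ 'n"
  shows "smooth_in U f \<Longrightarrow> open U \<Longrightarrow> smooth_in U (\<lambda>x. f x $ i)"
  by (rule smooth_in_linear_compose[OF bounded_linear_vec_nth])

section \<open>Directional derivatives and their symmetry\<close>

lemma dird_linear:
  assumes "smooth_in U f" "x \<in> U"
  shows "dird f (a *\<^sub>R u + b *\<^sub>R v) x = a *\<^sub>R dird f u x + b *\<^sub>R dird f v x"
  using linear_add[OF has_derivative_linear[OF smooth_in_has_derivative[OF assms]]]
    linear_scale[OF has_derivative_linear[OF smooth_in_has_derivative[OF assms]]]
  by simp

lemma dird_along:
  fixes f :: "'a::euclidean_space \<Rightarrow> 'b::real_normed_vector"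
  assumes "smooth_in U f" "x + t *\<^sub>R v \<in> U"
  shows "((\<lambda>t. f (x + t *\<^sub>R v)) has_vector_derivative dird f v (x + t *\<^sub>R v)) (at t)"
proof -
  have 1: "((\<lambda>t. x + t *\<^sub>R v) has_derivative (\<lambda>h. h *\<^sub>R v)) (at t)"
    by (auto intro!: derivative_eq_intros)
  show ?thesis
    using diff_chain_at[OF 1 smooth_in_has_derivative[OF assms]]
    by (simp add: has_vector_derivative_def o_def dird_linear[OF assms, of _ v 0 0, simplified])
qed

text \<open>The mean value theorem is used twice: along u for the difference of f across h v, then
  along v for \<open>dird f u\<close>. The second difference is symmetric in u and v, which is what
  \<open>dird_commute\<close> exploits.\<close>

lemma mixed_difference:
  fixes f :: "'a::euclidean_space \<Rightarrow> real"
  assumes f: "smooth_in U f" and h: "h > 0"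
    and U: "\<And>s t. 0 \<le> s \<Longrightarrow> s \<le> h \<Longrightarrow> 0 \<le> t \<Longrightarrow> t \<le> h \<Longrightarrow> x + s *\<^sub>R u + t *\<^sub>R v \<in> U"
  shows "\<exists>s t. 0 \<le> s \<and> s \<le> h \<and> 0 \<le> t \<and> t \<le> h \<and>
    f (x + h *\<^sub>R u + h *\<^sub>R v) - f (x + h *\<^sub>R u) - f (x + h *\<^sub>R v) + f x =
      h * (h * dird (dird f u) v (x + s *\<^sub>R u + t *\<^sub>R v))"
proof -
  define G where "G s = f ((x + h *\<^sub>R v) + s *\<^sub>R u) - f (x + s *\<^sub>R u)" for s
  define G' where "G' s = dird f u ((x + h *\<^sub>R v) + s *\<^sub>R u) - dird f u (x + s *\<^sub>R u)" for s
  have "(G has_real_derivative G' s) (at s)" if "0 \<le> s" "s \<le> h" for s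
    unfolding G_def G'_def has_real_derivative_iff_has_vector_derivative
    using U[of s h] U[of s 0] that h
    by (intro has_vector_derivative_diff dird_along[OF f]) (auto simp: algebra_simps)
  then obtain s where s: "0 < s" "s < h" "G h - G 0 = h * G' s"
    using MVT2[OF h, of G G'] by auto
  have "((\<lambda>t. dird f u ((x + s *\<^sub>R u) + t *\<^sub>R v)) has_real_derivative
      dird (dird f u) v ((x + s *\<^sub>R u) + t *\<^sub>R v)) (at t)" if "0 \<le> t" "t \<le> h" for t
    unfolding has_real_derivative_iff_has_vector_derivative
    using U[of s t] that s by (intro dird_along[OF smooth_in_dird[OF f]]) auto
  then obtain t where t: "0 < t" "t < h" "dird f u (x + s *\<^sub>R u + h *\<^sub>R v) - dird f u (x + s *\<^sub>R u)
      = h * dird (dird f u) v (x + s *\<^sub>R u + t *\<^sub>R v)"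
    using MVT2[OF h, of "\<lambda>t. dird f u ((x + s *\<^sub>R u) + t *\<^sub>R v)"
       "\<lambda>t. dird (dird f u) v ((x + s *\<^sub>R u) + t *\<^sub>R v)"] by auto
  show ?thesis
    using s t by (intro exI[of _ s] exI[of _ t]) (auto simp: G_def G'_def algebra_simps)
qed

text \<open>The symmetric second difference equals h^2 times either mixed derivative, taken at two
  points within distance h K of x. As h tends to 0, continuity of both mixed derivatives identifies
  them at x.\<close>

lemma dird_commute:
  fixes f :: "'a::euclidean_space \<Rightarrow> real"
  assumes U: "open U" and f: "smooth_in U f" and x: "x \<in> U"
  shows "dird (dird f u) v x = dird (dird f v) u x"
proof -
  obtain r where r: "r > 0" "ball x r \<subseteq> U" using U x open_contains_ball by blast
  \<comment> \<open>Since 0 \<le> s, t \<le> h, the point x + s u + t v is within h K of x; the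
    summand 1 keeps K positive when both directions vanish.\<close>
  define K where "K = norm u + norm v + 1"
  have K: "K > 0" by (simp add: K_def add_nonneg_pos)
  have near: "dist (x + s *\<^sub>R u + t *\<^sub>R v) x \<le> h * K" if "0 \<le> s" "s \<le> h" "0 \<le> t" "t \<le> h" for s t h
  proof -
    have "dist (x + s *\<^sub>R u + t *\<^sub>R v) x = norm (s *\<^sub>R u + t *\<^sub>R v)"
      by (simp add: dist_norm algebra_simps)
    also have "\<dots> \<le> norm (s *\<^sub>R u) + norm (t *\<^sub>R v)" by (rule norm_triangle_ineq)
    also have "\<dots> \<le> h * norm u + h * norm v"
      using that by (auto intro!: add_mono mult_right_mono)
    also have "\<dots> \<le> h * K" using that by (simp add: K_def algebra_simps)
    finally show ?thesis .
  qed
  have ex: "\<exists>p q. dist p x \<le> h * K \<and> dist q x \<le> h * K \<and> dird (dird f u) v p = dird (dird f v) u q"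
    if h: "h > 0" "h * K < r" for h
  proof -
    have in_U: "x + s *\<^sub>R u + t *\<^sub>R v \<in> U" "x + s *\<^sub>R v + t *\<^sub>R u \<in> U"
      if "0 \<le> s" "s \<le> h" "0 \<le> t" "t \<le> h" for s t
    proof -
      have "x + s *\<^sub>R u + t *\<^sub>R v \<in> ball x r"
        using le_less_trans[OF near[OF that] h(2)] by (simp add: dist_commute)
      then show "x + s *\<^sub>R u + t *\<^sub>R v \<in> U" using r(2) by blast
      have "x + t *\<^sub>R u + s *\<^sub>R v \<in> ball x r"
        using le_less_trans[OF near[OF that(3,4,1,2)] h(2)] by (simp add: dist_commute)
      moreover have "x + t *\<^sub>R u + s *\<^sub>R v = x + s *\<^sub>R v + t *\<^sub>R u" by (simp only: ac_simps)
      ultimately show "x + s *\<^sub>R v + t *\<^sub>R u \<in> U" using r(2) by (metis subsetD)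
    qed
    obtain s t where st: "0 \<le> s" "s \<le> h" "0 \<le> t" "t \<le> h"
      "f (x + h *\<^sub>R u + h *\<^sub>R v) - f (x + h *\<^sub>R u) - f (x + h *\<^sub>R v) + f x =
      h * (h * dird (dird f u) v (x + s *\<^sub>R u + t *\<^sub>R v))"
      using mixed_difference[OF f h(1), of x u v] in_U by blast
    obtain s' t' where st': "0 \<le> s'" "s' \<le> h" "0 \<le> t'" "t' \<le> h"
      "f (x + h *\<^sub>R v + h *\<^sub>R u) - f (x + h *\<^sub>R v) - f (x + h *\<^sub>R u) + f x =
      h * (h * dird (dird f v) u (x + s' *\<^sub>R v + t' *\<^sub>R u))"
      using mixed_difference[OF f h(1), of x v u] in_U by blast
    have e: "x + h *\<^sub>R v + h *\<^sub>R u = x + h *\<^sub>R u + h *\<^sub>R v" by (simp only: ac_simps)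
    have "h * (h * dird (dird f u) v (x + s *\<^sub>R u + t *\<^sub>R v)) =
        h * (h * dird (dird f v) u (x + s' *\<^sub>R v + t' *\<^sub>R u))"
      using st(5) st'(5)[unfolded e] by linarith
    then have "dird (dird f u) v (x + s *\<^sub>R u + t *\<^sub>R v) = dird (dird f v) u (x + s' *\<^sub>R v + t' *\<^sub>R u)"
      using h(1) by simp
    moreover have "x + t' *\<^sub>R u + s' *\<^sub>R v = x + s' *\<^sub>R v + t' *\<^sub>R u" by (simp only: ac_simps)
    from near[OF st'(3,4,1,2), unfolded this]
    have "dist (x + s' *\<^sub>R v + t' *\<^sub>R u) x \<le> h * K" .
    ultimately show ?thesis using near[OF st(1-4)] by blast
  qed
  \<comment> \<open>The factor r/(2K) makes \<open>a n * K\<close> equal to r/2 divided by n + 1,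
    which stays below r and tends to 0.\<close>
  define a where "a n = r / (2 * K) * inverse (real (Suc n))" for n
  have aK: "a n * K = r / 2 * inverse (real (Suc n))" for n using K by (simp add: a_def)
  have a: "a n > 0" "a n * K < r" for n
  proof -
    show "a n > 0" using r K by (simp add: a_def)
    have "inverse (real (Suc n)) \<le> 1" by (simp add: inverse_le_1_iff)
    then have "r / 2 * inverse (real (Suc n)) \<le> r / 2 * 1" using r by (intro mult_left_mono) auto
    then show "a n * K < r" using r(1) aK[of n] by linarith
  qed
  have "\<forall>n. \<exists>p q. dist p x \<le> a n * K \<and> dist q x \<le> a n * K \<and>
      dird (dird f u) v p = dird (dird f v) u q"
    using ex a by blast
  then obtain p q where pq: "\<And>n. dist (p n) x \<le> a n * K" "\<And>n. dist (q n) x \<le> a n * K"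
      "\<And>n. dird (dird f u) v (p n) = dird (dird f v) u (q n)"
    by metis
  have "(\<lambda>n. r / 2 * inverse (real (Suc n))) \<longlonglongrightarrow> r / 2 * 0"
    by (intro tendsto_mult tendsto_const LIMSEQ_inverse_real_of_nat)
  then have a0: "(\<lambda>n. a n * K) \<longlonglongrightarrow> 0" unfolding aK by simp
  have "(\<lambda>n. dist (p n) x) \<longlonglongrightarrow> 0" "(\<lambda>n. dist (q n) x) \<longlonglongrightarrow> 0"
    by (rule tendsto_sandwich[OF _ _ tendsto_const a0]; simp add: pq)+
  then have "p \<longlonglongrightarrow> x" "q \<longlonglongrightarrow> x" by (simp_all only: tendsto_dist_iff[symmetric])
  moreover have "isCont (dird (dird f u) v) x" "isCont (dird (dird f v) u) x"
    using smooth_in_continuous_on[OF smooth_in_dird[OF smooth_in_dird[OF f]]] U x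
      continuous_on_eq_continuous_at[OF U] by blast+
  ultimately have "(\<lambda>n. dird (dird f u) v (p n)) \<longlonglongrightarrow> dird (dird f u) v x"
    "(\<lambda>n. dird (dird f v) u (q n)) \<longlonglongrightarrow> dird (dird f v) u x"
    using isCont_tendsto_compose by blast+
  then show ?thesis using pq(3) LIMSEQ_unique by simp
qed

section \<open>Finsler geometry in a chart\<close>

lemma dird_mult:
  fixes f g :: "'a::euclidean_space \<Rightarrow> real"
  assumes "smooth_in U f" "smooth_in U g" "x \<in> U"
  shows "dird (\<lambda>x. f x * g x) v x = dird f v x * g x + f x * dird g v x"
  by (rule dird_eqI, rule has_derivative_eq_rhs[OF has_derivative_mult[OF
        smooth_in_has_derivative[OF assms(1,3)] smooth_in_has_derivative[OF assms(2,3)]]]) auto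

lemma dird_cmult:
  fixes f :: "'a::euclidean_space \<Rightarrow> real"
  assumes "smooth_in U f" "x \<in> U"
  shows "dird (\<lambda>x. c * f x) v x = c * dird f v x"
  by (rule dird_eqI, rule has_derivative_mult_right[OF smooth_in_has_derivative[OF assms]])

lemma dird_add:
  assumes "smooth_in U f" "smooth_in U g" "x \<in> U"
  shows "dird (\<lambda>x. f x + g x) v x = dird f v x + dird g v x"
  by (rule dird_eqI, rule has_derivative_add[OF
        smooth_in_has_derivative[OF assms(1,3)] smooth_in_has_derivative[OF assms(2,3)]])

lemma dird_diff:
  assumes "smooth_in U f" "smooth_in U g" "x \<in> U"
  shows "dird (\<lambda>x. f x - g x) v x = dird f v x - dird g v x"
  by (rule dird_eqI, rule has_derivative_diff[OF
        smooth_in_has_derivative[OF assms(1,3)] smooth_in_has_derivative[OF assms(2,3)]])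

lemma dird_sum:
  assumes "\<And>i. i \<in> A \<Longrightarrow> smooth_in U (f i)" "x \<in> U"
  shows "dird (\<lambda>x. \<Sum>i\<in>A. f i x) v x = (\<Sum>i\<in>A. dird (f i) v x)"
  by (rule dird_eqI, rule has_derivative_sum)
    (use assms in \<open>auto intro: smooth_in_has_derivative\<close>)

lemma dird_cong:
  assumes "open U" "smooth_in U f" "x \<in> U" "\<And>z. z \<in> U \<Longrightarrow> f z = g z"
  shows "dird g v x = dird f v x"
  by (rule dird_eqI, rule has_derivative_transform_within_open[OF
        smooth_in_has_derivative[OF assms(2,3)] assms(1,3)]) (use assms(4) in auto)

lemma dird_sum_direction:
  assumes "smooth_in U f" "x \<in> U"
  shows "dird f (\<Sum>i\<in>A. c i *\<^sub>R e i) x = (\<Sum>i\<in>A. c i *\<^sub>R dird f (e i) x)"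
  by (simp add: linear_sum[OF has_derivative_linear[OF smooth_in_has_derivative[OF assms]]]
    linear_scale[OF has_derivative_linear[OF smooth_in_has_derivative[OF assms]]])

lemma dird_pair_expand:
  fixes h :: "(real ^ 'n) \<times> (real ^ 'n) \<Rightarrow> real"
  assumes "smooth_in U h" "z \<in> U"
  shows "dird h (a, b) z =
    (\<Sum>k\<in>UNIV. a $ k * dird h (axis k 1, 0) z) + (\<Sum>k\<in>UNIV. b $ k * dird h (0, axis k 1) z)"
proof -
  have "(a, b) = (1::real) *\<^sub>R (\<Sum>k\<in>UNIV. a $ k *\<^sub>R (axis k (1::real), 0)) +
      (1::real) *\<^sub>R (\<Sum>k\<in>UNIV. b $ k *\<^sub>R (0::real^'n, axis k (1::real)))"
    by (simp add: prod_eq_iff fst_sum snd_sum basis_expansion scalar_mult_eq_scaleR[symmetric])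
  then show ?thesis
    by (simp only: dird_linear[OF assms] dird_sum_direction[OF assms]) simp
qed

lemma dird_snd_nth: "dird (\<lambda>z::(real ^ 'n) \<times> (real ^ 'n). snd z $ j) v z = snd v $ j"
proof -
  have "bounded_linear (\<lambda>z::(real ^ 'n) \<times> (real ^ 'n). snd z $ j)"
    by (intro bounded_linear_compose[OF bounded_linear_vec_nth] bounded_linear_snd)
  from dird_eqI[OF bounded_linear.has_derivative[OF this has_derivative_ident]] show ?thesis by simp
qed

lemma smooth_in_snd_nth: "smooth_in U (\<lambda>z::(real ^ 'n) \<times> (real ^ 'n). snd z $ j)"
  by (intro smooth_in_bounded_linear bounded_linear_compose[OF bounded_linear_vec_nth]
      bounded_linear_snd)

text \<open>Bridge from the one-variable \<open>deriv\<close> of the coordinate definitions to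
  \<open>dird\<close> on the product space. As \<open>W\<close> is open, agreement of
  \<open>f\<close> with the smooth \<open>h\<close> on \<open>W\<close> is enough; values elsewhere,
  such as on the zero section, are never seen.\<close>

lemma partial_x_eq:
  fixes f :: "'n::finite lagr"
  assumes W: "open W" "smooth_in W h" "(x, y) \<in> W" and eq: "\<And>x y. (x, y) \<in> W \<Longrightarrow> f x y = h (x, y)"
  shows "partial_x i f x y = dird h (axis i 1, 0) (x, y)"
proof -
  have h: "dird (\<lambda>z. f (fst z) (snd z)) v (x, y) = dird h v (x, y)" for v
    by (rule dird_cong[OF W]) (auto simp: eq)
  have s: "smooth_in W (\<lambda>z. f (fst z) (snd z))"
    by (rule smooth_in_cong[OF W(1,2)]) (auto simp: eq)
  have "((\<lambda>t. f (x + t *\<^sub>R axis i 1) y) has_vector_derivative dird h (axis i 1, 0) (x, y)) (at 0)"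
    using dird_along[OF s, of "(x, y)" 0 "(axis i 1, 0)"] W(3) by (simp add: h)
  then show ?thesis unfolding partial_x_def
    by (intro DERIV_imp_deriv) (simp add: has_real_derivative_iff_has_vector_derivative)
qed

lemma partial_y_eq:
  fixes f :: "'n::finite lagr"
  assumes W: "open W" "smooth_in W h" "(x, y) \<in> W" and eq: "\<And>x y. (x, y) \<in> W \<Longrightarrow> f x y = h (x, y)"
  shows "partial_y i f x y = dird h (0, axis i 1) (x, y)"
proof -
  have h: "dird (\<lambda>z. f (fst z) (snd z)) v (x, y) = dird h v (x, y)" for v
    by (rule dird_cong[OF W]) (auto simp: eq)
  have s: "smooth_in W (\<lambda>z. f (fst z) (snd z))"
    by (rule smooth_in_cong[OF W(1,2)]) (auto simp: eq)
  have "((\<lambda>t. f x (y + t *\<^sub>R axis i 1)) has_vector_derivative dird h (0, axis i 1) (x, y)) (at 0)"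
    using dird_along[OF s, of "(x, y)" 0 "(0, axis i 1)"] W(3) by (simp add: h)
  then show ?thesis unfolding partial_y_def
    by (intro DERIV_imp_deriv) (simp add: has_real_derivative_iff_has_vector_derivative)
qed

section \<open>Smoothness of the inverse metric\<close>

lemma smooth_in_det:
  fixes A :: "'a::euclidean_space \<Rightarrow> real ^ 'n ^ 'n::finite"
  assumes "open U" "\<And>i j. smooth_in U (\<lambda>z. A z $ i $ j)"
  shows "smooth_in U (\<lambda>z. det (A z))"
  unfolding det_def
  by (intro smooth_in_sum smooth_in_mult smooth_in_const smooth_in_prod assms)

lemma
  assumes "invertible A"
  shows matrix_inv_right: "A ** matrix_inv A = mat 1" and matrix_inv_left: "matrix_inv A ** A = mat 1"
  using someI_ex[of "\<lambda>A'. A ** A' = mat 1 \<and> A' ** A = mat 1"] assms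
  unfolding matrix_inv_def invertible_def by blast+

text \<open>Cramer's rule writes an entry of the inverse as a quotient of determinants, which are
  polynomials in smooth entries.\<close>

lemma smooth_in_matrix_inv:
  fixes A :: "'a::euclidean_space \<Rightarrow> real ^ 'n ^ 'n::finite"
  assumes U: "open U" and A: "\<And>i j. smooth_in U (\<lambda>z. A z $ i $ j)"
    and inv: "\<And>z. z \<in> U \<Longrightarrow> invertible (A z)"
  shows "smooth_in U (\<lambda>z. matrix_inv (A z) $ i $ j)"
proof -
  \<comment> \<open>Column i of \<open>A z\<close> is replaced by the unit vector e_j: the numerator
    in Cramer's rule for the system A w = e_j.\<close>
  define B where "B z = (\<chi> k l. if l = i then (axis j 1 :: real ^ 'n) $ k else A z $ k $ l)" for z
  have d: "det (A z) \<noteq> 0" if "z \<in> U" for z using inv[OF that] by (simp add: invertible_det_nz)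
  have eq: "det (B z) / det (A z) = matrix_inv (A z) $ i $ j" if z: "z \<in> U" for z
  proof -
    have "A z *v (matrix_inv (A z) *v axis j 1) = axis j 1"
      by (simp add: matrix_vector_mul_assoc matrix_inv_right[OF inv[OF z]])
    then have "matrix_inv (A z) *v axis j 1 =
        (\<chi> k. det (\<chi> i l. if l = k then (axis j 1 :: real ^ 'n) $ i else A z $ i $ l) / det (A z))"
      using cramer[OF d[OF z]] by simp
    then have "(matrix_inv (A z) *v axis j 1) $ i = det (B z) / det (A z)"
      by (simp add: B_def)
    then show ?thesis by (simp add: matrix_vector_mult_basis column_def)
  qed
  have "smooth_in U (\<lambda>z. B z $ k $ l)" for k l
    by (cases "l = i") (simp_all add: B_def A smooth_in_const)
  then have "smooth_in U (\<lambda>z. det (B z) / det (A z))"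
    by (intro smooth_in_divide smooth_in_det U A d)
  then show ?thesis by (rule smooth_in_cong[OF U]) (rule eq)
qed

text \<open>The normal form has determinant -1 and determinants multiply, so \<open>det G\<close>
  cannot vanish.\<close>

lemma lorentzian_imp_invertible:
  assumes "lorentzian_signature G" shows "invertible G"
proof -
  obtain P :: "real ^ 'a ^ 'a" and i0 where P: "transpose P ** G ** P =
      (\<chi> i j. if i \<noteq> j then 0 else if i = i0 then -1 else 1)"
    using assms unfolding lorentzian_signature_def by blast
  define D :: "real ^ 'a ^ 'a" where "D = (\<chi> i j. if i \<noteq> j then 0 else if i = i0 then -1 else 1)"
  have "det D = (\<Prod>i\<in>UNIV. D $ i $ i)" by (rule det_diagonal) (simp add: D_def)
  then have "det D \<noteq> 0" by (simp add: D_def)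
  then have "det (transpose P ** G ** P) \<noteq> 0" by (simp only: P D_def not_False_eq_True)
  then show ?thesis by (simp add: invertible_det_nz det_mul)
qed

lemma sum_delta_axis: "(\<Sum>k\<in>UNIV. axis i (1::real) $ k * f k) = f (i :: 'n::finite)"
  by (simp add: axis_def if_distrib[where f = "\<lambda>x. x * _"] cong: if_cong)

locale finsler_chart =
  fixes F :: "'n::finite lagr" and U :: "(real ^ 'n) set" and W
  assumes open_U: "open U"
    and W_def: "W = U \<times> (- {0})"
    and smooth_F: "smooth_in W (\<lambda>z. F (fst z) (snd z))"
    and homogeneous: "\<And>x y k. x \<in> U \<Longrightarrow> y \<noteq> 0 \<Longrightarrow> k > 0 \<Longrightarrow> F x (k *\<^sub>R y) = k\<^sup>2 * F x y"
    and invertible_g: "\<And>x y. x \<in> U \<Longrightarrow> y \<noteq> 0 \<Longrightarrow> invertible (g_matrix F x y)"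
begin

lemma open_W: "open W"
  unfolding W_def by (intro open_Times open_U) auto

text \<open>The coordinate objects are rebuilt as functions of the single argument
  \<open>z = (x, y)\<close>, where the smoothness calculus applies; lemmas such as
  \<open>g_low_eq\<close> and \<open>chern_gamma_eq\<close> identify them on \<open>W\<close> with
  the curried ones.\<close>

definition px :: "'n \<Rightarrow> ((real ^ 'n) \<times> (real ^ 'n) \<Rightarrow> real) \<Rightarrow> (real ^ 'n) \<times> (real ^ 'n) \<Rightarrow> real" where
  "px i h = dird h (axis i 1, 0)"

definition py :: "'n \<Rightarrow> ((real ^ 'n) \<times> (real ^ 'n) \<Rightarrow> real) \<Rightarrow> (real ^ 'n) \<times> (real ^ 'n) \<Rightarrow> real" where
  "py i h = dird h (0, axis i 1)"

definition Fz :: "(real ^ 'n) \<times> (real ^ 'n) \<Rightarrow> real" where "Fz z = F (fst z) (snd z)"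

definition Ly where "Ly i = py i Fz"

definition g where "g i j = py i (Ly j)"

definition gi :: "'n \<Rightarrow> 'n \<Rightarrow> (real ^ 'n) \<times> (real ^ 'n) \<Rightarrow> real" where
  "gi i j z = g_up F i j (fst z) (snd z)"

text \<open>The suffix \<open>l\<close> in \<open>chl\<close>, \<open>Gaml\<close>, \<open>Sl\<close> and \<open>Nl\<close> marks that the upper index has been lowered with
  \<open>g\<close>. With \<open>S\<close>, which is twice the usual spray coefficient, geodesics solve \<open>x'' = - S(x, x')\<close>.\<close>

definition chl where
  "chl s j k z = (1/2) * (px k (g s j) z - px s (g j k) z + px j (g s k) z)"

definition ch where "ch i j k z = (\<Sum>s\<in>UNIV. gi i s z * chl s j k z)"

definition S where "S i z = (\<Sum>r\<in>UNIV. \<Sum>s\<in>UNIV. ch i r s z * snd z $ r * snd z $ s)"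

text \<open>The inner sum over r and s in \<open>nonlinear_connection\<close> has become
  \<open>S k\<close>, and the Cartan tensor is half a vertical derivative of
  \<open>g\<close>.\<close>

definition N where
  "N i j z = (\<Sum>k\<in>UNIV. ch i j k z * snd z $ k) -
     (\<Sum>k\<in>UNIV. (\<Sum>l\<in>UNIV. gi i l z * ((1/2) * py k (g l j) z)) * S k z)"

definition dx_hor where
  "dx_hor k h z = px k h z - (\<Sum>i\<in>UNIV. N i k z * py i h z)"

text \<open>The Levi-Civita formula with horizontal in place of coordinate derivatives; that it
  yields the Chern coefficients is \<open>chern_gamma_eq\<close>.\<close>

definition Gaml where
  "Gaml s j k z = (1/2) * (dx_hor k (g s j) z - dx_hor s (g j k) z + dx_hor j (g s k) z)"

definition Gam where "Gam i j k z = (\<Sum>s\<in>UNIV. gi i s z * Gaml s j k z)"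

lemma smooth_px: "smooth_in W h \<Longrightarrow> smooth_in W (px i h)"
  by (simp add: px_def smooth_in_dird)
lemma smooth_py: "smooth_in W h \<Longrightarrow> smooth_in W (py i h)"
  by (simp add: py_def smooth_in_dird)
lemma smooth_Fz: "smooth_in W Fz" using smooth_F by (simp add: Fz_def[abs_def])
lemma smooth_Ly: "smooth_in W (Ly i)" by (simp add: Ly_def smooth_py smooth_Fz)
lemma smooth_g: "smooth_in W (g i j)" by (simp add: g_def smooth_py smooth_Ly)

lemma partial_y_F: "(x, y) \<in> W \<Longrightarrow> partial_y i F x y = Ly i (x, y)"
  unfolding Ly_def py_def by (rule partial_y_eq[OF open_W smooth_Fz]) (simp_all add: Fz_def)

lemma partial_x_F: "(x, y) \<in> W \<Longrightarrow> partial_x i F x y = px i Fz (x, y)"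
  unfolding px_def by (rule partial_x_eq[OF open_W smooth_Fz]) (simp_all add: Fz_def)

lemma g_low_eq: "(x, y) \<in> W \<Longrightarrow> g_low F i j x y = g i j (x, y)"
  unfolding g_low_def g_def[of i j] py_def
  by (rule partial_y_eq[OF open_W smooth_Ly]) (simp_all add: partial_y_F)

lemma gi_left: assumes "z \<in> W" shows "(\<Sum>k\<in>UNIV. gi i k z * g k j z) = (if i = j then 1 else 0)"
proof -
  obtain x y where z: "z = (x, y)" by (cases z)
  have "matrix_inv (g_matrix F x y) ** g_matrix F x y = mat 1"
    using assms by (intro matrix_inv_left invertible_g) (auto simp: W_def z)
  then have "(matrix_inv (g_matrix F x y) ** g_matrix F x y) $ i $ j = mat 1 $ i $ j" by simp
  then show ?thesis
    using assms by (simp add: matrix_matrix_mult_def mat_def z gi_def g_up_def g_matrix_def g_low_eq)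
qed

lemma smooth_gi: "smooth_in W (gi i j)"
proof -
  have "smooth_in W (\<lambda>z. g_matrix F (fst z) (snd z) $ i $ j)" for i j
    by (rule smooth_in_cong[OF open_W smooth_g[of i j]]) (auto simp: g_matrix_def g_low_eq)
  then show ?thesis unfolding gi_def[abs_def] g_up_def
    by (rule smooth_in_matrix_inv[OF open_W]) (auto simp: W_def intro!: invertible_g)
qed

lemma smooth_chl: "smooth_in W (chl s j k)"
  unfolding chl_def
  by (intro smooth_in_mult smooth_in_const smooth_in_diff smooth_in_add smooth_px smooth_g open_W)

lemma smooth_ch: "smooth_in W (ch i j k)"
  unfolding ch_def by (intro smooth_in_sum smooth_in_mult smooth_gi smooth_chl open_W)

lemma smooth_S: "smooth_in W (S i)"
  unfolding S_def by (intro smooth_in_sum smooth_in_mult smooth_ch smooth_in_snd_nth open_W)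

lemma smooth_N: "smooth_in W (N i j)"
  unfolding N_def
  by (intro smooth_in_diff smooth_in_sum smooth_in_mult smooth_ch smooth_S smooth_gi smooth_in_const
      smooth_py smooth_g smooth_in_snd_nth open_W)

lemma smooth_dx_hor: "smooth_in W h \<Longrightarrow> smooth_in W (dx_hor k h)"
  unfolding dx_hor_def
  by (intro smooth_in_diff smooth_in_sum smooth_in_mult smooth_px smooth_py smooth_N open_W)

lemma smooth_Gam: "smooth_in W (Gam i j k)"
  unfolding Gam_def Gaml_def
  by (intro smooth_in_diff smooth_in_sum smooth_in_mult smooth_in_add smooth_dx_hor smooth_gi smooth_g
      smooth_in_const open_W)

lemma partial_x_g: "(x, y) \<in> W \<Longrightarrow> partial_x k (g_low F i j) x y = px k (g i j) (x, y)"
  unfolding px_def by (rule partial_x_eq[OF open_W smooth_g]) (simp_all add: g_low_eq)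

lemma partial_y_g: "(x, y) \<in> W \<Longrightarrow> partial_y k (g_low F i j) x y = py k (g i j) (x, y)"
  unfolding py_def by (rule partial_y_eq[OF open_W smooth_g]) (simp_all add: g_low_eq)

lemma formal_christoffel_eq: "(x, y) \<in> W \<Longrightarrow> formal_christoffel F i j k x y = ch i j k (x, y)"
  by (simp add: formal_christoffel_def ch_def chl_def gi_def partial_x_g sum_distrib_left
      algebra_simps)

lemma cartan_low_eq: "(x, y) \<in> W \<Longrightarrow> cartan_low F i j k x y = (1/2) * py k (g i j) (x, y)"
  by (simp add: cartan_low_def partial_y_g)

lemma nonlinear_connection_eq: "(x, y) \<in> W \<Longrightarrow> nonlinear_connection F i j x y = N i j (x, y)"
  by (simp add: nonlinear_connection_def N_def formal_christoffel_eq cartan_up_def cartan_low_eq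
      S_def gi_def sum_distrib_left sum_distrib_right mult.assoc)

lemma delta_x_eq:
  assumes W: "(x, y) \<in> W" "smooth_in W h" and eq: "\<And>x y. (x, y) \<in> W \<Longrightarrow> f x y = h (x, y)"
  shows "delta_x F k f x y = dx_hor k h (x, y)"
  using partial_x_eq[OF open_W W(2,1) eq] partial_y_eq[OF open_W W(2,1) eq]
  by (simp add: delta_x_def dx_hor_def px_def py_def nonlinear_connection_eq[OF W(1)])

section \<open>Symmetries and Euler identities\<close>

lemma g_sym: "z \<in> W \<Longrightarrow> g i j z = g j i z"
  unfolding g_def Ly_def py_def by (rule dird_commute[OF open_W smooth_Fz])

text \<open>Third vertical derivatives of \<open>F\<close> commute, so the Cartan tensor is totally
  symmetric.\<close>

lemma py_g_sym: assumes "z \<in> W" shows "py k (g i j) z = py i (g k j) z" "py k (g i j) z = py k (g j i) z"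
proof -
  show "py k (g i j) z = py i (g k j) z"
    unfolding g_def py_def by (rule dird_commute[OF open_W smooth_Ly assms])
  show "py k (g i j) z = py k (g j i) z"
    unfolding py_def by (rule dird_cong[OF open_W smooth_g assms]) (rule g_sym)
qed

lemma px_g_sym: assumes "z \<in> W" shows "px k (g i j) z = px k (g j i) z"
  unfolding px_def by (rule dird_cong[OF open_W smooth_g assms]) (rule g_sym)

text \<open>Homogeneity gives F(x, (1 + t) y) = (1 + t)^2 F(x, y) for t > -1; the t-derivatives at 0
  are compared.\<close>

lemma euler_F: assumes "z \<in> W" shows "(\<Sum>j\<in>UNIV. snd z $ j * Ly j z) = 2 * Fz z"
proof -
  obtain x y where z: "z = (x, y)" by (cases z)
  have xy: "x \<in> U" "y \<noteq> 0" using assms by (auto simp: z W_def)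
  have "((\<lambda>t. Fz (z + t *\<^sub>R (0, y))) has_real_derivative dird Fz (0, y) z) (at 0)"
    using dird_along[OF smooth_Fz, of z 0 "(0, y)"] assms
    by (simp add: has_real_derivative_iff_has_vector_derivative zero_prod_def[symmetric])
  moreover have "((\<lambda>t. Fz (z + t *\<^sub>R (0, y))) has_real_derivative 2 * Fz z) (at 0)"
  proof (rule has_field_derivative_transform_within_open)
    show "((\<lambda>t. (1 + t)\<^sup>2 * Fz z) has_real_derivative 2 * Fz z) (at 0)"
      by (auto intro!: derivative_eq_intros)
    show "(1 + t)\<^sup>2 * Fz z = Fz (z + t *\<^sub>R (0, y))" if "t \<in> {-1<..}" for t
      using homogeneous[OF xy, of "1 + t"] that by (simp add: Fz_def z scaleR_add_left)
  qed auto
  ultimately have "dird Fz (0, y) z = 2 * Fz z" by (rule DERIV_unique)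
  then show ?thesis
    unfolding dird_pair_expand[OF smooth_Fz assms, of 0 y] by (simp add: Ly_def py_def z)
qed

lemma dird_y_sum:
  assumes "\<And>j. smooth_in W (h j)" "z \<in> W"
  shows "dird (\<lambda>z. \<Sum>j\<in>UNIV. snd z $ j * h j z) v z =
    (\<Sum>j\<in>UNIV. snd v $ j * h j z) + (\<Sum>j\<in>UNIV. snd z $ j * dird (h j) v z)"
proof -
  have "dird (\<lambda>z. \<Sum>j\<in>UNIV. snd z $ j * h j z) v z = (\<Sum>j\<in>UNIV. dird (\<lambda>z. snd z $ j * h j z) v z)"
    by (rule dird_sum[OF _ assms(2)]) (intro smooth_in_mult smooth_in_snd_nth assms(1) open_W)
  also have "\<dots> = (\<Sum>j\<in>UNIV. snd v $ j * h j z + snd z $ j * dird (h j) v z)"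
    by (rule sum.cong[OF refl])
      (subst dird_mult[OF smooth_in_snd_nth assms(1,2)], simp add: dird_snd_nth)
  finally show ?thesis by (simp add: sum.distrib)
qed

lemma dird_sum_mult:
  fixes h l :: "'n \<Rightarrow> (real ^ 'n) \<times> (real ^ 'n) \<Rightarrow> real"
  assumes "\<And>j. smooth_in W (h j)" "\<And>j. smooth_in W (l j)" "z \<in> W"
  shows "dird (\<lambda>z. \<Sum>j\<in>UNIV. h j z * l j z) v z =
    (\<Sum>j\<in>UNIV. dird (h j) v z * l j z) + (\<Sum>j\<in>UNIV. h j z * dird (l j) v z)"
proof -
  have "dird (\<lambda>z. \<Sum>j\<in>UNIV. h j z * l j z) v z = (\<Sum>j\<in>UNIV. dird (\<lambda>z. h j z * l j z) v z)"
    by (rule dird_sum[OF _ assms(3)]) (intro smooth_in_mult assms(1,2) open_W)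
  also have "\<dots> = (\<Sum>j\<in>UNIV. dird (h j) v z * l j z + h j z * dird (l j) v z)"
    by (rule sum.cong[OF refl]) (rule dird_mult[OF assms])
  finally show ?thesis by (simp add: sum.distrib)
qed

text \<open>The Euler identity for \<open>F\<close>, differentiated in an arbitrary direction v.
  Vertical directions give \<open>euler_Ly\<close>, directions in x give \<open>px_Fz\<close>;
  \<open>dird_g_sum\<close> repeats this one order higher.\<close>

lemma dird_Ly_sum:
  assumes "z \<in> W"
  shows "(\<Sum>j\<in>UNIV. snd v $ j * Ly j z) + (\<Sum>j\<in>UNIV. snd z $ j * dird (Ly j) v z) = 2 * dird Fz v z"
proof -
  have "dird (\<lambda>z. \<Sum>j\<in>UNIV. snd z $ j * Ly j z) v z = dird (\<lambda>z. 2 * Fz z) v z"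
    by (rule dird_cong[OF open_W smooth_in_mult[OF smooth_in_const smooth_Fz open_W] assms])
      (simp add: euler_F)
  then show ?thesis
    by (simp add: dird_y_sum[OF smooth_Ly assms] dird_cmult[OF smooth_Fz assms])
qed

lemma euler_Ly: assumes "z \<in> W" shows "(\<Sum>j\<in>UNIV. snd z $ j * g i j z) = Ly i z"
  using dird_Ly_sum[OF assms, of "(0, axis i 1)"]
  by (simp add: sum_delta_axis Ly_def g_def py_def)

lemma px_Fz: assumes "z \<in> W" shows "(\<Sum>j\<in>UNIV. snd z $ j * px k (Ly j) z) = 2 * px k Fz z"
  using dird_Ly_sum[OF assms, of "(axis k 1, 0)"] by (simp add: px_def)

lemma dird_g_sum:
  assumes "z \<in> W"
  shows "(\<Sum>j\<in>UNIV. snd v $ j * g i j z) + (\<Sum>j\<in>UNIV. snd z $ j * dird (g i j) v z) = dird (Ly i) v z"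
proof -
  have "dird (\<lambda>z. \<Sum>j\<in>UNIV. snd z $ j * g i j z) v z = dird (Ly i) v z"
    by (rule dird_cong[OF open_W smooth_Ly assms]) (simp add: euler_Ly)
  then show ?thesis by (simp add: dird_y_sum[OF smooth_g assms])
qed

text \<open>In the vertical case of \<open>dird_g_sum\<close> the terms \<open>g i k\<close> and
  \<open>g k i\<close> cancel by symmetry; what remains says that the metric is homogeneous of
  degree 0 in y.\<close>

lemma euler_g: assumes "z \<in> W" shows "(\<Sum>j\<in>UNIV. snd z $ j * py k (g i j) z) = 0"
  using dird_g_sum[OF assms, of "(0, axis k 1)" i] g_sym[OF assms]
  by (simp add: sum_delta_axis py_def g_def[of k i])

lemma px_Ly: assumes "z \<in> W" shows "(\<Sum>j\<in>UNIV. snd z $ j * px k (g i j) z) = px k (Ly i) z"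
  using dird_g_sum[OF assms, of "(axis k 1, 0)" i] by (simp add: px_def)


section \<open>The spray and the nonlinear connection\<close>

definition spray where
  "spray h z = (\<Sum>k\<in>UNIV. snd z $ k * px k h z) - (\<Sum>k\<in>UNIV. S k z * py k h z)"

text \<open>What the Euler-Lagrange expression d/ds L_y - L_x leaves when its acceleration term g
  x'' is removed.\<close>

definition Sl where "Sl t z = (\<Sum>k\<in>UNIV. snd z $ k * px k (Ly t) z) - px t Fz z"

definition Nl where
  "Nl t j z = (1/2) * (spray (g t j) z - px t (Ly j) z + px j (Ly t) z)"

lemma gi_right: assumes "z \<in> W" shows "(\<Sum>k\<in>UNIV. g i k z * gi k j z) = (if i = j then 1 else 0)"
proof -
  obtain x y where z: "z = (x, y)" by (cases z)
  have "g_matrix F x y ** matrix_inv (g_matrix F x y) = mat 1"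
    using assms by (intro matrix_inv_right invertible_g) (auto simp: W_def z)
  then have "(g_matrix F x y ** matrix_inv (g_matrix F x y)) $ i $ j = mat 1 $ i $ j" by simp
  then show ?thesis
    using assms by (simp add: matrix_matrix_mult_def mat_def z gi_def g_up_def g_matrix_def g_low_eq)
qed

lemma sum_delta_mult: "(\<Sum>k\<in>UNIV. (if i = k then 1 else 0) * b k) = (b i :: real)" for i :: 'n
  by (simp add: if_distrib[where f = "\<lambda>x. x * _"] cong: if_cong)

lemma lower_raise:
  assumes "z \<in> W"
  shows "(\<Sum>i\<in>UNIV. g m i z * (\<Sum>s\<in>UNIV. gi i s z * b s)) = b m"
proof -
  have "(\<Sum>i\<in>UNIV. g m i z * (\<Sum>s\<in>UNIV. gi i s z * b s)) =
      (\<Sum>i\<in>UNIV. \<Sum>s\<in>UNIV. (g m i z * gi i s z) * b s)"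
    by (simp only: sum_distrib_left mult.assoc)
  also have "\<dots> = (\<Sum>s\<in>UNIV. (\<Sum>i\<in>UNIV. g m i z * gi i s z) * b s)"
    by (subst sum.swap) (simp only: sum_distrib_right)
  also have "\<dots> = b m" by (simp only: gi_right[OF assms] sum_delta_mult)
  finally show ?thesis .
qed

lemma raise_lower:
  assumes "z \<in> W"
  shows "(\<Sum>s\<in>UNIV. gi i s z * (\<Sum>k\<in>UNIV. g s k z * b k)) = b i"
proof -
  have "(\<Sum>s\<in>UNIV. gi i s z * (\<Sum>k\<in>UNIV. g s k z * b k)) =
      (\<Sum>s\<in>UNIV. \<Sum>k\<in>UNIV. (gi i s z * g s k z) * b k)"
    by (simp only: sum_distrib_left mult.assoc)
  also have "\<dots> = (\<Sum>k\<in>UNIV. (\<Sum>s\<in>UNIV. gi i s z * g s k z) * b k)"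
    by (subst sum.swap) (simp only: sum_distrib_right)
  also have "\<dots> = b i" by (simp only: gi_left[OF assms] sum_delta_mult)
  finally show ?thesis .
qed

text \<open>Non-degeneracy of \<open>g\<close>. It lets \<open>py_S\<close> be proved by
  differentiating the lowered spray, so that no derivative of the inverse matrix appears.\<close>

lemma lower_cancel:
  assumes "z \<in> W" "\<And>m. (\<Sum>i\<in>UNIV. g m i z * a i) = (\<Sum>i\<in>UNIV. g m i z * b i)"
  shows "a i = b i"
  using raise_lower[OF assms(1), of i a] raise_lower[OF assms(1), of i b] assms(2) by simp

text \<open>Contracted twice with y, the three metric derivatives become derivatives of
  \<open>Ly\<close> and \<open>Fz\<close>, by \<open>px_Ly\<close> and \<open>px_Fz\<close>. Two of
  them agree, so with the factor 1/2 the sum is \<open>Sl t\<close>.\<close>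

lemma S_eq: assumes "z \<in> W" shows "S i z = (\<Sum>t\<in>UNIV. gi i t z * Sl t z)"
proof -
  have Sl: "(\<Sum>r\<in>UNIV. \<Sum>s\<in>UNIV. chl t r s z * snd z $ r * snd z $ s) = Sl t z" for t
  proof -
    have 1: "(\<Sum>r\<in>UNIV. \<Sum>s\<in>UNIV. snd z $ s * (snd z $ r * px s (g t r) z))
        = (\<Sum>k\<in>UNIV. snd z $ k * px k (Ly t) z)"
      by (subst sum.swap) (simp only: sum_distrib_left[symmetric] px_Ly[OF assms])
    have 2: "(\<Sum>r\<in>UNIV. \<Sum>s\<in>UNIV. snd z $ r * (snd z $ s * px t (g r s) z)) = 2 * px t Fz z"
      by (simp only: sum_distrib_left[symmetric] px_Ly[OF assms] px_Fz[OF assms])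
    have 3: "(\<Sum>r\<in>UNIV. \<Sum>s\<in>UNIV. snd z $ r * (snd z $ s * px r (g t s) z))
        = (\<Sum>k\<in>UNIV. snd z $ k * px k (Ly t) z)"
      by (simp only: sum_distrib_left[symmetric] px_Ly[OF assms])
    have "(\<Sum>r\<in>UNIV. \<Sum>s\<in>UNIV. chl t r s z * snd z $ r * snd z $ s) =
      (\<Sum>r\<in>UNIV. \<Sum>s\<in>UNIV. (1/2) * (snd z $ s * (snd z $ r * px s (g t r) z)
        - snd z $ r * (snd z $ s * px t (g r s) z) + snd z $ r * (snd z $ s * px r (g t s) z)))"
      by (intro sum.cong refl) (simp add: chl_def algebra_simps)
    also have "\<dots> = (1/2) * ((\<Sum>r\<in>UNIV. \<Sum>s\<in>UNIV. snd z $ s * (snd z $ r * px s (g t r) z))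
        - (\<Sum>r\<in>UNIV. \<Sum>s\<in>UNIV. snd z $ r * (snd z $ s * px t (g r s) z))
        + (\<Sum>r\<in>UNIV. \<Sum>s\<in>UNIV. snd z $ r * (snd z $ s * px r (g t s) z)))"
      by (simp only: sum_distrib_left[symmetric] sum.distrib sum_subtractf)
    also have "\<dots> = Sl t z" unfolding 1 2 3 Sl_def by simp
    finally show ?thesis .
  qed
  have "S i z = (\<Sum>r\<in>UNIV. \<Sum>s\<in>UNIV. \<Sum>t\<in>UNIV. gi i t z * (chl t r s z * snd z $ r * snd z $ s))"
    by (simp only: S_def ch_def sum_distrib_right mult.assoc)
  also have "\<dots> = (\<Sum>r\<in>UNIV. \<Sum>t\<in>UNIV. \<Sum>s\<in>UNIV. gi i t z * (chl t r s z * snd z $ r * snd z $ s))"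
    by (intro sum.cong refl sum.swap)
  also have "\<dots> = (\<Sum>t\<in>UNIV. \<Sum>r\<in>UNIV. \<Sum>s\<in>UNIV. gi i t z * (chl t r s z * snd z $ r * snd z $ s))"
    by (rule sum.swap)
  also have "\<dots> = (\<Sum>t\<in>UNIV. gi i t z * Sl t z)"
    by (simp only: sum_distrib_left[symmetric] Sl)
  finally show ?thesis .
qed

lemma lower_S: "z \<in> W \<Longrightarrow> (\<Sum>i\<in>UNIV. g m i z * S i z) = Sl m z"
  by (simp add: S_eq lower_raise)

text \<open>After one contraction with y, the term y \<partial>g/\<partial>x and the Cartan term -S
  \<partial>g/\<partial>y together form the spray derivative of \<open>g\<close>, which explains the
  shape of \<open>Nl\<close>.\<close>

lemma N_eq: assumes "z \<in> W" shows "N i j z = (\<Sum>t\<in>UNIV. gi i t z * Nl t j z)"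
proof -
  have Nl: "(\<Sum>k\<in>UNIV. chl t j k z * snd z $ k) - (\<Sum>k\<in>UNIV. (1/2) * py k (g t j) z * S k z) = Nl t j z"
    for t
  proof -
    have "(\<Sum>k\<in>UNIV. chl t j k z * snd z $ k) =
      (\<Sum>k\<in>UNIV. (1/2) * (snd z $ k * px k (g t j) z
         - snd z $ k * px t (g j k) z + snd z $ k * px j (g t k) z))"
      by (intro sum.cong refl) (simp add: chl_def algebra_simps)
    also have "\<dots> = (1/2) * ((\<Sum>k\<in>UNIV. snd z $ k * px k (g t j) z) - px t (Ly j) z + px j (Ly t) z)"
      by (simp only: sum_distrib_left[symmetric] sum.distrib sum_subtractf px_Ly[OF assms])
    finally have 1: "(\<Sum>k\<in>UNIV. chl t j k z * snd z $ k) = \<dots>" .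
    have 2: "(\<Sum>k\<in>UNIV. (1/2) * py k (g t j) z * S k z) = (1/2) * (\<Sum>k\<in>UNIV. S k z * py k (g t j) z)"
      by (simp only: sum_distrib_left mult.assoc mult.commute[of "S _ z"])
    show ?thesis unfolding 1 2 Nl_def spray_def by (simp add: algebra_simps)
  qed
  have 1: "(\<Sum>k\<in>UNIV. ch i j k z * snd z $ k) = (\<Sum>t\<in>UNIV. gi i t z * (\<Sum>k\<in>UNIV. chl t j k z * snd z $ k))"
    by (simp only: ch_def sum_distrib_right sum_distrib_left mult.assoc) (rule sum.swap)
  have 2: "(\<Sum>k\<in>UNIV. (\<Sum>l\<in>UNIV. gi i l z * ((1/2) * py k (g l j) z)) * S k z) =
      (\<Sum>t\<in>UNIV. gi i t z * (\<Sum>k\<in>UNIV. (1/2) * py k (g t j) z * S k z))"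
    by (simp only: sum_distrib_right sum_distrib_left mult.assoc) (rule sum.swap)
  show ?thesis
    unfolding N_def 1 2 by (simp only: Nl[symmetric] right_diff_distrib sum_subtractf)
qed

lemma lower_N: "z \<in> W \<Longrightarrow> (\<Sum>i\<in>UNIV. g m i z * N i j z) = Nl m j z"
  by (simp add: N_eq lower_raise)

text \<open>With the index lowered, the vertical part of the spray derivative of \<open>g\<close>
  disappears by \<open>euler_g\<close>, and the rest collapses to \<open>Sl\<close> by
  \<open>px_Ly\<close> and \<open>px_Fz\<close>.\<close>

lemma N_y: assumes "z \<in> W" shows "(\<Sum>j\<in>UNIV. N i j z * snd z $ j) = S i z"
proof -
  have "(\<Sum>j\<in>UNIV. Nl t j z * snd z $ j) = Sl t z" for t
  proof -
    have "(\<Sum>j\<in>UNIV. snd z $ j * spray (g t j) z) =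
       (\<Sum>j\<in>UNIV. \<Sum>k\<in>UNIV. snd z $ k * (snd z $ j * px k (g t j) z))
       - (\<Sum>j\<in>UNIV. \<Sum>k\<in>UNIV. S k z * (snd z $ j * py k (g t j) z))"
      by (simp only: spray_def right_diff_distrib sum_subtractf sum_distrib_left mult.left_commute)
    also have "(\<Sum>j\<in>UNIV. \<Sum>k\<in>UNIV. snd z $ k * (snd z $ j * px k (g t j) z)) =
        (\<Sum>k\<in>UNIV. snd z $ k * px k (Ly t) z)"
      by (subst sum.swap) (simp only: sum_distrib_left[symmetric] px_Ly[OF assms])
    also have "(\<Sum>j\<in>UNIV. \<Sum>k\<in>UNIV. S k z * (snd z $ j * py k (g t j) z)) = 0"
      by (subst sum.swap) (simp add: sum_distrib_left[symmetric] euler_g[OF assms])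
    finally have 1: "(\<Sum>j\<in>UNIV. snd z $ j * spray (g t j) z) = (\<Sum>k\<in>UNIV. snd z $ k * px k (Ly t) z)"
      by simp
    have "(\<Sum>j\<in>UNIV. Nl t j z * snd z $ j) = (1/2) * ((\<Sum>j\<in>UNIV. snd z $ j * spray (g t j) z)
      - (\<Sum>j\<in>UNIV. snd z $ j * px t (Ly j) z) + (\<Sum>j\<in>UNIV. snd z $ j * px j (Ly t) z))"
      by (simp only: sum_subtractf[symmetric] sum.distrib[symmetric] sum_distrib_left Nl_def)
        (simp add: algebra_simps)
    then show ?thesis unfolding 1 px_Fz[OF assms] by (simp add: Sl_def)
  qed
  then have "(\<Sum>t\<in>UNIV. gi i t z * (\<Sum>j\<in>UNIV. Nl t j z * snd z $ j)) = S i z"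
    by (simp add: S_eq[OF assms])
  then show ?thesis
    by (simp only: N_eq[OF assms] sum_distrib_right sum_distrib_left mult.assoc) (subst sum.swap)
qed

lemma spray_eq:
  assumes "z \<in> W" shows "(\<Sum>k\<in>UNIV. snd z $ k * dx_hor k h z) = spray h z"
proof -
  have "(\<Sum>k\<in>UNIV. \<Sum>i\<in>UNIV. snd z $ k * (N i k z * py i h z)) =
      (\<Sum>i\<in>UNIV. (\<Sum>k\<in>UNIV. N i k z * snd z $ k) * py i h z)"
    by (subst sum.swap, simp only: sum_distrib_right) (simp add: mult_ac)
  then show ?thesis
    by (simp only: dx_hor_def spray_def right_diff_distrib sum_subtractf sum_distrib_left N_y[OF assms])
qed

text \<open>Differentiate g S = Sl with respect to y^j. Cartan symmetry turns the derivative of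
  \<open>g\<close> into S^i \<partial>g/\<partial>y^i, which moves to the right and completes y
  \<partial>g/\<partial>x to \<open>spray\<close>; the right side is then twice
  \<open>Nl\<close>.\<close>

lemma py_S: assumes "z \<in> W" shows "py j (S i) z = 2 * N i j z"
proof (rule lower_cancel[OF assms, where a = "\<lambda>i. py j (S i) z" and b = "\<lambda>i. 2 * N i j z"])
  fix m
  have s: "smooth_in W (\<lambda>z. \<Sum>k\<in>UNIV. snd z $ k * px k (Ly m) z)"
    by (intro smooth_in_sum smooth_in_mult smooth_in_snd_nth smooth_px smooth_Ly open_W)
  have sS: "smooth_in W (Sl m)"
    unfolding Sl_def by (intro smooth_in_diff s smooth_px smooth_Fz open_W)
  have c: "py j (px k (Ly m)) z = px k (g j m) z" for k
    unfolding py_def px_def by (simp add: dird_commute[OF open_W smooth_Ly assms] g_def py_def)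
  have c': "py j (px m Fz) z = px m (Ly j) z"
    unfolding py_def px_def by (simp add: dird_commute[OF open_W smooth_Fz assms] Ly_def py_def)
  have "py j (\<lambda>z. \<Sum>i\<in>UNIV. g m i z * S i z) z = py j (Sl m) z"
    unfolding py_def by (rule dird_cong[OF open_W sS assms]) (simp add: lower_S)
  also have "\<dots> = px j (Ly m) z + (\<Sum>k\<in>UNIV. snd z $ k * px k (g j m) z) - px m (Ly j) z"
    unfolding Sl_def py_def dird_diff[OF s smooth_px[OF smooth_Fz] assms]
      dird_y_sum[OF smooth_px[OF smooth_Ly] assms]
    by (simp only: py_def[symmetric] c c' snd_conv sum_delta_axis)
  also have "(\<Sum>k\<in>UNIV. snd z $ k * px k (g j m) z) = (\<Sum>k\<in>UNIV. snd z $ k * px k (g m j) z)"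
    by (simp only: px_g_sym[OF assms, of _ j m])
  finally have 1: "(\<Sum>i\<in>UNIV. py j (g m i) z * S i z) + (\<Sum>i\<in>UNIV. g m i z * py j (S i) z) =
      px j (Ly m) z + (\<Sum>k\<in>UNIV. snd z $ k * px k (g m j) z) - px m (Ly j) z"
    by (simp only: py_def dird_sum_mult[OF smooth_g smooth_S assms])
  have 2: "py j (g m i) z = py i (g m j) z" for i
    using py_g_sym[OF assms] by metis
  have "(\<Sum>i\<in>UNIV. g m i z * (2 * N i j z)) = 2 * Nl m j z"
    by (simp only: lower_N[OF assms, symmetric] sum_distrib_left mult.left_commute)
  then show "(\<Sum>i\<in>UNIV. g m i z * py j (S i) z) = (\<Sum>i\<in>UNIV. g m i z * (2 * N i j z))"
    using 1 unfolding 2 Nl_def spray_def by (simp add: mult.commute[of "S _ z"])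
qed

section \<open>Horizontal derivatives and the Chern coefficients\<close>

lemma dx_hor_dird:
  assumes "smooth_in W h" "z \<in> W"
  shows "dx_hor k h z = dird h (axis k 1, - (\<chi> i. N i k z)) z"
  unfolding dird_pair_expand[OF assms, of "axis k 1"]
  by (simp add: dx_hor_def px_def py_def sum_delta_axis sum_negf)

lemma spray_dird:
  assumes "smooth_in W h" "z \<in> W"
  shows "spray h z = dird h (snd z, - (\<chi> i. S i z)) z"
  unfolding dird_pair_expand[OF assms, of "snd z"]
  by (simp add: spray_def px_def py_def sum_negf)

lemma dx_hor_g_sym: assumes "z \<in> W" shows "dx_hor k (g i j) z = dx_hor k (g j i) z"
  by (simp add: dx_hor_def px_g_sym[OF assms, of _ i j] py_g_sym(2)[OF assms, of _ i j])

text \<open>The vertical part of the horizontal derivative is a Cartan term, killed by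
  \<open>euler_g\<close>.\<close>

lemma dx_hor_g_y: assumes "z \<in> W" shows "(\<Sum>k\<in>UNIV. snd z $ k * dx_hor m (g j k) z) = px m (Ly j) z"
proof -
  have "(\<Sum>k\<in>UNIV. \<Sum>i\<in>UNIV. snd z $ k * (N i m z * py i (g j k) z)) =
      (\<Sum>i\<in>UNIV. N i m z * (\<Sum>k\<in>UNIV. snd z $ k * py i (g j k) z))"
    by (subst sum.swap) (simp only: sum_distrib_left mult.left_commute)
  then show ?thesis
    by (simp add: dx_hor_def right_diff_distrib sum_subtractf sum_distrib_left px_Ly[OF assms] euler_g[OF assms])
qed

lemma Gaml_sym: "z \<in> W \<Longrightarrow> Gaml s j k z = Gaml s k j z"
  by (simp add: Gaml_def dx_hor_g_sym[of z s j k])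

lemma Gam_sym: "z \<in> W \<Longrightarrow> Gam i j k z = Gam i k j z"
  by (simp add: Gam_def Gaml_sym[of z _ j k])

lemma lower_Gam: "z \<in> W \<Longrightarrow> (\<Sum>i\<in>UNIV. g m i z * Gam i j k z) = Gaml m j k z"
  by (simp add: Gam_def lower_raise)

text \<open>In \<open>Gaml j i k + Gaml i j k\<close> all horizontal derivatives except those along
  k cancel.\<close>

lemma metric_compatible:
  assumes "z \<in> W"
  shows "dx_hor k (g i j) z = (\<Sum>l\<in>UNIV. g j l z * Gam l i k z) + (\<Sum>l\<in>UNIV. g i l z * Gam l j k z)"
  using dx_hor_g_sym[OF assms, of k i j]
  by (simp add: lower_Gam[OF assms] Gaml_def field_simps)

text \<open>Contracting k with y turns the derivative along k into \<open>spray\<close>, and the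
  other two lose their vertical parts by \<open>dx_hor_g_y\<close>; this is
  \<open>Nl\<close>.\<close>

lemma Gam_y: assumes "z \<in> W" shows "(\<Sum>k\<in>UNIV. Gam i j k z * snd z $ k) = N i j z"
proof -
  have "(\<Sum>k\<in>UNIV. Gaml t j k z * snd z $ k) = Nl t j z" for t
  proof -
    have "(\<Sum>k\<in>UNIV. Gaml t j k z * snd z $ k) =
      (1/2) * ((\<Sum>k\<in>UNIV. snd z $ k * dx_hor k (g t j) z) - (\<Sum>k\<in>UNIV. snd z $ k * dx_hor t (g j k) z)
        + (\<Sum>k\<in>UNIV. snd z $ k * dx_hor j (g t k) z))"
      by (simp only: sum_subtractf[symmetric] sum.distrib[symmetric] sum_distrib_left Gaml_def)
        (simp add: algebra_simps)
    then show ?thesis by (simp only: spray_eq[OF assms] dx_hor_g_y[OF assms] Nl_def)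
  qed
  then have "(\<Sum>t\<in>UNIV. gi i t z * (\<Sum>k\<in>UNIV. Gaml t j k z * snd z $ k)) = N i j z"
    by (simp add: N_eq[OF assms])
  then show ?thesis
    by (simp only: Gam_def sum_distrib_right sum_distrib_left mult.assoc) (subst sum.swap)
qed

lemma Gam_y': assumes "z \<in> W" shows "(\<Sum>j\<in>UNIV. snd z $ j * Gam i j k z) = N i k z"
  by (simp only: Gam_sym[OF assms, of i _ k] mult.commute[of "snd z $ _"] Gam_y[OF assms])

lemma N_y': assumes "z \<in> W" shows "(\<Sum>l\<in>UNIV. snd z $ l * N i l z) = S i z"
  by (simp only: mult.commute[of "snd z $ _"] N_y[OF assms])

lemma spray_g:
  assumes "z \<in> W"
  shows "spray (g i j) z = (\<Sum>l\<in>UNIV. g j l z * N l i z) + (\<Sum>l\<in>UNIV. g i l z * N l j z)"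
proof -
  have "(\<Sum>k\<in>UNIV. \<Sum>l\<in>UNIV. snd z $ k * (g j l z * Gam l i k z)) = (\<Sum>l\<in>UNIV. g j l z * N l i z)" for i j
    by (subst sum.swap) (simp only: Gam_y[OF assms, symmetric] sum_distrib_left mult.left_commute mult.commute)
  then show ?thesis
    by (simp only: spray_eq[OF assms, symmetric] metric_compatible[OF assms] distrib_left sum.distrib
        sum_distrib_left)
qed

text \<open>The horizontal derivative of the coordinate y^j along m is -N^j_m, which produces the
  correction term.\<close>

lemma dx_hor_y_sum:
  assumes "\<And>j. smooth_in W (h j)" "z \<in> W"
  shows "dx_hor m (\<lambda>z. \<Sum>j\<in>UNIV. snd z $ j * h j z) z =
    (\<Sum>j\<in>UNIV. snd z $ j * dx_hor m (h j) z) - (\<Sum>j\<in>UNIV. N j m z * h j z)"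
proof -
  have "smooth_in W (\<lambda>z. \<Sum>j\<in>UNIV. snd z $ j * h j z)"
    by (intro smooth_in_sum smooth_in_mult smooth_in_snd_nth assms open_W)
  from dx_hor_dird[OF this assms(2)] show ?thesis
    by (simp add: dird_y_sum[OF assms] dx_hor_dird[OF assms(1,2)] sum_negf)
qed

lemma dx_hor_cong:
  assumes "smooth_in W f" "z \<in> W" "\<And>z. z \<in> W \<Longrightarrow> f z = h z"
  shows "dx_hor k h z = dx_hor k f z"
  unfolding dx_hor_def px_def py_def
  by (simp add: dird_cong[OF open_W assms])

end

section \<open>The Chern connection and its curvature\<close>

context finsler_chart
begin

lemma d_fun_g: assumes "(x, y) \<in> W"
  shows "d_fun (g_low F i j) x y X =
    (\<Sum>k\<in>UNIV. px k (g i j) (x, y) * fst X $ k) + (\<Sum>k\<in>UNIV. py k (g i j) (x, y) * snd X $ k)"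
  by (simp add: d_fun_def partial_x_g[OF assms] partial_y_g[OF assms] sum.distrib)

text \<open>The dy-part of \<delta>y reproduces the vertical part of dg; its dx-part changes
  \<partial>g/\<partial>x into the horizontal derivative. So the metric condition becomes one on
  horizontal derivatives once the connection form has no vertical part.\<close>

lemma cartan_delta_y: assumes "(x, y) \<in> W"
  shows "2 * (\<Sum>k\<in>UNIV. cartan_low F i j k x y * delta_y F k x y X) =
    (\<Sum>k\<in>UNIV. py k (g i j) (x, y) * snd X $ k)
    + (\<Sum>m\<in>UNIV. (px m (g i j) (x, y) - dx_hor m (g i j) (x, y)) * fst X $ m)"
proof -
  have "(\<Sum>k\<in>UNIV. \<Sum>m\<in>UNIV. py k (g i j) (x, y) * (N k m (x, y) * fst X $ m)) =
     (\<Sum>m\<in>UNIV. (\<Sum>k\<in>UNIV. N k m (x, y) * py k (g i j) (x, y)) * fst X $ m)"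
    by (subst sum.swap, simp only: sum_distrib_right) (simp add: mult_ac)
  then show ?thesis
    by (simp add: cartan_low_eq[OF assms] delta_y_def nonlinear_connection_eq[OF assms]
        sum_distrib_left distrib_left sum.distrib dx_hor_def)
qed

lemma is_chern_form_Gam:
  assumes "(x, y) \<in> W"
  shows "is_chern_form F x y (\<lambda>j i X. \<Sum>k\<in>UNIV. Gam i j k (x, y) * fst X $ k)"
  unfolding is_chern_form_def
proof (intro conjI allI)
  fix i j
  show "linear (\<lambda>X::(real^'n) \<times> (real^'n). \<Sum>k\<in>UNIV. Gam i j k (x, y) * fst X $ k)"
    by (rule linearI) (simp_all add: sum.distrib distrib_left sum_distrib_left mult_ac)
next
  fix i and X Y :: "(real^'n) \<times> (real^'n)"
  have "(\<Sum>j\<in>UNIV. \<Sum>k\<in>UNIV. fst X $ j * (Gam i j k (x, y) * fst Y $ k)) =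
      (\<Sum>j\<in>UNIV. \<Sum>k\<in>UNIV. fst Y $ j * (Gam i j k (x, y) * fst X $ k))"
    by (subst sum.swap) (simp add: Gam_sym[OF assms, of i] mult_ac)
  then show "(\<Sum>j\<in>UNIV. dx j X * (\<Sum>k\<in>UNIV. Gam i j k (x, y) * fst Y $ k)
      - dx j Y * (\<Sum>k\<in>UNIV. Gam i j k (x, y) * fst X $ k)) = 0"
    by (simp add: dx_def sum_subtractf sum_distrib_left)
next
  fix i j and X :: "(real^'n) \<times> (real^'n)"
  have *: "(\<Sum>l\<in>UNIV. a l * (\<Sum>k\<in>UNIV. Gam l i k (x, y) * fst X $ k)) =
      (\<Sum>k\<in>UNIV. (\<Sum>l\<in>UNIV. a l * Gam l i k (x, y)) * fst X $ k)" for a i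
    by (simp only: sum_distrib_left sum_distrib_right mult.assoc) (rule sum.swap)
  show "d_fun (g_low F i j) x y X
      - (\<Sum>k\<in>UNIV. g_low F k j x y * (\<Sum>l\<in>UNIV. Gam k i l (x, y) * fst X $ l))
      - (\<Sum>k\<in>UNIV. g_low F i k x y * (\<Sum>l\<in>UNIV. Gam k j l (x, y) * fst X $ l))
    = 2 * (\<Sum>k\<in>UNIV. cartan_low F i j k x y * delta_y F k x y X)"
    unfolding * cartan_delta_y[OF assms] d_fun_g[OF assms] g_low_eq[OF assms]
      metric_compatible[OF assms] g_sym[OF assms, of _ j]
    by (simp add: left_diff_distrib distrib_right sum_subtractf sum.distrib)
qed

text \<open>Koszul's argument: the wedge condition makes the form horizontal and symmetric, and
  three permutations of the metric condition then determine it.\<close>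

lemma is_chern_form_unique:
  assumes W: "(x, y) \<in> W" and \<omega>: "is_chern_form F x y \<omega>"
  shows "\<omega> = (\<lambda>j i X. \<Sum>k\<in>UNIV. Gam i j k (x, y) * fst X $ k)"
proof (intro ext)
  fix j i and X :: "(real^'n) \<times> (real^'n)"
  let ?e = "\<lambda>k. (axis k (1::real), 0) :: (real^'n) \<times> (real^'n)"
  define T where "T i j k = \<omega> j i (?e k)" for i j k
  define Tl where "Tl s j k = (\<Sum>l\<in>UNIV. g s l (x, y) * T l j k)" for s j k
  have lin: "linear (\<omega> j i)" for i j using \<omega> by (simp add: is_chern_form_def)
  have wedge: "(\<Sum>j\<in>UNIV. fst X $ j * \<omega> j i Y - fst Y $ j * \<omega> j i X) = 0" for i X Y
    using \<omega> unfolding is_chern_form_def dx_def by blast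
  \<comment> \<open>Testing the wedge condition on a base vector e_j and a vertical vector isolates
    a single component, which must be 0.\<close>
  have vert: "\<omega> j i (0, w) = 0" for i j w
    using wedge[of "?e j" i "(0, w)"] by (simp add: sum_delta_axis)
  have T_sym: "T i j k = T i k j" for i j k
    using wedge[of "?e j" i "?e k"] by (simp add: sum_delta_axis sum_subtractf T_def)
  have Tl_sym: "Tl s j k = Tl s k j" for s j k by (simp add: Tl_def T_sym[of _ j k])
  have compat: "Tl j i k + Tl i j k = dx_hor k (g i j) (x, y)" for i j k
  proof -
    have "d_fun (g_low F i j) x y (?e k)
        - (\<Sum>l\<in>UNIV. g_low F l j x y * \<omega> i l (?e k)) - (\<Sum>l\<in>UNIV. g_low F i l x y * \<omega> j l (?e k))
        = 2 * (\<Sum>l\<in>UNIV. cartan_low F i j l x y * delta_y F l x y (?e k))"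
      using \<omega> unfolding is_chern_form_def by blast
    then show ?thesis
      unfolding cartan_delta_y[OF W] d_fun_g[OF W] g_low_eq[OF W] g_sym[OF W, of _ j]
      by (simp add: Tl_def T_def sum_delta_axis mult.commute[of _ "axis _ _ $ _"])
  qed
  \<comment> \<open>Koszul combination of \<delta>_k g(s,j) + \<delta>_j g(s,k) - \<delta>_s g(j,k):
    symmetry in the lower indices cancels four of the six terms.\<close>
  have "Tl s j k = Gaml s j k (x, y)" for s j k
    using compat[of j s k] compat[of j k s] compat[of k s j] Tl_sym[of s j k] Tl_sym[of j s k]
      Tl_sym[of k j s] dx_hor_g_sym[OF W, of k j s] dx_hor_g_sym[OF W, of j k s]
      dx_hor_g_sym[OF W, of s j k]
    by (simp add: Gaml_def)
  then have T: "T l j k = Gam l j k (x, y)" for l j k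
    using lower_cancel[OF W, of "\<lambda>l. T l j k" "\<lambda>l. Gam l j k (x, y)"] lower_Gam[OF W]
    by (simp add: Tl_def)
  have "X = (\<Sum>k\<in>UNIV. fst X $ k *\<^sub>R ?e k) + (0, snd X)"
    by (simp add: prod_eq_iff fst_sum snd_sum basis_expansion scalar_mult_eq_scaleR[symmetric])
  then have "\<omega> j i X = \<omega> j i ((\<Sum>k\<in>UNIV. fst X $ k *\<^sub>R ?e k) + (0, snd X))" by simp
  also have "\<dots> = (\<Sum>k\<in>UNIV. fst X $ k * T i j k)"
    by (simp only: linear_add[OF lin] linear_sum[OF lin] linear_scale[OF lin] vert T_def) simp
  finally show "\<omega> j i X = (\<Sum>k\<in>UNIV. Gam i j k (x, y) * fst X $ k)"
    by (simp add: T mult.commute)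
qed

lemma chern_gamma_eq:
  assumes "(x, y) \<in> W" shows "chern_gamma F i j k x y = Gam i j k (x, y)"
proof -
  have "chern_form F x y = (\<lambda>j i X. \<Sum>k\<in>UNIV. Gam i j k (x, y) * fst X $ k)"
    unfolding chern_form_def
    by (rule the_equality) (fact is_chern_form_Gam[OF assms], rule is_chern_form_unique[OF assms])
  then show ?thesis
    by (simp add: chern_gamma_def sum_delta_axis mult.commute[of _ "axis _ _ $ _"])
qed

section \<open>Curvature contracted with the velocity\<close>

lemma hh_curvature_eq:
  assumes "(x, y) \<in> W"
  shows "hh_curvature F i j k l x y =
     dx_hor k (Gam i j l) (x, y) - dx_hor l (Gam i j k) (x, y)
     + (\<Sum>h\<in>UNIV. Gam i h k (x, y) * Gam h j l (x, y))
     - (\<Sum>h\<in>UNIV. Gam i h l (x, y) * Gam h j k (x, y))"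
proof -
  have "delta_x F k (chern_gamma F i j l) x y = dx_hor k (Gam i j l) (x, y)" for k j l
    by (rule delta_x_eq[OF assms smooth_Gam]) (rule chern_gamma_eq)
  then show ?thesis by (simp only: hh_curvature_def chern_gamma_eq[OF assms])
qed

text \<open>Since y^j \<Gamma>^i_jl = N^i_l, the contraction may be moved under the horizontal
  derivative; \<open>dx_hor_y_sum\<close> supplies the correction.\<close>

lemma dx_hor_Gam_y:
  assumes "z \<in> W"
  shows "(\<Sum>j\<in>UNIV. snd z $ j * dx_hor m (Gam i j l) z) =
    dx_hor m (N i l) z + (\<Sum>j\<in>UNIV. N j m z * Gam i j l z)"
  using dx_hor_y_sum[of "\<lambda>j. Gam i j l", OF smooth_Gam assms, of m]
    dx_hor_cong[OF smooth_N assms, of i l "\<lambda>z. \<Sum>j\<in>UNIV. snd z $ j * Gam i j l z" m]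
  by (simp add: Gam_y')

text \<open>Again y moves under the derivative, now by N y = S, with correction + N N. Expanding the
  horizontal derivative of S by \<open>py_S\<close> contributes -2 N N, so that -N N
  remains.\<close>

lemma dx_hor_N_y:
  assumes "z \<in> W"
  shows "(\<Sum>l\<in>UNIV. snd z $ l * dx_hor m (N i l) z) = px m (S i) z - (\<Sum>l\<in>UNIV. N i l z * N l m z)"
proof -
  have "(\<Sum>l\<in>UNIV. snd z $ l * dx_hor m (N i l) z) = dx_hor m (S i) z + (\<Sum>l\<in>UNIV. N l m z * N i l z)"
    using dx_hor_y_sum[of "\<lambda>l. N i l", OF smooth_N assms, of m]
      dx_hor_cong[OF smooth_S assms, of i "\<lambda>z. \<Sum>l\<in>UNIV. snd z $ l * N i l z" m]
    by (simp add: N_y')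
  then show ?thesis
    by (simp add: dx_hor_def py_S[OF assms] sum_distrib_left[symmetric] mult_ac)
qed

lemma curvature_along_y:
  assumes "(x, y) \<in> W"
  shows "(\<Sum>j\<in>UNIV. \<Sum>l\<in>UNIV. hh_curvature F i j m l x y * y $ j * y $ l) =
    px m (S i) (x, y) - spray (N i m) (x, y) - (\<Sum>l\<in>UNIV. N i l (x, y) * N l m (x, y))"
proof -
  define z where "z = (x, y)"
  have z: "z \<in> W" "y = snd z" using assms by (auto simp: z_def)
  have "(\<Sum>j\<in>UNIV. \<Sum>l\<in>UNIV. hh_curvature F i j m l x y * y $ j * y $ l) =
      (\<Sum>l\<in>UNIV. \<Sum>j\<in>UNIV. hh_curvature F i j m l x y * y $ j * y $ l)"
    by (rule sum.swap)
  also have "\<dots> = (\<Sum>l\<in>UNIV. snd z $ l * (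
      (\<Sum>j\<in>UNIV. snd z $ j * dx_hor m (Gam i j l) z)
      - (\<Sum>j\<in>UNIV. snd z $ j * dx_hor l (Gam i j m) z)
      + (\<Sum>h\<in>UNIV. Gam i h m z * N h l z) - (\<Sum>h\<in>UNIV. Gam i h l z * N h m z)))"
  proof (intro sum.cong refl)
    fix l
    \<comment> \<open>The contraction with y^j absorbs one factor \<Gamma> of each quadratic term
      into \<open>N\<close>.\<close>
    have sw: "(\<Sum>h\<in>UNIV. a h * N h l z) = (\<Sum>j\<in>UNIV. snd z $ j * (\<Sum>h\<in>UNIV. a h * Gam h j l z))" for a l
    proof -
      have "(\<Sum>h\<in>UNIV. a h * N h l z) = (\<Sum>h\<in>UNIV. \<Sum>j\<in>UNIV. snd z $ j * (a h * Gam h j l z))"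
        by (simp only: Gam_y'[OF z(1), symmetric] sum_distrib_left mult.left_commute)
      then show ?thesis by (subst (asm) sum.swap) (simp only: sum_distrib_left)
    qed
    have "(\<Sum>j\<in>UNIV. hh_curvature F i j m l x y * y $ j * y $ l) = snd z $ l *
       (\<Sum>j\<in>UNIV. snd z $ j * hh_curvature F i j m l x y)"
      by (simp add: z_def sum_distrib_left mult_ac)
    also have "(\<Sum>j\<in>UNIV. snd z $ j * hh_curvature F i j m l x y) =
      (\<Sum>j\<in>UNIV. snd z $ j * dx_hor m (Gam i j l) z) - (\<Sum>j\<in>UNIV. snd z $ j * dx_hor l (Gam i j m) z)
      + (\<Sum>j\<in>UNIV. snd z $ j * (\<Sum>h\<in>UNIV. Gam i h m z * Gam h j l z))
      - (\<Sum>j\<in>UNIV. snd z $ j * (\<Sum>h\<in>UNIV. Gam i h l z * Gam h j m z))"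
      by (simp only: hh_curvature_eq[OF assms] z_def[symmetric] right_diff_distrib distrib_left
          sum.distrib sum_subtractf)
    finally show "(\<Sum>j\<in>UNIV. hh_curvature F i j m l x y * y $ j * y $ l) = snd z $ l * (
      (\<Sum>j\<in>UNIV. snd z $ j * dx_hor m (Gam i j l) z)
      - (\<Sum>j\<in>UNIV. snd z $ j * dx_hor l (Gam i j m) z)
      + (\<Sum>h\<in>UNIV. Gam i h m z * N h l z) - (\<Sum>h\<in>UNIV. Gam i h l z * N h m z))"
      unfolding sw .
  qed
  also have "\<dots> = (\<Sum>l\<in>UNIV. snd z $ l * dx_hor m (N i l) z)
      + (\<Sum>l\<in>UNIV. snd z $ l * (\<Sum>j\<in>UNIV. N j m z * Gam i j l z))
      - (\<Sum>l\<in>UNIV. snd z $ l * dx_hor l (N i m) z)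
      - (\<Sum>l\<in>UNIV. snd z $ l * (\<Sum>j\<in>UNIV. N j l z * Gam i j m z))
      + (\<Sum>l\<in>UNIV. snd z $ l * (\<Sum>h\<in>UNIV. Gam i h m z * N h l z))
      - (\<Sum>l\<in>UNIV. snd z $ l * (\<Sum>h\<in>UNIV. Gam i h l z * N h m z))"
    by (simp only: dx_hor_Gam_y[OF z(1)] right_diff_distrib distrib_left sum.distrib sum_subtractf)
  \<comment> \<open>The corrections from \<open>dx_hor_Gam_y\<close> cancel the quadratic terms
    pairwise.\<close>
  also have "\<dots> = px m (S i) z - spray (N i m) z - (\<Sum>l\<in>UNIV. N i l z * N l m z)"
    unfolding spray_eq[OF z(1)] dx_hor_N_y[OF z(1)] by (simp add: mult.commute)
  finally show ?thesis by (simp add: z_def)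
qed

end

section \<open>The second variation in a chart\<close>

lemma dird_nth:
  fixes f :: "'a::euclidean_space \<Rightarrow> real ^ 'n"
  assumes "smooth_in U f" "x \<in> U"
  shows "dird (\<lambda>x. f x $ i) v x = dird f v x $ i"
  by (rule dird_eqI, rule bounded_linear.has_derivative[OF bounded_linear_vec_nth
        smooth_in_has_derivative[OF assms]])

lemma dird_commute_vec:
  fixes f :: "'a::euclidean_space \<Rightarrow> real ^ 'n"
  assumes U: "open U" and f: "smooth_in U f" and x: "x \<in> U"
  shows "dird (dird f u) v x = dird (dird f v) u x"
proof -
  have "dird (dird f u) v x $ i = dird (dird (\<lambda>x. f x $ i) u) v x" for u v i
  proof -
    have "dird (dird (\<lambda>x. f x $ i) u) v x = dird (\<lambda>x. dird f u x $ i) v x"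
      by (rule dird_cong[OF U smooth_in_nth[OF smooth_in_dird[OF f] U] x])
        (simp add: dird_nth[OF f])
    then show ?thesis by (simp add: dird_nth[OF smooth_in_dird[OF f] x])
  qed
  then show ?thesis
    by (simp add: vec_eq_iff dird_commute[OF U smooth_in_nth[OF f U] x, of _ u v])
qed

lemma dird_along_snd:
  assumes "smooth_in P h" "(e, s) \<in> P"
  shows "((\<lambda>r::real. h (e::real, r)) has_vector_derivative dird h (0, 1) (e, s)) (at s)"
  using dird_along[OF assms(1), of "(e, 0)" s "(0, 1)"] assms(2) by simp

lemma dird_along_fst:
  assumes "smooth_in P h" "(e, s) \<in> P"
  shows "((\<lambda>r::real. h (r, s::real)) has_vector_derivative dird h (1, 0) (e, s)) (at e)"
  using dird_along[OF assms(1), of "(0, s)" e "(1, 0)"] assms(2) by simp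

context finsler_chart
begin

definition G where "G z u w = (\<Sum>i\<in>UNIV. \<Sum>j\<in>UNIV. g i j z * u $ i * w $ j)"

text \<open>The connection term of the covariant derivative along a curve with lift
  \<open>z\<close>: by \<open>Gam_y\<close>, the derivative of a field a is a' +
  \<open>Nv z a\<close>.\<close>

definition Nv where "Nv z a = (\<chi> i. \<Sum>j\<in>UNIV. N i j z * a $ j)"

lemma G_add_left: "G z (u + v) w = G z u w + G z v w"
  by (simp add: G_def distrib_left distrib_right sum.distrib)

lemma G_add_right: "G z w (u + v) = G z w u + G z w v"
  by (simp add: G_def distrib_left sum.distrib)

lemma G_diff_right: "G z w (u - v) = G z w u - G z w v"
  by (simp add: G_def right_diff_distrib sum_subtractf)

lemma G_sym: "z \<in> W \<Longrightarrow> G z u w = G z w u"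
  unfolding G_def by (subst sum.swap) (simp add: g_sym[of z] mult_ac)

text \<open>By \<open>euler_Ly\<close>, pairing with the velocity needs only first vertical
  derivatives of L; hence \<open>psi\<close> below is the metric pairing of velocity and
  variation.\<close>

lemma G_vel: "z \<in> W \<Longrightarrow> G z u (snd z) = (\<Sum>i\<in>UNIV. Ly i z * u $ i)"
  unfolding G_def
  by (simp only: euler_Ly[symmetric] sum_distrib_right) (simp add: mult_ac)

text \<open>The hypothesis on \<open>z\<close> says that it moves like the lift of a geodesic at s.
  \<open>J\<close> allows one-sided derivatives at the ends of the parameter interval.\<close>

lemma spray_derivative:
  assumes z: "(z has_vector_derivative (snd (z s), - (\<chi> i. S i (z s)))) (at s within J)" "z s \<in> W"
    and h: "smooth_in W h"
  shows "((\<lambda>r. h (z r)) has_real_derivative spray h (z s)) (at s within J)"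
  using vector_derivative_diff_chain_within[OF z(1)
      has_derivative_at_withinI[OF smooth_in_has_derivative[OF h z(2)]]]
  by (simp only: spray_dird[OF h z(2)] has_real_derivative_iff_has_vector_derivative o_def)

text \<open>\<open>spray_g\<close> splits the derivative of the metric coefficients into two
  connection terms, one for each argument.\<close>

lemma metric_derivative:
  assumes z: "(z has_vector_derivative (snd (z s), - (\<chi> i. S i (z s)))) (at s within J)" "z s \<in> W"
    and u: "(u has_vector_derivative u') (at s within J)"
    and w: "(w has_vector_derivative w') (at s within J)"
  shows "((\<lambda>r. G (z r) (u r) (w r)) has_real_derivative
    G (z s) (u' + Nv (z s) (u s)) (w s) + G (z s) (u s) (w' + Nv (z s) (w s))) (at s within J)"
proof -
  note gd = spray_derivative[OF z smooth_g]
  have ud: "((\<lambda>r. u r $ i) has_real_derivative u' $ i) (at s within J)" for i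
    using bounded_linear.has_vector_derivative[OF bounded_linear_vec_nth u]
    by (simp add: has_real_derivative_iff_has_vector_derivative)
  have wd: "((\<lambda>r. w r $ i) has_real_derivative w' $ i) (at s within J)" for i
    using bounded_linear.has_vector_derivative[OF bounded_linear_vec_nth w]
    by (simp add: has_real_derivative_iff_has_vector_derivative)
  have 1: "(\<Sum>i\<in>UNIV. \<Sum>j\<in>UNIV. (\<Sum>l\<in>UNIV. g j l (z s) * N l i (z s)) * u s $ i * w s $ j)
      = G (z s) (Nv (z s) (u s)) (w s)"
  proof -
    have gs: "(\<Sum>l\<in>UNIV. g j l (z s) * N l i (z s)) = (\<Sum>l\<in>UNIV. g l j (z s) * N l i (z s))" for i j
      by (simp add: g_sym[OF z(2), of j])
    have "(\<Sum>i\<in>UNIV. \<Sum>j\<in>UNIV. (\<Sum>l\<in>UNIV. g j l (z s) * N l i (z s)) * u s $ i * w s $ j) =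
      (\<Sum>j\<in>UNIV. \<Sum>i\<in>UNIV. \<Sum>l\<in>UNIV. g l j (z s) * (N l i (z s) * u s $ i) * w s $ j)"
      unfolding gs by (subst sum.swap, simp only: sum_distrib_right) (simp add: mult_ac)
    also have "\<dots> = (\<Sum>j\<in>UNIV. \<Sum>l\<in>UNIV. \<Sum>i\<in>UNIV. g l j (z s) * (N l i (z s) * u s $ i) * w s $ j)"
      by (intro sum.cong refl sum.swap)
    also have "\<dots> = (\<Sum>l\<in>UNIV. \<Sum>j\<in>UNIV. \<Sum>i\<in>UNIV. g l j (z s) * (N l i (z s) * u s $ i) * w s $ j)"
      by (rule sum.swap)
    finally show ?thesis by (simp add: G_def Nv_def sum_distrib_left sum_distrib_right)
  qed
  have 2: "(\<Sum>i\<in>UNIV. \<Sum>j\<in>UNIV. (\<Sum>l\<in>UNIV. g i l (z s) * N l j (z s)) * u s $ i * w s $ j)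
      = G (z s) (u s) (Nv (z s) (w s))"
  proof -
    have "(\<Sum>i\<in>UNIV. \<Sum>j\<in>UNIV. (\<Sum>l\<in>UNIV. g i l (z s) * N l j (z s)) * u s $ i * w s $ j) =
      (\<Sum>i\<in>UNIV. \<Sum>j\<in>UNIV. \<Sum>l\<in>UNIV. g i l (z s) * u s $ i * (N l j (z s) * w s $ j))"
      by (simp only: sum_distrib_right) (simp add: mult_ac)
    also have "\<dots> = (\<Sum>i\<in>UNIV. \<Sum>l\<in>UNIV. \<Sum>j\<in>UNIV. g i l (z s) * u s $ i * (N l j (z s) * w s $ j))"
      by (intro sum.cong refl sum.swap)
    finally show ?thesis by (simp add: G_def Nv_def sum_distrib_left)
  qed
  have "((\<lambda>r. G (z r) (u r) (w r)) has_real_derivative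
    (\<Sum>i\<in>UNIV. \<Sum>j\<in>UNIV. (spray (g i j) (z s) * u s $ i + u' $ i * g i j (z s)) * w s $ j
       + w' $ j * (g i j (z s) * u s $ i))) (at s within J)"
    unfolding G_def by (intro DERIV_sum DERIV_mult gd ud wd)
  also have "(\<Sum>i\<in>UNIV. \<Sum>j\<in>UNIV. (spray (g i j) (z s) * u s $ i + u' $ i * g i j (z s)) * w s $ j
       + w' $ j * (g i j (z s) * u s $ i)) =
    (\<Sum>i\<in>UNIV. \<Sum>j\<in>UNIV. (\<Sum>l\<in>UNIV. g j l (z s) * N l i (z s)) * u s $ i * w s $ j) +
    (\<Sum>i\<in>UNIV. \<Sum>j\<in>UNIV. (\<Sum>l\<in>UNIV. g i l (z s) * N l j (z s)) * u s $ i * w s $ j) +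
    G (z s) u' (w s) + G (z s) (u s) w'"
    unfolding G_def
    by (simp only: spray_g[OF z(2)] sum.distrib distrib_right) (simp add: mult_ac)
  also have "\<dots> = G (z s) (u' + Nv (z s) (u s)) (w s) + G (z s) (u s) (w' + Nv (z s) (w s))"
    unfolding 1 2 by (simp add: G_add_left G_add_right)
  finally show ?thesis .
qed

end

text \<open>\<open>X\<close> stands for the coordinate expression of a variation, extended smoothly
  to an open set, so that endpoints of the curves become interior points. Outside the original strip
  little is known about the extension; constancy of L and the geodesic equation are therefore
  imposed only at single values of s.\<close>

locale chart_variation = finsler_chart F U W
  for F :: "'n::finite lagr" and U W +
  fixes P :: "(real \<times> real) set" and X :: "real \<times> real \<Rightarrow> real ^ 'n"
  assumes open_P: "open P" and smooth_X: "smooth_in P X"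
    and lift: "\<And>p. p \<in> P \<Longrightarrow> (X p, dird X (0, 1) p) \<in> W"
begin

definition Xe where "Xe = dird X (1, 0)"
definition Xs where "Xs = dird X (0, 1)"
definition Z where "Z p = (X p, Xs p)"
definition psi where "psi p = (\<Sum>i\<in>UNIV. Ly i (Z p) * Xe p $ i)"
text \<open>The Euler-Lagrange expression d/ds L_y - L_x, by \<open>dird_Ly_Z\<close>, written as
  \<open>g\<close> applied to the geodesic equation.\<close>

definition EL where "EL i p = (\<Sum>k\<in>UNIV. g i k (Z p) * (dird Xs (0, 1) p $ k + S k (Z p)))"

lemma smooth_Xe: "smooth_in P Xe" by (simp add: Xe_def smooth_X smooth_in_dird)
lemma smooth_Xs: "smooth_in P Xs" by (simp add: Xs_def smooth_X smooth_in_dird)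
lemma Z_W: "p \<in> P \<Longrightarrow> Z p \<in> W" by (simp add: Z_def Xs_def lift)
lemma smooth_Z: "smooth_in P Z"
  unfolding Z_def by (intro smooth_in_Pair smooth_X smooth_Xs open_P)

lemma smooth_comp_Z: "smooth_in W h \<Longrightarrow> smooth_in P (\<lambda>p. h (Z p))"
  by (rule smooth_in_compose[OF _ smooth_Z open_P open_W]) (auto simp: Z_W)

lemma smooth_psi: "smooth_in P psi"
  unfolding psi_def
  by (intro smooth_in_sum smooth_in_mult smooth_comp_Z smooth_Ly smooth_in_nth smooth_Xe open_P)

lemma dird_Z: assumes "p \<in> P" shows "dird Z v p = (dird X v p, dird Xs v p)"
  unfolding Z_def
  by (rule dird_eqI, rule has_derivative_Pair[OF smooth_in_has_derivative[OF smooth_X assms]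
      smooth_in_has_derivative[OF smooth_Xs assms]])

lemma dird_comp_Z:
  assumes "smooth_in W h" "p \<in> P"
  shows "dird (\<lambda>p. h (Z p)) v p = dird h (dird X v p, dird Xs v p) (Z p)"
  using diff_chain_at[OF smooth_in_has_derivative[OF smooth_Z assms(2)]
      smooth_in_has_derivative[OF assms(1) Z_W[OF assms(2)]]]
  by (simp add: dird_eqI o_def dird_Z[OF assms(2)])

lemma dird_Xs_Xe: "p \<in> P \<Longrightarrow> dird Xs (1, 0) p = dird Xe (0, 1) p"
  unfolding Xs_def Xe_def by (rule dird_commute_vec[OF open_P smooth_X])

lemma dird_Ly_Z:
  assumes p: "p \<in> P"
  shows "dird (\<lambda>p. Ly i (Z p)) (0, 1) p = EL i p + px i Fz (Z p)"
proof -
  have z: "Z p \<in> W" "snd (Z p) = Xs p" using Z_W[OF p] by (auto simp: Z_def)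
  have "dird (\<lambda>p. Ly i (Z p)) (0, 1) p =
      (\<Sum>k\<in>UNIV. Xs p $ k * px k (Ly i) (Z p)) + (\<Sum>k\<in>UNIV. dird Xs (0, 1) p $ k * g k i (Z p))"
    unfolding dird_comp_Z[OF smooth_Ly p] dird_pair_expand[OF smooth_Ly z(1), where a = "dird X (0, 1) p"]
    by (simp add: px_def g_def py_def Xs_def)
  moreover have "EL i p = (\<Sum>k\<in>UNIV. dird Xs (0, 1) p $ k * g k i (Z p)) + Sl i (Z p)"
    by (simp only: EL_def distrib_left sum.distrib lower_S[OF z(1)])
      (simp add: g_sym[OF z(1), of i] mult.commute)
  ultimately show ?thesis by (simp add: Sl_def z(2))
qed

text \<open>First variation formula before integration: \<open>dird_Ly_Z\<close> treats the factor
  L_y, and since the two partial derivatives of \<open>X\<close> commute, the remaining terms form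
  the \<epsilon>-derivative of L.\<close>

lemma dird_psi_s:
  assumes p: "p \<in> P"
  shows "dird psi (0, 1) p = (\<Sum>i\<in>UNIV. EL i p * Xe p $ i) + dird (\<lambda>p. Fz (Z p)) (1, 0) p"
proof -
  have z: "Z p \<in> W" by (rule Z_W[OF p])
  have "dird psi (0, 1) p = (\<Sum>i\<in>UNIV. dird (\<lambda>p. Ly i (Z p) * Xe p $ i) (0, 1) p)"
    unfolding psi_def
    by (rule dird_sum[OF _ p])
      (intro smooth_in_mult smooth_comp_Z smooth_Ly smooth_in_nth smooth_Xe open_P)
  also have "\<dots> = (\<Sum>i\<in>UNIV. (EL i p + px i Fz (Z p)) * Xe p $ i + Ly i (Z p) * dird Xe (0, 1) p $ i)"
    by (simp only: dird_mult[OF smooth_comp_Z[OF smooth_Ly] smooth_in_nth[OF smooth_Xe open_P] p] dird_Ly_Z[OF p]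
        dird_nth[OF smooth_Xe p])
  also have "\<dots> = (\<Sum>i\<in>UNIV. EL i p * Xe p $ i) + ((\<Sum>i\<in>UNIV. Xe p $ i * px i Fz (Z p)) +
      (\<Sum>i\<in>UNIV. dird Xe (0, 1) p $ i * Ly i (Z p)))"
    by (simp only: distrib_right sum.distrib) (simp add: mult.commute)
  also have "(\<Sum>i\<in>UNIV. Xe p $ i * px i Fz (Z p)) + (\<Sum>i\<in>UNIV. dird Xe (0, 1) p $ i * Ly i (Z p))
      = dird (\<lambda>p. Fz (Z p)) (1, 0) p"
    unfolding dird_comp_Z[OF smooth_Fz p] dird_pair_expand[OF smooth_Fz z, of "dird X (1, 0) p"]
    by (simp add: px_def Ly_def py_def Xe_def[symmetric] dird_Xs_Xe[OF p])
  finally show ?thesis .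
qed

lemma EL_zero:
  assumes "p \<in> P" "\<And>i. EL i p = 0" shows "dird Xs (0, 1) p $ k = - S k (Z p)"
  using lower_cancel[OF Z_W[OF assms(1)], of "\<lambda>k. dird Xs (0, 1) p $ k + S k (Z p)" "\<lambda>_. 0" k] assms(2)
  by (simp add: EL_def)

text \<open>Linearisation of x'' + S(x, x') in the direction of the variation field: the Jacobi
  operator before covariant rewriting.\<close>

definition jac where
  "jac s = (\<chi> k. dird (dird Xe (0, 1)) (0, 1) (0, s) $ k
     + dird (S k) (Xe (0, s), dird Xe (0, 1) (0, s)) (Z (0, s)))"

text \<open>By \<open>dird_psi_s\<close> the s-derivative of \<open>psi\<close> equals the pairing
  of \<open>EL\<close> with \<open>Xe\<close> for \<epsilon> near 0. As \<open>EL\<close> vanishes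
  at \<epsilon> = 0, only its own \<epsilon>-derivative contributes.\<close>

lemma second_derivative_psi:
  assumes p: "(0, s) \<in> P" and EL: "\<And>i. EL i (0, s) = 0"
    and const: "\<forall>\<^sub>F e in nhds 0. dird (\<lambda>p. Fz (Z p)) (1, 0) (e, s) = 0"
  shows "dird (dird psi (1, 0)) (0, 1) (0, s) = G (Z (0, s)) (Xe (0, s)) (jac s)"
proof -
  have sEL: "smooth_in P (EL i)" for i
    unfolding EL_def
    by (intro smooth_in_sum smooth_in_mult smooth_in_add smooth_comp_Z smooth_g smooth_S smooth_in_nth
        smooth_in_dird smooth_Xs open_P)
  have ss: "smooth_in P (\<lambda>p. dird Xs (0, 1) p $ k)" for k
    by (intro smooth_in_nth smooth_in_dird smooth_Xs open_P)
  have EL_e: "dird (EL i) (1, 0) (0, s) = (\<Sum>k\<in>UNIV. g i k (Z (0, s)) * jac s $ k)" for i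
  proof -
    have c: "dird (dird Xs (0, 1)) (1, 0) (0, s) = dird (dird Xe (0, 1)) (0, 1) (0, s)"
      using dird_commute_vec[OF open_P smooth_Xs p, of "(0, 1)" "(1, 0)"]
        dird_cong[OF open_P smooth_in_dird[OF smooth_Xe] p, of "(0, 1)" "dird Xs (1, 0)" "(0, 1)"]
      by (simp add: dird_Xs_Xe)
    \<comment> \<open>The bracket vanishes on the geodesic by \<open>EL_zero\<close>, so the
      derivative of the metric coefficient drops out.\<close>
    have 1: "dird (\<lambda>p. g i k (Z p) * (dird Xs (0, 1) p $ k + S k (Z p))) (1, 0) (0, s) =
        g i k (Z (0, s)) * dird (\<lambda>p. dird Xs (0, 1) p $ k + S k (Z p)) (1, 0) (0, s)" for k
      using dird_mult[OF smooth_comp_Z[OF smooth_g[of i k]]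
          smooth_in_add[OF ss[of k] smooth_comp_Z[OF smooth_S[of k]] open_P] p, of "(1, 0)"]
      unfolding EL_zero[OF p EL, of k] by simp
    have 2: "dird (\<lambda>p. dird Xs (0, 1) p $ k + S k (Z p)) (1, 0) (0, s) = jac s $ k" for k
    proof -
      have "dird (\<lambda>p. dird Xs (0, 1) p $ k) (1, 0) (0, s) = dird (dird Xe (0, 1)) (0, 1) (0, s) $ k"
        using dird_nth[OF smooth_in_dird[OF smooth_Xs, of "(0, 1)"] p, of k "(1, 0)"] unfolding c .
      moreover have "dird (\<lambda>p. S k (Z p)) (1, 0) (0, s) =
          dird (S k) (Xe (0, s), dird Xe (0, 1) (0, s)) (Z (0, s))"
        using dird_comp_Z[OF smooth_S[of k] p, of "(1, 0)"]
        unfolding dird_Xs_Xe[OF p] Xe_def[symmetric] .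
      ultimately show ?thesis
        using dird_add[OF ss[of k] smooth_comp_Z[OF smooth_S[of k]] p, of "(1, 0)"]
        by (simp only: jac_def vec_lambda_beta)
    qed
    have "dird (EL i) (1, 0) (0, s) = (\<Sum>k\<in>UNIV.
        dird (\<lambda>p. g i k (Z p) * (dird Xs (0, 1) p $ k + S k (Z p))) (1, 0) (0, s))"
      unfolding EL_def
      by (rule dird_sum[OF _ p])
        (intro smooth_in_mult smooth_in_add smooth_comp_Z smooth_g smooth_S ss open_P)
    then show ?thesis by (simp only: 1 2)
  qed
  have d1: "((\<lambda>e. dird psi (0, 1) (e, s)) has_real_derivative dird (dird psi (0, 1)) (1, 0) (0, s)) (at 0)"
    using dird_along_fst[OF smooth_in_dird[OF smooth_psi] p]
    by (simp add: has_real_derivative_iff_has_vector_derivative)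
  have "((\<lambda>e. \<Sum>i\<in>UNIV. EL i (e, s) * Xe (e, s) $ i) has_real_derivative
      (\<Sum>i\<in>UNIV. dird (EL i) (1, 0) (0, s) * Xe (0, s) $ i + dird (\<lambda>p. Xe p $ i) (1, 0) (0, s) * EL i (0, s))) (at 0)"
    using dird_along_fst[OF sEL p] dird_along_fst[OF smooth_in_nth[OF smooth_Xe open_P] p]
    by (intro DERIV_sum DERIV_mult) (simp_all add: has_real_derivative_iff_has_vector_derivative)
  then have d2: "((\<lambda>e. \<Sum>i\<in>UNIV. EL i (e, s) * Xe (e, s) $ i) has_real_derivative
      (\<Sum>i\<in>UNIV. dird (EL i) (1, 0) (0, s) * Xe (0, s) $ i)) (at 0)"
    by (simp add: EL)
  have "\<forall>\<^sub>F e in nhds 0. (e, s) \<in> P"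
  proof -
    have "((\<lambda>e. (e, s)) \<longlongrightarrow> (0, s)) (nhds (0::real))"
      by (intro tendsto_Pair filterlim_ident tendsto_const)
    from topological_tendstoD[OF this open_P p] show ?thesis .
  qed
  with const have ev: "\<forall>\<^sub>F e in nhds 0. dird psi (0, 1) (e, s) = (\<Sum>i\<in>UNIV. EL i (e, s) * Xe (e, s) $ i)"
    by eventually_elim (simp add: dird_psi_s)
  then have d3: "((\<lambda>e. dird psi (0, 1) (e, s)) has_real_derivative
      (\<Sum>i\<in>UNIV. dird (EL i) (1, 0) (0, s) * Xe (0, s) $ i)) (at 0)"
    using DERIV_cong_ev[OF refl ev refl] d2 by simp
  have "dird (dird psi (1, 0)) (0, 1) (0, s) = dird (dird psi (0, 1)) (1, 0) (0, s)"
    by (rule dird_commute[OF open_P smooth_psi p])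
  also have "\<dots> = (\<Sum>i\<in>UNIV. dird (EL i) (1, 0) (0, s) * Xe (0, s) $ i)" by (rule DERIV_unique[OF d1 d3])
  finally show ?thesis
    by (simp only: EL_e G_def sum_distrib_right) (simp add: mult_ac)
qed

definition cov where "cov s = dird Xe (0, 1) (0, s) + Nv (Z (0, s)) (Xe (0, s))"

text \<open>The derivatives of the connection coefficients in \<open>cov2\<close>, the second covariant derivative of the
  variation field, are taken along the spray, that is, with the geodesic equation substituted.\<close>

definition cov2 where
  "cov2 s = dird (dird Xe (0, 1)) (0, 1) (0, s)
     + (\<chi> k. (\<Sum>l\<in>UNIV. spray (N k l) (Z (0, s)) * Xe (0, s) $ l)
       + (\<Sum>l\<in>UNIV. N k l (Z (0, s)) * dird Xe (0, 1) (0, s) $ l))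
     + Nv (Z (0, s)) (cov s)"

lemma Z_derivative:
  assumes p: "(0, s) \<in> P" and EL: "\<And>i. EL i (0, s) = 0"
  shows "((\<lambda>r. Z (0, r)) has_vector_derivative (snd (Z (0, s)), - (\<chi> i. S i (Z (0, s))))) (at s within J)"
proof -
  have "dird Z (0, 1) (0, s) = (snd (Z (0, s)), - (\<chi> i. S i (Z (0, s))))"
    unfolding dird_Z[OF p] by (simp add: Z_def Xs_def[symmetric] vec_eq_iff)
      (simp add: EL_zero[OF p EL] Z_def)
  then show ?thesis
    using has_vector_derivative_at_within[OF dird_along_snd[OF smooth_Z p]] by simp
qed

lemma Xe_derivative:
  assumes p: "(0, s) \<in> P"
  shows "((\<lambda>r. Xe (0, r)) has_vector_derivative dird Xe (0, 1) (0, s)) (at s within J)"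
  by (rule has_vector_derivative_at_within[OF dird_along_snd[OF smooth_Xe p]])

lemma norm_variation_derivative:
  assumes p: "(0, s) \<in> P" and EL: "\<And>i. EL i (0, s) = 0"
  shows "((\<lambda>r. G (Z (0, r)) (Xe (0, r)) (Xe (0, r))) has_real_derivative
    2 * G (Z (0, s)) (Xe (0, s)) (cov s)) (at s within J)"
  using metric_derivative[OF Z_derivative[OF assms] Z_W[OF p] Xe_derivative[OF p] Xe_derivative[OF p]]
  by (simp add: cov_def G_sym[OF Z_W[OF p], of _ "Xe (0, s)"])

lemma cov_derivative:
  assumes p: "(0, s) \<in> P" and EL: "\<And>i. EL i (0, s) = 0"
  shows "((\<lambda>r. G (Z (0, r)) (Xe (0, r)) (cov r)) has_real_derivative
    G (Z (0, s)) (cov s) (cov s) + G (Z (0, s)) (Xe (0, s)) (cov2 s)) (at s within J)"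
proof -
  note Z' = Z_derivative[OF assms, of J]
  note Nd = spray_derivative[OF Z' Z_W[OF p] smooth_N]
  have Xd: "((\<lambda>r. Xe (0, r) $ l) has_real_derivative dird Xe (0, 1) (0, s) $ l) (at s within J)" for l
    using bounded_linear.has_vector_derivative[OF bounded_linear_vec_nth Xe_derivative[OF p]]
    by (simp add: has_real_derivative_iff_has_vector_derivative)
  have "((\<lambda>r. \<Sum>l\<in>UNIV. N k l (Z (0, r)) * Xe (0, r) $ l) has_real_derivative
      (\<Sum>l\<in>UNIV. spray (N k l) (Z (0, s)) * Xe (0, s) $ l + dird Xe (0, 1) (0, s) $ l * N k l (Z (0, s))))
      (at s within J)" for k
    by (intro DERIV_sum DERIV_mult Nd Xd)
  then have "((\<lambda>r. \<Sum>l\<in>UNIV. N k l (Z (0, r)) * Xe (0, r) $ l) has_vector_derivative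
      (\<Sum>l\<in>UNIV. spray (N k l) (Z (0, s)) * Xe (0, s) $ l)
       + (\<Sum>l\<in>UNIV. N k l (Z (0, s)) * dird Xe (0, 1) (0, s) $ l)) (at s within J)" for k
    by (simp add: has_real_derivative_iff_has_vector_derivative sum.distrib mult.commute)
  then have Nvd: "((\<lambda>r. Nv (Z (0, r)) (Xe (0, r))) has_vector_derivative
      (\<chi> k. (\<Sum>l\<in>UNIV. spray (N k l) (Z (0, s)) * Xe (0, s) $ l)
       + (\<Sum>l\<in>UNIV. N k l (Z (0, s)) * dird Xe (0, 1) (0, s) $ l))) (at s within J)"
    unfolding Nv_def has_vector_derivative_def
    by (subst has_derivative_componentwise_within) (auto simp: Basis_vec_def inner_axis)
  have "(cov has_vector_derivative dird (dird Xe (0, 1)) (0, 1) (0, s)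
      + (\<chi> k. (\<Sum>l\<in>UNIV. spray (N k l) (Z (0, s)) * Xe (0, s) $ l)
       + (\<Sum>l\<in>UNIV. N k l (Z (0, s)) * dird Xe (0, 1) (0, s) $ l))) (at s within J)"
    unfolding cov_def
    by (intro has_vector_derivative_add Nvd has_vector_derivative_at_within[OF dird_along_snd[OF
            smooth_in_dird[OF smooth_Xe] p]])
  from metric_derivative[OF Z' Z_W[OF p] Xe_derivative[OF p] this]
  show ?thesis by (simp add: cov_def[symmetric] cov2_def)
qed

definition jac_curv where
  "jac_curv s = (\<chi> i. \<Sum>j\<in>UNIV. \<Sum>k\<in>UNIV. \<Sum>l\<in>UNIV.
        hh_curvature F i j k l (X (0, s)) (Xs (0, s)) * Xs (0, s) $ j * Xe (0, s) $ k * Xs (0, s) $ l)"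

text \<open>A'' cancels. The two terms N A' of \<open>cov2\<close>, one from differentiating
  \<open>Nv\<close>, one from the outer \<open>Nv\<close>, match the vertical derivative 2N of
  \<open>S\<close> from \<open>py_S\<close>; what is left is the expression in
  \<open>curvature_along_y\<close>.\<close>

lemma jacobi_identity:
  assumes p: "(0, s) \<in> P" shows "jac s - cov2 s = jac_curv s"
proof (subst vec_eq_iff, rule allI)
  fix k
  let ?z = "Z (0, s)" and ?A = "Xe (0, s)" and ?B = "dird Xe (0, 1) (0, s)"
  have z: "?z \<in> W" by (rule Z_W[OF p])
  have XZ: "(X (0, s), Xs (0, s)) = ?z" by (simp add: Z_def)
  have "jac_curv s $ k = (\<Sum>m\<in>UNIV. \<Sum>j\<in>UNIV. \<Sum>l\<in>UNIV.
      ?A $ m * (hh_curvature F k j m l (X (0, s)) (Xs (0, s)) * Xs (0, s) $ j * Xs (0, s) $ l))"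
    unfolding jac_curv_def by (subst sum.swap) (simp add: mult_ac)
  also have "\<dots> = (\<Sum>m\<in>UNIV. ?A $ m * (px m (S k) ?z - spray (N k m) ?z - (\<Sum>l\<in>UNIV. N k l ?z * N l m ?z)))"
    by (simp only: sum_distrib_left[symmetric] curvature_along_y[OF z[folded XZ]] XZ)
  also have "\<dots> = (\<Sum>m\<in>UNIV. ?A $ m * px m (S k) ?z) - (\<Sum>m\<in>UNIV. spray (N k m) ?z * ?A $ m)
      - (\<Sum>m\<in>UNIV. ?A $ m * (\<Sum>l\<in>UNIV. N k l ?z * N l m ?z))"
    by (simp add: right_diff_distrib sum_subtractf mult.commute)
  also have "(\<Sum>m\<in>UNIV. ?A $ m * (\<Sum>l\<in>UNIV. N k l ?z * N l m ?z)) =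
      (\<Sum>l\<in>UNIV. N k l ?z * (\<Sum>m\<in>UNIV. N l m ?z * ?A $ m))"
    by (simp only: sum_distrib_left, subst sum.swap) (simp add: mult_ac)
  finally have R: "jac_curv s $ k = (\<Sum>m\<in>UNIV. ?A $ m * px m (S k) ?z)
      - (\<Sum>m\<in>UNIV. spray (N k m) ?z * ?A $ m)
      - (\<Sum>l\<in>UNIV. N k l ?z * (\<Sum>m\<in>UNIV. N l m ?z * ?A $ m))" .
  have "dird (S k) (?A, ?B) ?z = (\<Sum>m\<in>UNIV. ?A $ m * px m (S k) ?z) + 2 * (\<Sum>l\<in>UNIV. N k l ?z * ?B $ l)"
    unfolding dird_pair_expand[OF smooth_S z, where a = ?A] px_def[symmetric] py_def[symmetric] py_S[OF z]
    by (simp add: sum_distrib_left mult_ac)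
  then show "(jac s - cov2 s) $ k = jac_curv s $ k"
    unfolding R by (simp add: jac_def cov2_def Nv_def cov_def distrib_left sum.distrib)
qed

theorem second_variation_local:
  assumes p: "(0, s) \<in> P" and EL: "\<And>i. EL i (0, s) = 0"
    and const: "\<forall>\<^sub>F e in nhds 0. dird (\<lambda>p. Fz (Z p)) (1, 0) (e, s) = 0"
  shows "((\<lambda>r. dird psi (1, 0) (0, r) - G (Z (0, r)) (Xe (0, r)) (cov r)) has_real_derivative
    G (Z (0, s)) (Xe (0, s)) (jac_curv s) - G (Z (0, s)) (cov s) (cov s)) (at s within J)"
proof -
  have "((\<lambda>r. dird psi (1, 0) (0, r)) has_real_derivative G (Z (0, s)) (Xe (0, s)) (jac s)) (at s within J)"
    using has_vector_derivative_at_within[OF dird_along_snd[OF smooth_in_dird[OF smooth_psi, of "(1, 0)"] p]]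
    unfolding second_derivative_psi[OF assms] has_real_derivative_iff_has_vector_derivative .
  from DERIV_diff[OF this cov_derivative[OF p EL]] show ?thesis
    by (simp add: jacobi_identity[OF p, symmetric] G_diff_right algebra_simps)
qed

end

section \<open>Tangent vectors on the manifold\<close>

lemma is_chartD:
  assumes "is_chart c"
  shows "open (fst c)" "open (snd c ` fst c)"
    "homeomorphism (fst c) (snd c ` fst c) (snd c) (chart_inv c)"
  using assms by (simp_all add: is_chart_def)

lemma smooth_atlas_chart: "smooth_atlas \<A> \<Longrightarrow> c \<in> \<A> \<Longrightarrow> is_chart c"
  by (simp add: smooth_atlas_def)

lemma chart_inv_chart: "is_chart c \<Longrightarrow> p \<in> fst c \<Longrightarrow> chart_inv c (snd c p) = p"
  by (rule homeomorphism_apply1[OF is_chartD(3)])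

lemma open_chart_image:
  assumes c: "is_chart c" and "open V" shows "open (snd c ` (fst c \<inter> V))"
  by (rule openin_open_trans[OF homeomorphism_imp_open_map[OF is_chartD(3)[OF c]
        openin_open_Int[OF assms(2)]] is_chartD(2)[OF c]])

lemma smooth_in_transition:
  assumes "smooth_atlas \<A>" "c \<in> \<A>" "d \<in> \<A>"
  shows "open (snd c ` (fst c \<inter> fst d))" "smooth_in (snd c ` (fst c \<inter> fst d)) (transition c d)"
proof -
  show o: "open (snd c ` (fst c \<inter> fst d))"
    by (rule open_chart_image[OF smooth_atlas_chart[OF assms(1,2)]
          is_chartD(1)[OF smooth_atlas_chart[OF assms(1,3)]]])
  show "smooth_in (snd c ` (fst c \<inter> fst d)) (transition c d)"
    using assms by (intro smooth_on_open[OF o]) (simp add: smooth_atlas_def)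
qed

lemma transition_has_derivative:
  assumes "smooth_atlas \<A>" "c \<in> \<A>" "d \<in> \<A>" "p \<in> fst c" "p \<in> fst d"
  shows "(transition c d has_derivative frechet_derivative (transition c d) (at (snd c p))) (at (snd c p))"
  using smooth_in_has_derivative[OF smooth_in_transition(2)[OF assms(1-3)], of "snd c p"] assms(4,5)
  by (simp add: dird_def)

lemma transition_self:
  assumes "smooth_atlas \<A>" "c \<in> \<A>" "p \<in> fst c"
  shows "frechet_derivative (transition c c) (at (snd c p)) = (\<lambda>y. y)"
proof -
  note c = smooth_atlas_chart[OF assms(1,2)]
  have "(transition c c has_derivative (\<lambda>y. y)) (at (snd c p))"
  proof (rule has_derivative_transform_within_open[OF has_derivative_ident])
    show "open (snd c ` fst c)" by (rule is_chartD(2)[OF c])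
    show "snd c p \<in> snd c ` fst c" using assms by simp
    show "x = transition c c x" if "x \<in> snd c ` fst c" for x
      using that chart_inv_chart[OF c] by (auto simp: transition_def)
  qed
  then show ?thesis using frechet_derivative_at by metis
qed

text \<open>Chain rule for the cocycle identity of the transition maps; it holds on the image of the
  triple overlap, which is open.\<close>

lemma transition_compose:
  assumes A: "smooth_atlas \<A>" "c \<in> \<A>" "d \<in> \<A>" "e \<in> \<A>" and p: "p \<in> fst c" "p \<in> fst d" "p \<in> fst e"
  shows "frechet_derivative (transition d e) (at (snd d p))
      (frechet_derivative (transition c d) (at (snd c p)) y) =
    frechet_derivative (transition c e) (at (snd c p)) y"
proof -
  note ch = A(2-4)[THEN smooth_atlas_chart[OF A(1)]]
  have t: "transition c d (snd c q) = snd d q" if "is_chart c" "q \<in> fst c"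
    for c d :: "('a, 'b) chart" and q
    using chart_inv_chart[OF that] by (simp add: transition_def)
  have "((transition d e \<circ> transition c d) has_derivative
      (frechet_derivative (transition d e) (at (snd d p)) \<circ>
       frechet_derivative (transition c d) (at (snd c p)))) (at (snd c p))"
    using transition_has_derivative[OF A(1,2,3) p(1,2)] transition_has_derivative[OF A(1,3,4) p(2,3)]
    by (intro diff_chain_at) (simp_all add: t ch p)
  then have "(transition c e has_derivative
      (frechet_derivative (transition d e) (at (snd d p)) \<circ>
       frechet_derivative (transition c d) (at (snd c p)))) (at (snd c p))"
  proof (rule has_derivative_transform_within_open)
    show "open (snd c ` (fst c \<inter> (fst d \<inter> fst e)))"
      by (intro open_chart_image open_Int is_chartD(1) ch)
    show "snd c p \<in> snd c ` (fst c \<inter> (fst d \<inter> fst e))" using p by auto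
    show "(transition d e \<circ> transition c d) x = transition c e x"
      if "x \<in> snd c ` (fst c \<inter> (fst d \<inter> fst e))" for x
      using that by (auto simp: t ch)
  qed
  from frechet_derivative_at[OF this] show ?thesis by (metis o_apply)
qed

lemma tangent_space_transform:
  "v \<in> tangent_space \<A> p \<Longrightarrow> c \<in> \<A> \<Longrightarrow> d \<in> \<A> \<Longrightarrow> p \<in> fst c \<Longrightarrow> p \<in> fst d \<Longrightarrow>
    v d = frechet_derivative (transition c d) (at (snd c p)) (v c)"
  unfolding tangent_space_def by blast

lemma tangent_space_outside: "v \<in> tangent_space \<A> p \<Longrightarrow> \<not> (c \<in> \<A> \<and> p \<in> fst c) \<Longrightarrow> v c = 0"
  unfolding tangent_space_def by blast

lemma tvec_of_tangent:
  assumes "smooth_atlas \<A>" "c \<in> \<A>" "p \<in> fst c"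
  shows "tvec_of \<A> c p y \<in> tangent_space \<A> p"
  unfolding tangent_space_def
proof (intro CollectI conjI allI ballI impI)
  fix d e assume d: "d \<in> \<A>" "e \<in> \<A>" "p \<in> fst d \<and> p \<in> fst e"
  then show "tvec_of \<A> c p y e = frechet_derivative (transition d e) (at (snd d p)) (tvec_of \<A> c p y d)"
    using transition_compose[OF assms(1,2) d(1,2) assms(3), of y] by (simp add: tvec_of_def)
qed (auto simp: tvec_of_def)

lemma tvec_of_self:
  assumes "smooth_atlas \<A>" "c \<in> \<A>" "p \<in> fst c" shows "tvec_of \<A> c p y c = y"
  using transition_self[OF assms] assms by (simp add: tvec_of_def)

text \<open>The transformation law recovers all components from one, so \<open>coord_rep\<close>,
  which sees only that one, still gives the value of L (\<open>L_in_chart\<close>).\<close>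

lemma tvec_of_component:
  assumes "v \<in> tangent_space \<A> p" "c \<in> \<A>" "p \<in> fst c" shows "tvec_of \<A> c p (v c) = v"
proof
  fix d show "tvec_of \<A> c p (v c) d = v d"
  proof (cases "d \<in> \<A> \<and> p \<in> fst d")
    case True
    then show ?thesis using tangent_space_transform[OF assms(1,2) _ assms(3), of d]
      by (simp add: tvec_of_def)
  next
    case False
    show ?thesis
      by (simp only: tvec_of_def False if_False tangent_space_outside[OF assms(1) False])
  qed
qed

text \<open>Provides the line v + t w in a single tangent space, along which \<open>Psi\<close> and
  \<open>Chi\<close> differentiate L.\<close>

lemma tangent_space_combination:
  assumes "smooth_atlas \<A>" "v \<in> tangent_space \<A> p" "w \<in> tangent_space \<A> p"
  shows "(\<lambda>d. v d + t *\<^sub>R w d) \<in> tangent_space \<A> p"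
  unfolding tangent_space_def
proof (intro CollectI conjI allI ballI impI)
  fix c d assume c: "c \<in> \<A>" "d \<in> \<A>" "p \<in> fst c \<and> p \<in> fst d"
  then have p: "p \<in> fst c" "p \<in> fst d" by auto
  note l = has_derivative_linear[OF transition_has_derivative[OF assms(1) c(1,2) p]]
  show "v d + t *\<^sub>R w d = frechet_derivative (transition c d) (at (snd c p)) (v c + t *\<^sub>R w c)"
    by (simp only: linear_add[OF l] linear_scale[OF l] tangent_space_transform[OF assms(2) c(1,2) p]
        tangent_space_transform[OF assms(3) c(1,2) p])
next
  fix c assume "\<not> (c \<in> \<A> \<and> p \<in> fst c)"
  from tangent_space_outside[OF assms(2) this] tangent_space_outside[OF assms(3) this]
  show "v c + t *\<^sub>R w c = 0" by simp
qed

text \<open>Transition derivatives are linear, so a vector that vanishes in one chart vanishes in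
  all.\<close>

lemma slit_component_nonzero:
  assumes "smooth_atlas \<A>" "v \<in> slit_tangent_space \<A> p" "c \<in> \<A>" "p \<in> fst c"
  shows "v c \<noteq> 0"
proof
  assume 0: "v c = 0"
  have v: "v \<in> tangent_space \<A> p" "v \<noteq> (\<lambda>_. 0)" using assms(2) by (auto simp: slit_tangent_space_def)
  have "v d = 0" for d
  proof (cases "d \<in> \<A> \<and> p \<in> fst d")
    case True
    then have d: "d \<in> \<A>" "p \<in> fst d" by auto
    show ?thesis
      unfolding tangent_space_transform[OF v(1) assms(3) d(1) assms(4) d(2)] 0
      by (rule linear_0[OF has_derivative_linear[OF
            transition_has_derivative[OF assms(1,3) d(1) assms(4) d(2)]]])
  qed (rule tangent_space_outside[OF v(1)])
  then have "v = (\<lambda>_. 0)" by (rule ext)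
  then show False using v(2) by contradiction
qed

lemma L_in_chart:
  assumes "smooth_atlas \<A>" "v \<in> tangent_space \<A> p" "c \<in> \<A>" "p \<in> fst c"
  shows "L p v = coord_rep \<A> L c (snd c p) (v c)"
proof -
  show ?thesis
    unfolding coord_rep_def chart_inv_chart[OF smooth_atlas_chart[OF assms(1,3)] assms(4)]
      tvec_of_component[OF assms(2-4)] ..
qed

lemma finsler_chart_coord_rep:
  assumes fin: "finsler_spacetime \<A> L" and c: "c \<in> \<A>"
  shows "finsler_chart (coord_rep \<A> L c) (snd c ` fst c) ((snd c ` fst c) \<times> (- {0}))"
proof
  have A: "smooth_atlas \<A>" using fin by (simp add: finsler_spacetime_def)
  then have ch: "is_chart c" using c by (rule smooth_atlas_chart)
  show o: "open (snd c ` fst c)" by (rule is_chartD(2)[OF ch])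
  show "smooth_in ((snd c ` fst c) \<times> (- {0})) (\<lambda>z. coord_rep \<A> L c (fst z) (snd z))"
  proof (rule smooth_on_open)
    show "open ((snd c ` fst c) \<times> - {0 :: real ^ 'b})" by (intro open_Times o) auto
    show "smooth_on ((snd c ` fst c) \<times> (- {0})) (\<lambda>z. coord_rep \<A> L c (fst z) (snd z))"
      using fin c by (auto simp: finsler_spacetime_def case_prod_unfold)
  qed
  show "coord_rep \<A> L c x (k *\<^sub>R y) = k\<^sup>2 * coord_rep \<A> L c x y"
    if x: "x \<in> snd c ` fst c" and y: "y \<noteq> 0" and k: "k > 0" for x y k
  proof -
    obtain p where p: "p \<in> fst c" "x = snd c p" using x by blast
    define v where "v = tvec_of \<A> c p y"
    have v: "v \<in> tangent_space \<A> p" "v c = y"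
      using tvec_of_tangent[OF A c p(1)] tvec_of_self[OF A c p(1)] by (auto simp: v_def)
    then have "v \<in> slit_tangent_space \<A> p" using y by (auto simp: slit_tangent_space_def)
    then have "L p (\<lambda>c. k *\<^sub>R v c) = k\<^sup>2 * L p v" using fin k by (simp add: finsler_spacetime_def)
    \<comment> \<open>Written as v + (k - 1) v, so that \<open>tangent_space_combination\<close>
      applies.\<close>
    moreover have "(\<lambda>d. k *\<^sub>R v d) = (\<lambda>d. v d + (k - 1) *\<^sub>R v d)" by (simp add: algebra_simps)
    then have "(\<lambda>d. k *\<^sub>R v d) \<in> tangent_space \<A> p"
      using tangent_space_combination[OF A v(1) v(1)] by simp
    ultimately show ?thesis
      using L_in_chart[OF A _ c p(1), of _ L] v p(2) by metis
  qed
  show "invertible (g_matrix (coord_rep \<A> L c) x y)" if "x \<in> snd c ` fst c" "y \<noteq> 0" for x y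
    using fin c that by (intro lorentzian_imp_invertible) (auto simp: finsler_spacetime_def)
qed auto

text \<open>\<open>smooth_on\<close> relates the extension to \<open>f\<close> only where
  \<open>f\<close> lies in the chart; continuity of \<open>f\<close> shrinks the neighbourhood until
  this holds for all its points of \<open>S\<close>.\<close>

lemma smooth_map_extension:
  assumes f: "smooth_map \<A> S f" and z0: "z0 \<in> S" and c: "c \<in> \<A>" "f z0 \<in> fst c" "open (fst c)"
  obtains U F where "open U" "z0 \<in> U" "smooth_in U F"
    "\<And>z. z \<in> U \<Longrightarrow> z \<in> S \<Longrightarrow> f z \<in> fst c \<and> F z = snd c (f z)"
proof -
  have "smooth_on {z \<in> S. f z \<in> fst c} (\<lambda>z. snd c (f z))"
    using f c(1) by (auto simp: smooth_map_def)
  then obtain U F where U: "open U" "z0 \<in> U" "\<forall>k. Ck_on k U F"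
    "\<forall>z\<in>U \<inter> {z \<in> S. f z \<in> fst c}. F z = snd c (f z)"
    unfolding smooth_on_def using z0 c by blast
  have "continuous_on S f" using f by (simp add: smooth_map_def)
  then obtain V where V: "open V" "V \<inter> S = f -` fst c \<inter> S"
    using c(3) unfolding continuous_on_open_invariant by blast
  show thesis
  proof
    show "open (U \<inter> V)" using U V by auto
    show "z0 \<in> U \<inter> V" using U V z0 c by auto
    show "smooth_in (U \<inter> V) F"
      using U(3) smooth_in_subset[of U F "U \<inter> V"] by (auto simp: smooth_in_def)
    show "f z \<in> fst c \<and> F z = snd c (f z)" if "z \<in> U \<inter> V" "z \<in> S" for z
      using that U V by blast
  qed
qed

section \<open>Velocities with one-sided derivatives\<close>

lemma velocity_component:
  assumes "c \<in> \<A>" "\<mu> t \<in> fst c" "at t within S \<noteq> bot"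
    and "((\<lambda>r. snd c (\<mu> r)) has_vector_derivative v) (at t within S)"
  shows "velocity \<A> S \<mu> t c = v"
  using assms by (simp add: velocity_def vector_derivative_within)

lemma velocity_cong:
  assumes "\<And>r. r \<in> S \<Longrightarrow> f r = g r" "t \<in> S"
  shows "velocity \<A> S f t = velocity \<A> S g t"
  unfolding velocity_def
  using assms by (intro ext if_cong vector_derivative_cong_eq refl) auto

text \<open>Chain rule through the transition map; continuity keeps the curve in the first chart
  near t, where the two coordinate expressions are related.\<close>

lemma velocity_tangent:
  fixes \<mu> :: "real \<Rightarrow> 'm::{t2_space, second_countable_topology}"
  assumes A: "smooth_atlas \<A>" and t: "t \<in> S" "at t within S \<noteq> bot"
    and cont: "continuous_on S \<mu>"
    and diff: "\<And>c. c \<in> \<A> \<Longrightarrow> \<mu> t \<in> fst c \<Longrightarrow> (\<lambda>r. snd c (\<mu> r)) differentiable (at t within S)"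
  shows "velocity \<A> S \<mu> t \<in> tangent_space \<A> (\<mu> t)"
  unfolding tangent_space_def
proof (intro CollectI conjI allI ballI impI)
  show "velocity \<A> S \<mu> t c = 0" if "\<not> (c \<in> \<A> \<and> \<mu> t \<in> fst c)" for c
    using that unfolding velocity_def by (rule if_not_P)
  fix c d assume c: "c \<in> \<A>" "d \<in> \<A>" "\<mu> t \<in> fst c \<and> \<mu> t \<in> fst d"
  note ch = c(1,2)[THEN smooth_atlas_chart[OF A]]
  have D: "((\<lambda>r. snd c (\<mu> r)) has_vector_derivative velocity \<A> S \<mu> t c) (at t within S)"
    using diff[of c] c by (simp add: velocity_def vector_derivative_works)
  from vector_derivative_diff_chain_within[OF this
      has_derivative_at_withinI[OF transition_has_derivative[OF A c(1,2)]]] c(3)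
  have D2: "((transition c d \<circ> (\<lambda>r. snd c (\<mu> r))) has_vector_derivative
      frechet_derivative (transition c d) (at (snd c (\<mu> t))) (velocity \<A> S \<mu> t c)) (at t within S)"
    by simp
  obtain V where V: "open V" "V \<inter> S = \<mu> -` fst c \<inter> S"
    using cont is_chartD(1)[OF ch(1)] unfolding continuous_on_open_invariant by blast
  then have "t \<in> V" using t c by blast
  then obtain e where e: "e > 0" "ball t e \<subseteq> V" using V open_contains_ball by blast
  have "((\<lambda>r. snd d (\<mu> r)) has_vector_derivative
      frechet_derivative (transition c d) (at (snd c (\<mu> t))) (velocity \<A> S \<mu> t c)) (at t within S)"
  proof (rule has_vector_derivative_transform_within[OF D2 e(1) t(1)])
    fix r assume r: "r \<in> S" "dist r t < e"
    then have "r \<in> ball t e" by (simp add: dist_commute)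
    then have "\<mu> r \<in> fst c" using e(2) V(2) r(1) by blast
    then show "(transition c d \<circ> (\<lambda>r. snd c (\<mu> r))) r = snd d (\<mu> r)"
      using chart_inv_chart[OF ch(1)] by (simp add: transition_def)
  qed
  then show "velocity \<A> S \<mu> t d =
      frechet_derivative (transition c d) (at (snd c (\<mu> t))) (velocity \<A> S \<mu> t c)"
    using c t by (intro velocity_component) auto
qed

text \<open>A connected set with more than one point has no isolated points. This makes one-sided
  derivatives at the ends of the interval unique.\<close>

lemma interval_at_within_nontrivial:
  fixes t :: real
  assumes "is_interval S" "interior S \<noteq> {}" "t \<in> S" shows "at t within S \<noteq> bot"
proof -
  have "S \<noteq> {x}" for x using assms(2) by auto
  then have "t islimpt S"
    using assms by (intro connected_imp_perfect) (auto simp: is_interval_connected)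
  then show ?thesis by (simp add: trivial_limit_within)
qed

text \<open>The inverse function theorem is applied to one component of \<open>H\<close>; continuity of \<open>\<tau>\<close> selects the
  branch of the inverse.\<close>

lemma curve_parameter_twice_differentiable:
  fixes H x :: "real \<Rightarrow> real ^ 'n::finite"
  assumes H: "open Q" "smooth_in Q H" "\<tau> 0 \<in> Q" "dird H 1 (\<tau> 0) \<noteq> 0"
    and x: "open D" "smooth_in D x" "0 \<in> D"
    and cont: "isCont \<tau> 0" and eq: "\<forall>\<^sub>F e in nhds 0. x e = H (\<tau> e)"
  obtains \<tau>' D2 where "\<forall>\<^sub>F e in nhds 0. (\<tau> has_real_derivative \<tau>' e) (at e)"
    "(\<tau>' has_real_derivative D2) (at 0)"
proof -
  obtain i where i: "dird H 1 (\<tau> 0) $ i \<noteq> 0" using H(4) by (auto simp: vec_eq_iff)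
  define h where "h t = H t $ i" for t
  define h' where "h' t = dird H 1 t $ i" for t
  have sh': "smooth_in Q h'" unfolding h'_def by (intro smooth_in_nth smooth_in_dird H)
  have sh: "smooth_in Q h" unfolding h_def by (intro smooth_in_nth H)
  have real_deriv: "(f has_real_derivative dird f 1 t) (at t)" if "smooth_in R f" "t \<in> R"
    for f :: "real \<Rightarrow> real" and R t
    using dird_along[OF that(1), of 0 t 1] that(2) by (simp add: has_real_derivative_iff_has_vector_derivative)
  have hd: "(h has_real_derivative h' t) (at t)" if "t \<in> Q" for t
    using real_deriv[OF sh that] dird_nth[OF H(2) that] by (simp add: h_def[abs_def] h'_def)
  have "open {t \<in> Q. h' t \<noteq> 0}"
    using continuous_open_preimage[OF smooth_in_continuous_on[OF sh'] H(1), of "- {0}"]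
    by (auto simp: vimage_def Int_def)
  then obtain r where r: "r > 0" "ball (\<tau> 0) r \<subseteq> {t \<in> Q. h' t \<noteq> 0}"
    using H(3) i unfolding open_contains_ball by (auto simp: h'_def)
  define R where "R = ball (\<tau> 0) r"
  have R: "open R" "t \<in> R \<Longrightarrow> t \<in> Q" "t \<in> R \<Longrightarrow> h' t \<noteq> 0" for t using r by (auto simp: R_def)
  \<comment> \<open>By the mean value theorem two equal values of \<open>h\<close> would force a
    zero of \<open>h'\<close> inside \<open>R\<close>.\<close>
  have less: False if "a \<in> R" "b \<in> R" "a < b" "h a = h b" for a b
  proof -
    have sub: "{a..b} \<subseteq> R" using that by (auto simp: R_def dist_real_def)
    have "\<exists>z>a. z < b \<and> h b - h a = (b - a) * h' z"
      using sub R(2) hd by (intro MVT2[OF that(3)]) auto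
    then obtain z where z: "a < z" "z < b" "h b - h a = (b - a) * h' z" by blast
    have "z \<in> R" using z sub by auto
    then show False using z that R(3)[of z] by auto
  qed
  have inj: "inj_on h R"
  proof (rule inj_onI)
    fix a b assume "a \<in> R" "b \<in> R" "h a = h b"
    then show "a = b" using less[of a b] less[of b a] by (cases a b rule: linorder_cases) auto
  qed
  define k where "k = inv_into R h"
  have kd: "(k has_real_derivative inverse (h' t)) (at (h t))" if t: "t \<in> R" for t
    unfolding has_field_derivative_def
  proof (rule has_derivative_inverse_strong[OF R(1) t])
    show "continuous_on R h"
      using smooth_in_continuous_on[OF sh] R(2) by (auto intro: continuous_on_subset)
    show "k (h y) = y" if "y \<in> R" for y using that inj by (simp add: k_def)
    show "(h has_derivative (\<lambda>y. h' t * y)) (at t)"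
      using hd[OF R(2)[OF t]] by (simp add: has_field_derivative_def)
    show "(\<lambda>y. h' t * y) \<circ> (\<lambda>y. inverse (h' t) * y) = id" using R(3)[OF t] by (auto simp: fun_eq_iff)
  qed
  have "(\<tau> \<longlongrightarrow> \<tau> 0) (nhds 0)"
    using cont by (simp add: isCont_def tendsto_at_iff_tendsto_nhds)
  moreover have "\<tau> 0 \<in> R" using r by (simp add: R_def)
  ultimately have "\<forall>\<^sub>F e in nhds 0. \<tau> e \<in> R" using R(1) topological_tendstoD by blast
  moreover have "\<forall>\<^sub>F e in nhds 0. e \<in> D" using x by (simp add: eventually_nhds_in_open)
  ultimately have "\<forall>\<^sub>F e in nhds 0. e \<in> D \<and> \<tau> e \<in> R \<and> x e $ i = h (\<tau> e)"
    using eq by eventually_elim (simp add: h_def)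
  then obtain D' where D': "open D'" "0 \<in> D'"
    "\<And>e. e \<in> D' \<Longrightarrow> e \<in> D \<and> \<tau> e \<in> R \<and> x e $ i = h (\<tau> e)"
    unfolding eventually_nhds by blast
  define x' where "x' = dird (\<lambda>e. x e $ i) 1"
  have sx: "smooth_in D (\<lambda>e. x e $ i)" by (intro smooth_in_nth x)
  \<comment> \<open>Near 0 the parameter is \<open>k (x e $ i)\<close>, whose derivative by the
    inverse rule is this quotient; its numerator and denominator are differentiable at 0, which
    gives the second derivative.\<close>
  define \<tau>' where "\<tau>' e = x' e / h' (\<tau> e)" for e
  have \<tau>d: "(\<tau> has_real_derivative \<tau>' e) (at e)" if e: "e \<in> D'" for e
  proof (rule has_field_derivative_transform_within_open[OF _ D'(1) e])
    have xd: "((\<lambda>e. x e $ i) has_real_derivative x' e) (at e)"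
      unfolding x'_def using real_deriv[OF sx] D'(3)[OF e] by blast
    have "(k has_real_derivative inverse (h' (\<tau> e))) (at (x e $ i))"
      using kd D'(3)[OF e] by auto
    from DERIV_chain2[OF this xd]
    show "((\<lambda>e. k (x e $ i)) has_real_derivative \<tau>' e) (at e)"
      by (simp add: \<tau>'_def divide_inverse mult.commute)
    show "k (x y $ i) = \<tau> y" if "y \<in> D'" for y using D'(3)[OF that] inj by (simp add: k_def)
  qed
  have 0: "\<tau> 0 \<in> R" "0 \<in> D" using D' by auto
  have "(x' has_real_derivative dird x' 1 0) (at 0)"
    by (rule real_deriv[OF _ 0(2)]) (simp add: x'_def smooth_in_dird sx)
  moreover have "((\<lambda>e. h' (\<tau> e)) has_real_derivative dird h' 1 (\<tau> 0) * \<tau>' 0) (at 0)"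
    by (rule DERIV_chain2[OF real_deriv[OF sh' R(2)[OF 0(1)]] \<tau>d[OF D'(2)]])
  ultimately have "(\<tau>' has_real_derivative (dird x' 1 0 * h' (\<tau> 0) - x' 0 * (dird h' 1 (\<tau> 0) * \<tau>' 0))
      / (h' (\<tau> 0) * h' (\<tau> 0))) (at 0)"
    unfolding \<tau>'_def using R(3)[OF 0(1)] by (intro DERIV_divide) auto
  moreover have "\<forall>\<^sub>F e in nhds 0. (\<tau> has_real_derivative \<tau>' e) (at e)"
    using D' \<tau>d unfolding eventually_nhds by blast
  ultimately show thesis using that by blast
qed

section \<open>Variations of a geodesic\<close>

context finsler_chart
begin

text \<open>The left sides differentiate along a line in one fibre, so they can be written with L on
  a tangent space alone. \<open>Psi\<close> and \<open>Chi\<close> are defined in that way.\<close>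

lemma vertical_derivatives:
  assumes "(x, y) \<in> W"
  shows "deriv (\<lambda>t. F x (y + t *\<^sub>R b)) 0 = (\<Sum>i\<in>UNIV. Ly i (x, y) * b $ i)"
    and "deriv (deriv (\<lambda>t. F x (y + t *\<^sub>R b))) 0 = G (x, y) b b"
proof -
  define z where "z = (x, y)"
  define w where "w = ((0, b) :: (real ^ 'n) \<times> (real ^ 'n))"
  have z: "z \<in> W" using assms by (simp add: z_def)
  have Fz: "F x (y + t *\<^sub>R b) = Fz (z + t *\<^sub>R w)" for t by (simp add: Fz_def z_def w_def)
  have D: "((\<lambda>t. h (z + t *\<^sub>R w)) has_real_derivative dird h w (z + t *\<^sub>R w)) (at t)"
    if "smooth_in W h" "z + t *\<^sub>R w \<in> W" for h :: "(real ^ 'n) \<times> (real ^ 'n) \<Rightarrow> real" and t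
    using dird_along[OF that] by (simp add: has_real_derivative_iff_has_vector_derivative)
  have z0: "z + 0 *\<^sub>R w = z" by simp
  have "((\<lambda>t. z + t *\<^sub>R w) \<longlongrightarrow> z + 0 *\<^sub>R w) (nhds 0)"
    by (intro tendsto_add tendsto_scaleR filterlim_ident tendsto_const)
  from topological_tendstoD[OF this open_W] z
  have "\<forall>\<^sub>F t in nhds 0. z + t *\<^sub>R w \<in> W" by simp
  \<comment> \<open>The first derivative must be identified near t = 0, not only at 0, since it is
    differentiated again.\<close>
  then have ev: "\<forall>\<^sub>F t in nhds 0. deriv (\<lambda>t. F x (y + t *\<^sub>R b)) t = dird Fz w (z + t *\<^sub>R w)"
    unfolding Fz by eventually_elim (rule DERIV_imp_deriv[OF D[OF smooth_Fz]])
  have ex: "dird h w z = (\<Sum>k\<in>UNIV. b $ k * py k h z)" if "smooth_in W h" for h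
    unfolding w_def dird_pair_expand[OF that z, of 0 b] by (simp add: py_def)
  from ev have "deriv (\<lambda>t. F x (y + t *\<^sub>R b)) 0 = dird Fz w z"
    using eventually_nhds_x_imp_x by fastforce
  then show "deriv (\<lambda>t. F x (y + t *\<^sub>R b)) 0 = (\<Sum>i\<in>UNIV. Ly i (x, y) * b $ i)"
    unfolding ex[OF smooth_Fz] by (simp add: Ly_def z_def mult.commute)
  have "deriv (deriv (\<lambda>t. F x (y + t *\<^sub>R b))) 0 = deriv (\<lambda>t. dird Fz w (z + t *\<^sub>R w)) 0"
    by (rule deriv_cong_ev[OF ev refl])
  also have "\<dots> = dird (dird Fz w) w z"
    using DERIV_imp_deriv[OF D[OF smooth_in_dird[OF smooth_Fz], of 0]] z by simp
  also have "\<dots> = (\<Sum>k\<in>UNIV. b $ k * py k (dird Fz w) z)" by (rule ex[OF smooth_in_dird[OF smooth_Fz]])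
  also have "\<dots> = (\<Sum>k\<in>UNIV. b $ k * dird (Ly k) w z)"
    unfolding py_def Ly_def by (simp only: dird_commute[OF open_W smooth_Fz z, of w])
  also have "\<dots> = (\<Sum>k\<in>UNIV. \<Sum>j\<in>UNIV. g k j z * b $ k * b $ j)"
    by (simp only: ex[OF smooth_Ly] sum_distrib_left g_def[symmetric])
      (simp add: g_sym[OF z, of j k for j k] mult_ac)
  finally show "deriv (deriv (\<lambda>t. F x (y + t *\<^sub>R b))) 0 = G (x, y) b b"
    by (simp add: G_def z_def)
qed

end

locale geodesic_variation =
  fixes \<A> :: "('m::{t2_space, second_countable_topology}, 'n::finite) chart set"
    and L :: "'m \<Rightarrow> ('m, 'n) tvec \<Rightarrow> real"
    and T :: "'m \<Rightarrow> ('m, 'n) tvec"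
    and q :: 'm and I :: "real set" and \<gamma> :: "real \<Rightarrow> 'm" and c :: real
    and \<mu> :: "real \<Rightarrow> 'm"
    and \<epsilon>0 :: real and \<Lambda> :: "real \<Rightarrow> real \<Rightarrow> 'm"
  assumes fin: "finsler_spacetime \<A> L" and geo: "geodesic \<A> L {0..1} \<mu>"
    and var: "allowed_variation \<A> L T q I \<gamma> c \<mu> \<epsilon>0 \<Lambda>"
begin

definition Vel where "Vel e s = velocity \<A> {0..1} (\<Lambda> e) s"
definition Var where "Var e s = velocity \<A> {-\<epsilon>0<..<\<epsilon>0} (\<lambda>e. \<Lambda> e s) e"

text \<open>Both functions are defined without reference to a chart; in a chart, \<open>Psi e s\<close> is
  \<open>g\<^sub>v(v, \<partial>\<Lambda>/\<partial>\<epsilon>)\<close> with \<open>v = \<partial>\<Lambda>/\<partial>s\<close>, and \<open>Chi s\<close> is \<open>g\<^sub>v(A, A)\<close>.\<close>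

definition Psi where "Psi e s = deriv (\<lambda>t. L (\<Lambda> e s) (\<lambda>d. Vel e s d + t *\<^sub>R Var e s d)) 0"
definition Chi where "Chi s = deriv (deriv (\<lambda>t. L (\<Lambda> 0 s) (\<lambda>d. Vel 0 s d + t *\<^sub>R Var 0 s d))) 0"

text \<open>\<epsilon> = 0 is an interior parameter, whereas s may be an endpoint and \<Lambda> is
  controlled on [0, 1] only; hence one ordinary and one relative derivative.\<close>

definition phi where
  "phi s = deriv (\<lambda>e. Psi e s) 0 - (1/2) * vector_derivative Chi (at s within {0..1})"

lemma atlas: "smooth_atlas \<A>" using fin by (simp add: finsler_spacetime_def)

lemma eps_pos: "\<epsilon>0 > 0" using var by (simp add: allowed_variation_def)

lemma base: "s \<in> {0..1} \<Longrightarrow> \<Lambda> 0 s = \<mu> s" using var by (simp add: allowed_variation_def)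

lemma admissible: "e \<in> {-\<epsilon>0<..<\<epsilon>0} \<Longrightarrow> \<Lambda> e \<in> admissible_curves \<A> L T q I \<gamma> c"
  using var unfolding allowed_variation_def by blast

lemma start: "e \<in> {-\<epsilon>0<..<\<epsilon>0} \<Longrightarrow> \<Lambda> e 0 = q"
  using admissible[of e] unfolding admissible_curves_def by blast

lemma arrival: "e \<in> {-\<epsilon>0<..<\<epsilon>0} \<Longrightarrow> \<exists>t\<in>I. \<Lambda> e 1 = \<gamma> t"
  using admissible[of e] unfolding admissible_curves_def by blast

lemma Vel_slit: "e \<in> {-\<epsilon>0<..<\<epsilon>0} \<Longrightarrow> s \<in> {0..1} \<Longrightarrow> Vel e s \<in> slit_tangent_space \<A> (\<Lambda> e s)"
  using admissible[of e] unfolding admissible_curves_def Vel_def by blast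

lemma L_Vel: "e \<in> {-\<epsilon>0<..<\<epsilon>0} \<Longrightarrow> s \<in> {0..1} \<Longrightarrow> L (\<Lambda> e s) (Vel e s) = - c\<^sup>2"
  using admissible[of e] unfolding admissible_curves_def Vel_def by blast

lemma Vel_base: "s \<in> {0..1} \<Longrightarrow> Vel 0 s = velocity \<A> {0..1} \<mu> s"
  unfolding Vel_def by (rule velocity_cong) (simp_all add: base)

lemma unit_nontrivial: "s \<in> {0..1} \<Longrightarrow> at s within {0..1::real} \<noteq> bot"
  by (rule interval_at_within_nontrivial) (auto simp: is_interval_cc)

text \<open>On the strip the extension agrees with the variation, so its ordinary partial
  derivatives serve as the one-sided derivatives of the coordinate curves.\<close>

lemma variation_extension:
  assumes e0: "e0 \<in> {-\<epsilon>0<..<\<epsilon>0}" and s0: "s0 \<in> {0..1}" and k: "k \<in> \<A>" "\<Lambda> e0 s0 \<in> fst k"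
  obtains U X where "open U" "(e0, s0) \<in> U" "smooth_in U X"
    "\<And>e s. (e, s) \<in> U \<Longrightarrow> e \<in> {-\<epsilon>0<..<\<epsilon>0} \<Longrightarrow> s \<in> {0..1} \<Longrightarrow>
      \<Lambda> e s \<in> fst k \<and> X (e, s) = snd k (\<Lambda> e s)
      \<and> ((\<lambda>r. snd k (\<Lambda> e r)) has_vector_derivative dird X (0, 1) (e, s)) (at s within {0..1})
      \<and> ((\<lambda>r. snd k (\<Lambda> r s)) has_vector_derivative dird X (1, 0) (e, s)) (at e within {-\<epsilon>0<..<\<epsilon>0})"
proof -
  have sm: "smooth_map \<A> ({-\<epsilon>0<..<\<epsilon>0} \<times> {0..1}) (\<lambda>(e, s). \<Lambda> e s)"
    using var unfolding allowed_variation_def by blast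
  have ok: "open (fst k)" by (rule is_chartD(1)[OF smooth_atlas_chart[OF atlas k(1)]])
  have z0: "(e0, s0) \<in> {-\<epsilon>0<..<\<epsilon>0} \<times> {0..1}" and kz: "(\<lambda>(e, s). \<Lambda> e s) (e0, s0) \<in> fst k"
    using e0 s0 k by auto
  obtain U X where U: "open U" "(e0, s0) \<in> U" "smooth_in U X"
    and X: "\<And>z. z \<in> U \<Longrightarrow> z \<in> {-\<epsilon>0<..<\<epsilon>0} \<times> {0..1} \<Longrightarrow>
        (\<lambda>(e, s). \<Lambda> e s) z \<in> fst k \<and> X z = snd k ((\<lambda>(e, s). \<Lambda> e s) z)"
    using smooth_map_extension[OF sm z0 k(1) kz ok] by blast
  have X': "\<Lambda> e s \<in> fst k \<and> X (e, s) = snd k (\<Lambda> e s)"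
    if "(e, s) \<in> U" "e \<in> {-\<epsilon>0<..<\<epsilon>0}" "s \<in> {0..1}" for e s
    using X[of "(e, s)"] that by simp
  show thesis
  proof (rule that[OF U])
    fix e s assume es: "(e, s) \<in> U" "e \<in> {-\<epsilon>0<..<\<epsilon>0}" "s \<in> {0..1}"
    obtain r where r: "r > 0" "ball (e, s) r \<subseteq> U" using U(1) es(1) open_contains_ball by blast
    have in_U: "(e, s') \<in> U" if "dist s' s < r" for s'
      using that r(2) by (auto simp: dist_Pair_Pair dist_commute subset_eq)
    have in_U': "(e', s) \<in> U" if "dist e' e < r" for e'
      using that r(2) by (auto simp: dist_Pair_Pair dist_commute subset_eq)
    have "((\<lambda>r. snd k (\<Lambda> e r)) has_vector_derivative dird X (0, 1) (e, s)) (at s within {0..1})"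
    proof (rule has_vector_derivative_transform_within[OF _ r(1) es(3)])
      show "((\<lambda>r. X (e, r)) has_vector_derivative dird X (0, 1) (e, s)) (at s within {0..1})"
        by (rule has_vector_derivative_at_within[OF dird_along_snd[OF U(3) es(1)]])
      show "X (e, s') = snd k (\<Lambda> e s')" if "s' \<in> {0..1}" "dist s' s < r" for s'
        using X'[OF in_U[OF that(2)] es(2) that(1)] by simp
    qed
    moreover have "((\<lambda>r. snd k (\<Lambda> r s)) has_vector_derivative dird X (1, 0) (e, s))
        (at e within {-\<epsilon>0<..<\<epsilon>0})"
    proof (rule has_vector_derivative_transform_within[OF _ r(1) es(2)])
      show "((\<lambda>r. X (r, s)) has_vector_derivative dird X (1, 0) (e, s)) (at e within {-\<epsilon>0<..<\<epsilon>0})"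
        by (rule has_vector_derivative_at_within[OF dird_along_fst[OF U(3) es(1)]])
      show "X (e', s) = snd k (\<Lambda> e' s)" if "e' \<in> {-\<epsilon>0<..<\<epsilon>0}" "dist e' e < r" for e'
        using X'[OF in_U'[OF that(2)] that(1) es(3)] by simp
    qed
    ultimately show "\<Lambda> e s \<in> fst k \<and> X (e, s) = snd k (\<Lambda> e s)
      \<and> ((\<lambda>r. snd k (\<Lambda> e r)) has_vector_derivative dird X (0, 1) (e, s)) (at s within {0..1})
      \<and> ((\<lambda>r. snd k (\<Lambda> r s)) has_vector_derivative dird X (1, 0) (e, s)) (at e within {-\<epsilon>0<..<\<epsilon>0})"
      using X'[OF es] by blast
  qed
qed

lemma eps_nontrivial: "e \<in> {-\<epsilon>0<..<\<epsilon>0} \<Longrightarrow> at e within {-\<epsilon>0<..<\<epsilon>0} \<noteq> bot"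
  by (rule interval_at_within_nontrivial) (auto simp: is_interval_oo interior_open)

lemma Var_tangent:
  assumes e: "e \<in> {-\<epsilon>0<..<\<epsilon>0}" and s: "s \<in> {0..1}"
  shows "Var e s \<in> tangent_space \<A> (\<Lambda> e s)"
  unfolding Var_def
proof (rule velocity_tangent[OF atlas e eps_nontrivial[OF e]])
  have "continuous_on ({-\<epsilon>0<..<\<epsilon>0} \<times> {0..1}) (\<lambda>(e, s). \<Lambda> e s)"
    using var unfolding allowed_variation_def smooth_map_def by blast
  then have "continuous_on {-\<epsilon>0<..<\<epsilon>0} (\<lambda>e. (\<lambda>(e, s). \<Lambda> e s) (e, s))"
    by (rule continuous_on_compose2) (use s in \<open>auto intro!: continuous_intros\<close>)
  then show "continuous_on {-\<epsilon>0<..<\<epsilon>0} (\<lambda>e. \<Lambda> e s)" by simp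
  fix k assume k: "k \<in> \<A>" "\<Lambda> e s \<in> fst k"
  obtain U X where "(e, s) \<in> U"
    "\<And>e s. (e, s) \<in> U \<Longrightarrow> e \<in> {-\<epsilon>0<..<\<epsilon>0} \<Longrightarrow> s \<in> {0..1} \<Longrightarrow>
      \<Lambda> e s \<in> fst k \<and> X (e, s) = snd k (\<Lambda> e s)
      \<and> ((\<lambda>r. snd k (\<Lambda> e r)) has_vector_derivative dird X (0, 1) (e, s)) (at s within {0..1})
      \<and> ((\<lambda>r. snd k (\<Lambda> r s)) has_vector_derivative dird X (1, 0) (e, s)) (at e within {-\<epsilon>0<..<\<epsilon>0})"
    using variation_extension[OF e s k] by metis
  then show "(\<lambda>r. snd k (\<Lambda> r s)) differentiable (at e within {-\<epsilon>0<..<\<epsilon>0})"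
    using e s differentiableI_vector by blast
qed

end

text \<open>A box around (0, s0) on which the coordinate expression of the variation extends
  smoothly. \<open>d \<le> \<epsilon>0\<close> puts its \<epsilon>-side inside the variation range;
  its s-side may leave [0, 1], so \<open>frame\<close> also asks for
  \<open>s \<in> {0..1}\<close>.\<close>

locale variation_frame = geodesic_variation \<A> L T q I \<gamma> c \<mu> \<epsilon>0 \<Lambda> +
  chart_variation "coord_rep \<A> L k" "snd k ` fst k" "(snd k ` fst k) \<times> (- {0})"
    "ball 0 d \<times> ball s0 d" X
  for \<A> :: "('m::{t2_space, second_countable_topology}, 'n::finite) chart set"
    and L :: "'m \<Rightarrow> ('m, 'n) tvec \<Rightarrow> real" and T q I \<gamma> c \<mu> \<epsilon>0 \<Lambda> k s0 d X +
  assumes k: "k \<in> \<A>" and s0: "s0 \<in> {0..1}" and d: "d > 0" "d \<le> \<epsilon>0"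
    and frame: "\<And>e s. e \<in> ball 0 d \<Longrightarrow> s \<in> {0..1} \<Longrightarrow> s \<in> ball s0 d \<Longrightarrow>
      \<Lambda> e s \<in> fst k \<and> X (e, s) = snd k (\<Lambda> e s) \<and> Vel e s k = dird X (0, 1) (e, s)
      \<and> Var e s k = dird X (1, 0) (e, s)"

lemma (in geodesic_variation) variation_frame_exists:
  assumes s0: "s0 \<in> {0..1}" and k: "k \<in> \<A>" "\<Lambda> 0 s0 \<in> fst k"
  obtains d X where "variation_frame \<A> L T q I \<gamma> c \<mu> \<epsilon>0 \<Lambda> k s0 d X"
proof -
  have z: "0 \<in> {-\<epsilon>0<..<\<epsilon>0}" using eps_pos by simp
  obtain U X where U: "open U" "(0, s0) \<in> U" "smooth_in U X"
    and X: "\<And>e s. (e, s) \<in> U \<Longrightarrow> e \<in> {-\<epsilon>0<..<\<epsilon>0} \<Longrightarrow> s \<in> {0..1} \<Longrightarrow>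
      \<Lambda> e s \<in> fst k \<and> X (e, s) = snd k (\<Lambda> e s)
      \<and> ((\<lambda>r. snd k (\<Lambda> e r)) has_vector_derivative dird X (0, 1) (e, s)) (at s within {0..1})
      \<and> ((\<lambda>r. snd k (\<Lambda> r s)) has_vector_derivative dird X (1, 0) (e, s)) (at e within {-\<epsilon>0<..<\<epsilon>0})"
    using variation_extension[OF z s0 k] by metis
  have Vel: "Vel e s k = dird X (0, 1) (e, s)" and Var: "Var e s k = dird X (1, 0) (e, s)"
    if "(e, s) \<in> U" "e \<in> {-\<epsilon>0<..<\<epsilon>0}" "s \<in> {0..1}" for e s
    unfolding Vel_def Var_def
    using X[OF that] velocity_component[OF k(1) _ unit_nontrivial[OF that(3)]]
      velocity_component[OF k(1) _ eps_nontrivial[OF that(2)]] by auto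
  interpret finsler_chart "coord_rep \<A> L k" "snd k ` fst k" "(snd k ` fst k) \<times> (- {0})"
    by (rule finsler_chart_coord_rep[OF fin k(1)])
  \<comment> \<open>Nonvanishing of the velocity is an open condition and holds at (0, s0) by
    \<open>Vel_slit\<close>, so the extension keeps it on a smaller neighbourhood.\<close>
  define U' where "U' = {p \<in> U. (X p, dird X (0, 1) p) \<in> (snd k ` fst k) \<times> (- {0})}"
  have "continuous_on U (\<lambda>p. (X p, dird X (0, 1) p))"
    by (intro continuous_on_Pair smooth_in_continuous_on[OF U(3)]
        smooth_in_continuous_on[OF smooth_in_dird[OF U(3)]])
  from continuous_open_preimage[OF this U(1) open_W]
  have "open U'" by (simp add: U'_def vimage_def Int_def conj_commute)
  moreover have "(0, s0) \<in> U'"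
    using U(2) X[OF U(2) z s0] Vel[OF U(2) z s0]
      slit_component_nonzero[OF atlas Vel_slit[OF z s0] k] by (simp add: U'_def)
  ultimately obtain P1 P2 where P: "open P1" "open P2" "(0, s0) \<in> P1 \<times> P2" "P1 \<times> P2 \<subseteq> U'"
    using open_prod_elim by metis
  obtain d1 where d1: "d1 > 0" "ball 0 d1 \<subseteq> P1" using P(1,3) open_contains_ball by blast
  obtain d2 where d2: "d2 > 0" "ball s0 d2 \<subseteq> P2" using P(2,3) open_contains_ball by blast
  define d where "d = min \<epsilon>0 (min d1 d2)"
  have sub: "ball 0 d \<times> ball s0 d \<subseteq> U'" using P(4) d1(2) d2(2) by (force simp: d_def)
  then have subU: "ball 0 d \<times> ball s0 d \<subseteq> U" by (auto simp: U'_def)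
  have de: "e \<in> ball 0 d \<Longrightarrow> e \<in> {-\<epsilon>0<..<\<epsilon>0}" for e by (auto simp: d_def)
  have "variation_frame \<A> L T q I \<gamma> c \<mu> \<epsilon>0 \<Lambda> k s0 d X"
  proof
    show "open (ball 0 d \<times> ball s0 d)" by (intro open_Times open_ball)
    show "smooth_in (ball 0 d \<times> ball s0 d) X" by (rule smooth_in_subset[OF U(3) subU])
    show "(X p, dird X (0, 1) p) \<in> (snd k ` fst k) \<times> (- {0})" if "p \<in> ball 0 d \<times> ball s0 d" for p
      using that sub unfolding U'_def by blast
    show "d > 0" "d \<le> \<epsilon>0" using d1 d2 eps_pos by (auto simp: d_def)
    show "k \<in> \<A>" "s0 \<in> {0..1}" by fact+
    fix e s :: real assume es: "e \<in> ball 0 d" "s \<in> {0..1}" "s \<in> ball s0 d"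
    then have "(e, s) \<in> U" using subU by blast
    from X[OF this de[OF es(1)] es(2)] Vel[OF this de[OF es(1)] es(2)] Var[OF this de[OF es(1)] es(2)]
    show "\<Lambda> e s \<in> fst k \<and> X (e, s) = snd k (\<Lambda> e s) \<and> Vel e s k = dird X (0, 1) (e, s)
      \<and> Var e s k = dird X (1, 0) (e, s)" by blast
  qed
  then show thesis by (rule that)
qed

context variation_frame
begin

lemma eps: "e \<in> ball 0 d \<Longrightarrow> e \<in> {-\<epsilon>0<..<\<epsilon>0}"
  using d by auto

lemma zero_ball: "0 \<in> ball (0::real) d" using d by simp

lemma in_frame: "s \<in> ball s0 d \<Longrightarrow> (0, s) \<in> ball 0 d \<times> ball s0 d"
  using zero_ball by simp

lemma Z_eq:
  assumes "e \<in> ball 0 d" "s \<in> {0..1}" "s \<in> ball s0 d"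
  shows "Z (e, s) = (snd k (\<Lambda> e s), Vel e s k)" "Xe (e, s) = Var e s k" "\<Lambda> e s \<in> fst k"
  using frame[OF assms] by (simp_all add: Z_def Xs_def Xe_def)

lemma L_along:
  assumes "e \<in> ball 0 d" "s \<in> {0..1}" "s \<in> ball s0 d"
  shows "L (\<Lambda> e s) (\<lambda>d. Vel e s d + t *\<^sub>R Var e s d) =
    coord_rep \<A> L k (fst (Z (e, s))) (snd (Z (e, s)) + t *\<^sub>R Xe (e, s))"
proof -
  have "Vel e s \<in> tangent_space \<A> (\<Lambda> e s)"
    using Vel_slit[OF eps[OF assms(1)] assms(2)] by (simp add: slit_tangent_space_def)
  from tangent_space_combination[OF atlas this Var_tangent[OF eps[OF assms(1)] assms(2)]]
  have "(\<lambda>d. Vel e s d + t *\<^sub>R Var e s d) \<in> tangent_space \<A> (\<Lambda> e s)" .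
  from L_in_chart[OF atlas this k Z_eq(3)[OF assms]]
  show ?thesis by (simp add: Z_eq[OF assms])
qed

lemma Psi_eq:
  assumes "e \<in> ball 0 d" "s \<in> {0..1}" "s \<in> ball s0 d"
  shows "Psi e s = psi (e, s)"
  using vertical_derivatives(1)[of "fst (Z (e, s))" "snd (Z (e, s))"] Z_W[of "(e, s)"] assms
  by (simp add: Psi_def psi_def L_along[OF assms])

lemma Chi_eq:
  assumes "s \<in> {0..1}" "s \<in> ball s0 d"
  shows "Chi s = G (Z (0, s)) (Xe (0, s)) (Xe (0, s))"
  using vertical_derivatives(2)[of "fst (Z (0, s))" "snd (Z (0, s))"] Z_W[of "(0, s)"] assms zero_ball
  by (simp add: Chi_def L_along[OF zero_ball assms])

lemma ball_radius:
  assumes "s \<in> ball s0 d" shows "0 < d - dist s s0"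
    and "dist r s < d - dist s s0 \<Longrightarrow> r \<in> ball s0 d"
  using assms dist_triangle[of r s0 s] by (auto simp: dist_commute)

lemma Fz_const:
  assumes "e \<in> ball 0 d" "s \<in> {0..1}" "s \<in> ball s0 d"
  shows "Fz (Z (e, s)) = - c\<^sup>2"
  using L_along[OF assms, of 0] L_Vel[OF eps[OF assms(1)] assms(2)] by (simp add: Fz_def)

lemma dird_Fz_zero:
  assumes "e \<in> ball 0 d" "s \<in> {0..1}" "s \<in> ball s0 d"
  shows "dird (\<lambda>p. Fz (Z p)) (1, 0) (e, s) = 0"
proof -
  have p: "(e, s) \<in> ball 0 d \<times> ball s0 d" using assms by blast
  have "((\<lambda>e. Fz (Z (e, s))) has_vector_derivative 0) (at e)"
    by (rule has_vector_derivative_transform_within_open[OF has_vector_derivative_const open_ball assms(1)])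
      (rule Fz_const[OF _ assms(2,3), symmetric])
  from vector_derivative_unique_at[OF dird_along_fst[OF smooth_comp_Z[OF smooth_Fz] p] this]
  show ?thesis .
qed

lemma dird_Fz_zero_ev:
  assumes "s \<in> {0..1}" "s \<in> ball s0 d"
  shows "\<forall>\<^sub>F e in nhds 0. dird (\<lambda>p. Fz (Z p)) (1, 0) (e, s) = 0"
proof -
  have "\<forall>\<^sub>F e in nhds 0. e \<in> ball (0::real) d"
    by (rule eventually_nhds_in_open[OF open_ball zero_ball])
  then show ?thesis by eventually_elim (rule dird_Fz_zero[OF _ assms])
qed

text \<open>The derivative of L_y along the curve is given once by the geodesic equation and once by
  \<open>dird_Ly_Z\<close>; derivatives within [0, 1] are unique.\<close>

lemma EL_geodesic:
  assumes s: "s \<in> {0..1}" "s \<in> ball s0 d"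
  shows "EL i (0, s) = 0"
proof -
  have p: "(0, s) \<in> ball 0 d \<times> ball s0 d" by (rule in_frame[OF s(2)])
  have Zr: "Z (0, r) = (snd k (\<mu> r), velocity \<A> {0..1} \<mu> r k)"
    if "r \<in> {0..1}" "r \<in> ball s0 d" for r
    using Z_eq[OF zero_ball that] by (simp add: base[OF that(1)] Vel_base[OF that(1)])
  have \<mu>s: "\<mu> s \<in> fst k" using Z_eq(3)[OF zero_ball s] base[OF s(1)] by simp
  have "((\<lambda>r. partial_y i (coord_rep \<A> L k) (snd k (\<mu> r)) (velocity \<A> {0..1} \<mu> r k))
        has_real_derivative
      partial_x i (coord_rep \<A> L k) (snd k (\<mu> s)) (velocity \<A> {0..1} \<mu> s k)) (at s within {0..1})"
    by (rule geo[unfolded geodesic_def, rule_format, OF s(1) k \<mu>s])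
  moreover have "partial_x i (coord_rep \<A> L k) (snd k (\<mu> s)) (velocity \<A> {0..1} \<mu> s k) = px i Fz (Z (0, s))"
    using partial_x_F[OF Z_W[OF p, unfolded Zr[OF s]]] by (simp add: Zr[OF s])
  ultimately have "((\<lambda>r. partial_y i (coord_rep \<A> L k) (snd k (\<mu> r)) (velocity \<A> {0..1} \<mu> r k))
        has_vector_derivative px i Fz (Z (0, s))) (at s within {0..1})"
    by (simp add: has_real_derivative_iff_has_vector_derivative)
  then have 1: "((\<lambda>r. Ly i (Z (0, r))) has_vector_derivative px i Fz (Z (0, s))) (at s within {0..1})"
  proof (rule has_vector_derivative_transform_within[OF _ ball_radius(1)[OF s(2)] s(1)])
    fix r assume r: "r \<in> {0..1}" "dist r s < d - dist s s0"
    then have rb: "r \<in> ball s0 d" using ball_radius(2)[OF s(2)] by blast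
    show "partial_y i (coord_rep \<A> L k) (snd k (\<mu> r)) (velocity \<A> {0..1} \<mu> r k) = Ly i (Z (0, r))"
      using partial_y_F[OF Z_W[OF in_frame[OF rb], unfolded Zr[OF r(1) rb]]] by (simp add: Zr[OF r(1) rb])
  qed
  have 2: "((\<lambda>r. Ly i (Z (0, r))) has_vector_derivative (EL i (0, s) + px i Fz (Z (0, s))))
      (at s within {0..1})"
    using has_vector_derivative_at_within[OF dird_along_snd[OF smooth_comp_Z[OF smooth_Ly, of i] p]]
    by (simp only: dird_Ly_Z[OF p])
  from vector_derivative_unique_within[OF unit_nontrivial[OF s(1)] 2 1] show ?thesis by simp
qed

lemma deriv_Psi:
  assumes s: "s \<in> {0..1}" "s \<in> ball s0 d"
  shows "deriv (\<lambda>e. Psi e s) 0 = dird psi (1, 0) (0, s)"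
proof (rule DERIV_imp_deriv)
  have "((\<lambda>e. psi (e, s)) has_real_derivative dird psi (1, 0) (0, s)) (at 0)"
    using dird_along_fst[OF smooth_psi in_frame[OF s(2)]]
    by (simp add: has_real_derivative_iff_has_vector_derivative)
  then show "((\<lambda>e. Psi e s) has_real_derivative dird psi (1, 0) (0, s)) (at 0)"
    by (rule has_field_derivative_transform_within_open[OF _ open_ball zero_ball])
      (simp add: Psi_eq[OF _ s])
qed

lemma Chi_derivative:
  assumes s: "s \<in> {0..1}" "s \<in> ball s0 d"
  shows "vector_derivative Chi (at s within {0..1}) = 2 * G (Z (0, s)) (Xe (0, s)) (cov s)"
proof (rule vector_derivative_within[OF unit_nontrivial[OF s(1)]])
  have "((\<lambda>r. G (Z (0, r)) (Xe (0, r)) (Xe (0, r))) has_vector_derivative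
      2 * G (Z (0, s)) (Xe (0, s)) (cov s)) (at s within {0..1})"
    using norm_variation_derivative[OF in_frame[OF s(2)] EL_geodesic[OF s]]
    by (simp add: has_real_derivative_iff_has_vector_derivative)
  then show "(Chi has_vector_derivative 2 * G (Z (0, s)) (Xe (0, s)) (cov s)) (at s within {0..1})"
    by (rule has_vector_derivative_transform_within[OF _ ball_radius(1)[OF s(2)] s(1)])
      (use ball_radius(2)[OF s(2)] in \<open>auto simp: Chi_eq simp del: mem_ball\<close>)
qed

lemma phi_eq:
  assumes s: "s \<in> {0..1}" "s \<in> ball s0 d"
  shows "phi s = dird psi (1, 0) (0, s) - G (Z (0, s)) (Xe (0, s)) (cov s)"
  by (simp add: phi_def deriv_Psi[OF s] Chi_derivative[OF s])

lemma s0_ball: "s0 \<in> ball s0 d" using d by simp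

lemma phi_derivative:
  "(phi has_vector_derivative
    G (Z (0, s0)) (Xe (0, s0)) (jac_curv s0) - G (Z (0, s0)) (cov s0) (cov s0)) (at s0 within {0..1})"
proof (rule has_vector_derivative_transform_within[OF _ d(1) s0])
  show "((\<lambda>r. dird psi (1, 0) (0, r) - G (Z (0, r)) (Xe (0, r)) (cov r)) has_vector_derivative
    G (Z (0, s0)) (Xe (0, s0)) (jac_curv s0) - G (Z (0, s0)) (cov s0) (cov s0)) (at s0 within {0..1})"
    using second_variation_local[OF in_frame[OF s0_ball] EL_geodesic[OF s0 s0_ball]
        dird_Fz_zero_ev[OF s0 s0_ball]]
    by (simp add: has_real_derivative_iff_has_vector_derivative)
  show "dird psi (1, 0) (0, r) - G (Z (0, r)) (Xe (0, r)) (cov r) = phi r"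
    if "r \<in> {0..1}" "dist r s0 < d" for r
    using that by (simp add: phi_eq dist_commute)
qed

text \<open>Both terms of \<open>dird_psi_s\<close> vanish: \<open>EL\<close> on the geodesic, and
  the \<epsilon>-derivative of L because all curves share the value -c^2.\<close>

lemma Psi_derivative: "(Psi 0 has_vector_derivative 0) (at s0 within {0..1})"
proof (rule has_vector_derivative_transform_within[OF _ d(1) s0])
  have "dird psi (0, 1) (0, s0) = 0"
    using dird_psi_s[OF in_frame[OF s0_ball]] EL_geodesic[OF s0 s0_ball]
      dird_Fz_zero[OF zero_ball s0 s0_ball] by simp
  then show "((\<lambda>r. psi (0, r)) has_vector_derivative 0) (at s0 within {0..1})"
    using has_vector_derivative_at_within[OF dird_along_snd[OF smooth_psi in_frame[OF s0_ball]]] by metis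
  show "psi (0, r) = Psi 0 r" if "r \<in> {0..1}" "dist r s0 < d" for r
    using that zero_ball by (simp add: Psi_eq dist_commute)
qed

section \<open>Comparison with the index form, and the endpoints\<close>

lemma cov_eq: "covariant_deriv \<A> L \<mu> (variation_field \<A> \<epsilon>0 \<Lambda>) s0 k = cov s0"
proof -
  have A: "variation_field \<A> \<epsilon>0 \<Lambda> s k = Xe (0, s)" if "s \<in> {0..1}" "s \<in> ball s0 d" for s
    using Z_eq(2)[OF zero_ball that] by (simp add: variation_field_def Var_def)
  have W: "(fst (Z (0, s0)), snd (Z (0, s0))) \<in> (snd k ` fst k) \<times> (- {0})"
    using Z_W[OF in_frame[OF s0_ball]] by simp
  have "((\<lambda>r. variation_field \<A> \<epsilon>0 \<Lambda> r k) has_vector_derivative dird Xe (0, 1) (0, s0)) (at s0 within {0..1})"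
    by (rule has_vector_derivative_transform_within[OF Xe_derivative[OF in_frame[OF s0_ball]] d(1) s0])
      (simp add: A dist_commute)
  note vd = vector_derivative_within[OF unit_nontrivial[OF s0] this]
  have Z: "snd k (\<mu> s0) = fst (Z (0, s0))" "velocity \<A> {0..1} \<mu> s0 k = snd (Z (0, s0))"
    "\<mu> s0 \<in> fst k"
    using Z_eq[OF zero_ball s0 s0_ball] by (simp_all add: base[OF s0] Vel_base[OF s0])
  have "(\<Sum>j\<in>UNIV. \<Sum>l\<in>UNIV. chern_gamma (coord_rep \<A> L k) i j l (fst (Z (0, s0))) (snd (Z (0, s0)))
      * Xe (0, s0) $ j * snd (Z (0, s0)) $ l) = Nv (Z (0, s0)) (Xe (0, s0)) $ i" for i
    by (simp only: chern_gamma_eq[OF W] Nv_def vec_lambda_beta sum_distrib_right prod.collapse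
        Gam_y[OF Z_W[OF in_frame[OF s0_ball]], symmetric]) (simp add: mult_ac)
  then show ?thesis
    using k Z(3) by (simp add: covariant_deriv_def vd Z(1,2) A[OF s0 s0_ball] cov_def vec_eq_iff)
qed

lemma jacobi_eq:
  "jacobi_curvature \<A> L (\<mu> s0) (velocity \<A> {0..1} \<mu> s0) (variation_field \<A> \<epsilon>0 \<Lambda> s0) k = jac_curv s0"
proof -
  have A: "variation_field \<A> \<epsilon>0 \<Lambda> s0 k = Xe (0, s0)"
    using Z_eq(2)[OF zero_ball s0 s0_ball] by (simp add: variation_field_def Var_def)
  have Z: "snd k (\<mu> s0) = X (0, s0)" "velocity \<A> {0..1} \<mu> s0 k = Xs (0, s0)" "\<mu> s0 \<in> fst k"
    using Z_eq[OF zero_ball s0 s0_ball] by (simp_all add: base[OF s0] Vel_base[OF s0] Z_def)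
  show ?thesis using k Z(3) by (simp add: jacobi_curvature_def jac_curv_def A Z(1,2))
qed

lemma fund_tensor_eq:
  assumes "chart_at \<A> (\<mu> s0) = k"
  shows "fund_tensor \<A> L (\<mu> s0) (velocity \<A> {0..1} \<mu> s0) Y Y' = G (Z (0, s0)) (Y k) (Y' k)"
proof -
  have Z: "(snd k (\<mu> s0), velocity \<A> {0..1} \<mu> s0 k) = Z (0, s0)"
    using Z_eq[OF zero_ball s0 s0_ball] by (simp add: base[OF s0] Vel_base[OF s0])
  show ?thesis
    using g_low_eq[of "snd k (\<mu> s0)" "velocity \<A> {0..1} \<mu> s0 k"] Z_W[OF in_frame[OF s0_ball]]
    by (simp add: fund_tensor_def assms Z G_def)
qed

text \<open>All curves start at q, so the \<epsilon>-derivative of the variation at s = 0 vanishes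
  for every \<epsilon> near 0.\<close>

lemma phi_start:
  assumes "s0 = 0" shows "phi 0 = 0" "Psi 0 0 = 0"
proof -
  have s: "(0::real) \<in> {0..1}" "0 \<in> ball s0 d" using assms d by auto
  have Xe0: "Xe (e, 0) = 0" if e: "e \<in> ball 0 d" for e
  proof -
    have p: "(e, 0) \<in> ball 0 d \<times> ball s0 d" using e s by blast
    have "((\<lambda>e. X (e, 0)) has_vector_derivative 0) (at e)"
    proof (rule has_vector_derivative_transform_within_open[OF has_vector_derivative_const open_ball e])
      show "snd k q = X (e, 0)" if "e \<in> ball 0 d" for e
        using frame[OF that s] start[OF eps[OF that]] by simp
    qed
    from vector_derivative_unique_at[OF dird_along_fst[OF smooth_X p] this] show ?thesis
      by (simp add: Xe_def)
  qed
  have psi0: "psi (e, 0) = 0" if "e \<in> ball 0 d" for e by (simp add: psi_def Xe0[OF that])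
  then show "Psi 0 0 = 0" using Psi_eq[OF zero_ball s] zero_ball by simp
  have "((\<lambda>e. psi (e, 0)) has_vector_derivative 0) (at 0)"
    by (rule has_vector_derivative_transform_within_open[OF has_vector_derivative_const open_ball zero_ball])
      (rule psi0[symmetric])
  from vector_derivative_unique_at[OF dird_along_fst[OF smooth_psi in_frame[OF s(2)]] this]
  have "dird psi (1, 0) (0, 0) = 0" .
  then show "phi 0 = 0" by (simp add: phi_eq[OF s] Xe0[OF zero_ball] G_def)
qed

text \<open>The endpoint moves along \<gamma>, so \<open>Xe\<close> there is \<tau>' times the
  velocity of \<gamma>, and psi(\<epsilon>, 1) = \<tau>'(\<epsilon>) K(\<epsilon>). If \<tau>'(0) =
  0, the derivative at 0 is D2 K(0), and the variation field vanishes at s = 1, which removes the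
  subtracted term of \<open>phi\<close>.\<close>

lemma endpoint:
  assumes s0: "s0 = 1" and H: "open Q" "smooth_in Q H" "\<tau> 0 \<in> Q"
    and eq: "\<forall>\<^sub>F e in nhds 0. X (e, 1) = H (\<tau> e)"
    and \<tau>: "\<forall>\<^sub>F e in nhds 0. (\<tau> has_real_derivative \<tau>' e) (at e)"
    and \<tau>': "(\<tau>' has_real_derivative D2) (at 0)"
  shows "Psi 0 1 = \<tau>' 0 * G (Z (0, 1)) (dird H 1 (\<tau> 0)) (snd (Z (0, 1)))"
    and "\<tau>' 0 = 0 \<Longrightarrow> phi 1 = D2 * G (Z (0, 1)) (dird H 1 (\<tau> 0)) (snd (Z (0, 1)))"
proof -
  have s: "(1::real) \<in> {0..1}" "1 \<in> ball s0 d" using s0 d by auto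
  have p1: "(0, 1) \<in> ball 0 d \<times> ball s0 d" by (rule in_frame[OF s(2)])
  have \<tau>0: "(\<tau> has_real_derivative \<tau>' 0) (at 0)" using \<tau> eventually_nhds_x_imp_x by fastforce
  have "(\<tau> \<longlongrightarrow> \<tau> 0) (nhds 0)"
    using DERIV_isCont[OF \<tau>0] by (simp add: isCont_def tendsto_at_iff_tendsto_nhds)
  then have "\<forall>\<^sub>F e in nhds 0. \<tau> e \<in> Q" by (rule topological_tendstoD[OF _ H(1,3)])
  moreover have "\<forall>\<^sub>F e in nhds 0. e \<in> ball (0::real) d"
    by (rule eventually_nhds_in_open[OF open_ball zero_ball])
  ultimately have "\<forall>\<^sub>F e in nhds 0. X (e, 1) = H (\<tau> e) \<and> (\<tau> has_real_derivative \<tau>' e) (at e)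
      \<and> \<tau> e \<in> Q \<and> e \<in> ball 0 d"
    using eq \<tau> by eventually_elim simp
  then obtain D where D: "open D" "0 \<in> D"
    and De: "\<And>e. e \<in> D \<Longrightarrow> X (e, 1) = H (\<tau> e) \<and> (\<tau> has_real_derivative \<tau>' e) (at e)
      \<and> \<tau> e \<in> Q \<and> e \<in> ball 0 d"
    unfolding eventually_nhds by blast
  have Hd: "(H has_vector_derivative dird H 1 t) (at t)" if "t \<in> Q" for t
    using dird_along[OF H(2), of 0 t 1] that by simp
  have Xe1: "Xe (e, 1) = \<tau>' e *\<^sub>R dird H 1 (\<tau> e)" if e: "e \<in> D" for e
  proof -
    have "((H \<circ> \<tau>) has_vector_derivative \<tau>' e *\<^sub>R dird H 1 (\<tau> e)) (at e)"
      using vector_diff_chain_at[of \<tau> "\<tau>' e" e H "dird H 1 (\<tau> e)"] De[OF e] Hd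
      by (simp add: has_real_derivative_iff_has_vector_derivative)
    then have 1: "((\<lambda>e. X (e, 1)) has_vector_derivative \<tau>' e *\<^sub>R dird H 1 (\<tau> e)) (at e)"
      by (rule has_vector_derivative_transform_within_open[OF _ D(1) e]) (simp add: De)
    have "(e, 1) \<in> ball 0 d \<times> ball s0 d" using De[OF e] s by blast
    from vector_derivative_unique_at[OF dird_along_fst[OF smooth_X this] 1]
    show ?thesis by (simp add: Xe_def)
  qed
  define K where "K e = (\<Sum>i\<in>UNIV. Ly i (Z (e, 1)) * dird H 1 (\<tau> e) $ i)" for e
  have psi1: "psi (e, 1) = \<tau>' e * K e" if "e \<in> D" for e
    by (simp add: psi_def K_def Xe1[OF that] sum_distrib_left mult_ac)
  have K0: "K 0 = G (Z (0, 1)) (dird H 1 (\<tau> 0)) (snd (Z (0, 1)))"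
    by (simp add: K_def G_vel[OF Z_W[OF p1]])
  show "Psi 0 1 = \<tau>' 0 * G (Z (0, 1)) (dird H 1 (\<tau> 0)) (snd (Z (0, 1)))"
    using Psi_eq[OF zero_ball s] psi1[OF D(2)] K0 by simp
  assume 0: "\<tau>' 0 = 0"
  have Lyd: "((\<lambda>e. Ly i (Z (e, 1))) has_real_derivative dird (\<lambda>p. Ly i (Z p)) (1, 0) (0, 1)) (at 0)" for i
    using dird_along_fst[OF smooth_comp_Z[OF smooth_Ly] p1]
    by (simp add: has_real_derivative_iff_has_vector_derivative)
  have "((\<lambda>t. dird H 1 t $ i) has_real_derivative dird (\<lambda>t. dird H 1 t $ i) 1 (\<tau> 0)) (at (\<tau> 0))" for i
    using dird_along[OF smooth_in_nth[OF smooth_in_dird[OF H(2)] H(1)], of 0 "\<tau> 0" 1] H(3)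
    by (simp add: has_real_derivative_iff_has_vector_derivative)
  from DERIV_chain2[OF this \<tau>0]
  have Hi: "((\<lambda>e. dird H 1 (\<tau> e) $ i) has_real_derivative dird (\<lambda>t. dird H 1 t $ i) 1 (\<tau> 0) * \<tau>' 0) (at 0)" for i .
  have "(K has_real_derivative (\<Sum>i\<in>UNIV. dird (\<lambda>p. Ly i (Z p)) (1, 0) (0, 1) * dird H 1 (\<tau> 0) $ i
      + dird (\<lambda>t. dird H 1 t $ i) 1 (\<tau> 0) * \<tau>' 0 * Ly i (Z (0, 1)))) (at 0)"
    unfolding K_def[abs_def] by (intro DERIV_sum DERIV_mult Lyd Hi)
  from DERIV_mult[OF \<tau>' this] have "((\<lambda>e. \<tau>' e * K e) has_real_derivative D2 * K 0) (at 0)"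
    by (simp add: 0)
  then have "((\<lambda>e. psi (e, 1)) has_vector_derivative D2 * K 0) (at 0)"
    unfolding has_real_derivative_iff_has_vector_derivative
    by (rule has_vector_derivative_transform_within_open[OF _ D]) (simp add: psi1)
  from vector_derivative_unique_at[OF dird_along_fst[OF smooth_psi p1] this]
  have "dird psi (1, 0) (0, 1) = D2 * K 0" .
  then show "phi 1 = D2 * G (Z (0, 1)) (dird H 1 (\<tau> 0)) (snd (Z (0, 1)))"
    using Xe1[OF D(2)] by (simp add: phi_eq[OF s] K0 0 G_def)
qed

end

section \<open>From local frames to the whole geodesic\<close>

lemma (in geodesic_variation) chart_at_mem: "chart_at \<A> p \<in> \<A>" "p \<in> fst (chart_at \<A> p)"
proof -
  have "p \<in> (\<Union>c\<in>\<A>. fst c)" using atlas by (simp add: smooth_atlas_def)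
  then have "\<exists>k. k \<in> \<A> \<and> p \<in> fst k" by blast
  from someI_ex[OF this] show "chart_at \<A> p \<in> \<A>" "p \<in> fst (chart_at \<A> p)"
    by (simp_all add: chart_at_def)
qed

lemma (in geodesic_variation) frame_at:
  assumes "s \<in> {0..1}"
  obtains d X where "variation_frame \<A> L T q I \<gamma> c \<mu> \<epsilon>0 \<Lambda> (chart_at \<A> (\<mu> s)) s d X"
  using variation_frame_exists[OF assms chart_at_mem(1)[of "\<mu> s"]] chart_at_mem(2)[of "\<mu> s"] base[OF assms]
  by metis

lemma (in geodesic_variation) index_form_eq:
  "index_form \<A> L \<mu> (variation_field \<A> \<epsilon>0 \<Lambda>) (variation_field \<A> \<epsilon>0 \<Lambda>) = phi 1 - phi 0"
  unfolding index_form_def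
proof (rule integral_unique, rule fundamental_theorem_of_calculus[where f = phi])
  show "(0::real) \<le> 1" by simp
  fix s :: real assume s: "s \<in> {0..1}"
  obtain d X where "variation_frame \<A> L T q I \<gamma> c \<mu> \<epsilon>0 \<Lambda> (chart_at \<A> (\<mu> s)) s d X"
    by (rule frame_at[OF s])
  then interpret variation_frame \<A> L T q I \<gamma> c \<mu> \<epsilon>0 \<Lambda> "chart_at \<A> (\<mu> s)" s d X .
  have A: "variation_field \<A> \<epsilon>0 \<Lambda> s (chart_at \<A> (\<mu> s)) = Xe (0, s)"
    using Z_eq(2)[OF zero_ball s s0_ball] by (simp add: variation_field_def Var_def)
  show "(phi has_vector_derivative (let v = velocity \<A> {0..1} \<mu> s in
     fund_tensor \<A> L (\<mu> s) v (variation_field \<A> \<epsilon>0 \<Lambda> s)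
       (jacobi_curvature \<A> L (\<mu> s) v (variation_field \<A> \<epsilon>0 \<Lambda> s)) -
     fund_tensor \<A> L (\<mu> s) v (covariant_deriv \<A> L \<mu> (variation_field \<A> \<epsilon>0 \<Lambda>) s)
       (covariant_deriv \<A> L \<mu> (variation_field \<A> \<epsilon>0 \<Lambda>) s))) (at s within {0..1})"
    using phi_derivative by (simp add: Let_def fund_tensor_eq jacobi_eq cov_eq A)
qed

lemma (in geodesic_variation) boundary_start: "phi 0 = 0" "Psi 0 0 = 0"
proof -
  have s: "(0::real) \<in> {0..1}" by simp
  obtain d X where "variation_frame \<A> L T q I \<gamma> c \<mu> \<epsilon>0 \<Lambda> (chart_at \<A> (\<mu> 0)) 0 d X"
    by (rule frame_at[OF s])
  then interpret variation_frame \<A> L T q I \<gamma> c \<mu> \<epsilon>0 \<Lambda> "chart_at \<A> (\<mu> 0)" 0 d X .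
  show "phi 0 = 0" "Psi 0 0 = 0" using phi_start by simp_all
qed

lemma (in geodesic_variation) Psi_end: "Psi 0 1 = 0"
proof -
  have "((\<lambda>s. 0) has_integral (Psi 0 1 - Psi 0 0)) {0..1::real}"
  proof (rule fundamental_theorem_of_calculus[where f = "Psi 0"])
    fix s :: real assume s: "s \<in> {0..1}"
    obtain d X where "variation_frame \<A> L T q I \<gamma> c \<mu> \<epsilon>0 \<Lambda> (chart_at \<A> (\<mu> s)) s d X"
      by (rule frame_at[OF s])
    then interpret variation_frame \<A> L T q I \<gamma> c \<mu> \<epsilon>0 \<Lambda> "chart_at \<A> (\<mu> s)" s d X .
    show "(Psi 0 has_vector_derivative 0) (at s within {0..1})" by (rule Psi_derivative)
  qed simp
  then show ?thesis using has_integral_unique[OF has_integral_0] boundary_start by fastforce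
qed

theorem proposition4p7:
  fixes \<A> :: "('m::{t2_space, second_countable_topology}, 'n::finite) chart set"
    and L :: "'m \<Rightarrow> ('m, 'n) tvec \<Rightarrow> real"
    and T :: "'m \<Rightarrow> ('m, 'n) tvec"
    and q :: 'm and c :: real
    and I :: "real set" and \<gamma> :: "real \<Rightarrow> 'm"
    and \<mu> :: "real \<Rightarrow> 'm"
    and \<epsilon>0 :: real and \<Lambda> :: "real \<Rightarrow> real \<Rightarrow> 'm"
  assumes "finsler_spacetime \<A> L"
    and "time_orientation \<A> L T"
    and "c \<le> 0"
    and "is_interval I" and "interior I \<noteq> {}"
    and "smooth_map \<A> I \<gamma>" and "inj_on \<gamma> I"
    and "timelike_curve \<A> L I \<gamma>" and "future_pointed_curve \<A> L T I \<gamma>"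
    and "\<mu> \<in> admissible_curves \<A> L T q I \<gamma> c"
    and "causal_curve \<A> L {0..1} \<mu>" and "geodesic \<A> L {0..1} \<mu>"
    and "allowed_variation \<A> L T q I \<gamma> c \<mu> \<epsilon>0 \<Lambda>"
    and lhs_meaningful: "isCont (\<lambda>\<epsilon>. time_arrival I \<gamma> (\<Lambda> \<epsilon>)) 0"
    and rhs_meaningful: "fund_tensor \<A> L (\<mu> 1) (velocity \<A> {0..1} \<mu> 1)
           (velocity \<A> I \<gamma> (time_arrival I \<gamma> \<mu>)) (velocity \<A> {0..1} \<mu> 1) \<noteq> 0"
  shows "has_second_derivative (\<lambda>\<epsilon>. time_arrival I \<gamma> (\<Lambda> \<epsilon>))
     (index_form \<A> L \<mu> (variation_field \<A> \<epsilon>0 \<Lambda>) (variation_field \<A> \<epsilon>0 \<Lambda>) /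
      fund_tensor \<A> L (\<mu> 1) (velocity \<A> {0..1} \<mu> 1)
        (velocity \<A> I \<gamma> (time_arrival I \<gamma> \<mu>)) (velocity \<A> {0..1} \<mu> 1)) 0"
proof -
  interpret geodesic_variation \<A> L T q I \<gamma> c \<mu> \<epsilon>0 \<Lambda>
    using assms by unfold_locales
  have one: "(1::real) \<in> {0..1}" by simp
  define \<tau> where "\<tau> e = time_arrival I \<gamma> (\<Lambda> e)" for e
  \<comment> \<open>Injectivity of \<gamma> makes the description in \<open>time_arrival\<close>
    unique.\<close>
  have \<tau>_eqI: "time_arrival I \<gamma> \<nu> = t" if "t \<in> I" "\<nu> 1 = \<gamma> t" for \<nu> t
    unfolding time_arrival_def
    by (rule the_equality) (use that \<open>inj_on \<gamma> I\<close> in \<open>auto dest: inj_onD\<close>)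
  have \<tau>: "\<tau> e \<in> I" "\<Lambda> e 1 = \<gamma> (\<tau> e)" if "e \<in> {-\<epsilon>0<..<\<epsilon>0}" for e
    using arrival[OF that] \<tau>_eqI[of _ "\<Lambda> e"] by (auto simp: \<tau>_def)
  have z: "0 \<in> {-\<epsilon>0<..<\<epsilon>0}" using eps_pos by simp
  have \<tau>0: "time_arrival I \<gamma> \<mu> = \<tau> 0"
    by (rule \<tau>_eqI) (use \<tau>[OF z] base[OF one] in auto)
  \<comment> \<open>The endpoint is studied in the chart in which \<open>fund_tensor\<close>
    evaluates the denominator.\<close>
  define k where "k = chart_at \<A> (\<mu> 1)"
  obtain d X where "variation_frame \<A> L T q I \<gamma> c \<mu> \<epsilon>0 \<Lambda> (chart_at \<A> (\<mu> 1)) 1 d X"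
    by (rule frame_at[OF one])
  then interpret variation_frame \<A> L T q I \<gamma> c \<mu> \<epsilon>0 \<Lambda> k 1 d X by (simp add: k_def)
  have \<mu>1: "\<mu> 1 = \<gamma> (\<tau> 0)" using \<tau>(2)[OF z] base[OF one] by simp
  then have k1: "\<gamma> (\<tau> 0) \<in> fst k" using chart_at_mem(2)[of "\<mu> 1"] by (simp add: k_def)
  obtain Q H where Q: "open Q" "\<tau> 0 \<in> Q" "smooth_in Q H"
    and H: "\<And>t. t \<in> Q \<Longrightarrow> t \<in> I \<Longrightarrow> \<gamma> t \<in> fst k \<and> H t = snd k (\<gamma> t)"
    using smooth_map_extension[OF \<open>smooth_map \<A> I \<gamma>\<close> \<tau>(1)[OF z] k k1
        is_chartD(1)[OF smooth_atlas_chart[OF atlas k]]] by blast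
  have \<gamma>': "velocity \<A> I \<gamma> (\<tau> 0) k = dird H 1 (\<tau> 0)"
  proof (rule velocity_component[where \<mu> = \<gamma> and t = "\<tau> 0", OF k k1])
    show "at (\<tau> 0) within I \<noteq> bot"
      by (rule interval_at_within_nontrivial[OF \<open>is_interval I\<close> \<open>interior I \<noteq> {}\<close> \<tau>(1)[OF z]])
    obtain r where r: "r > 0" "ball (\<tau> 0) r \<subseteq> Q" using Q(1,2) open_contains_ball by blast
    have "(H has_vector_derivative dird H 1 (\<tau> 0)) (at (\<tau> 0) within I)"
      using has_vector_derivative_at_within[OF dird_along[OF Q(3), of 0 "\<tau> 0" 1]] Q(2) by simp
    then show "((\<lambda>r. snd k (\<gamma> r)) has_vector_derivative dird H 1 (\<tau> 0)) (at (\<tau> 0) within I)"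
    proof (rule has_vector_derivative_transform_within[OF _ r(1) \<tau>(1)[OF z]])
      fix t assume t: "t \<in> I" "dist t (\<tau> 0) < r"
      then have "t \<in> Q" using r(2) by (auto simp: dist_commute)
      then show "H t = snd k (\<gamma> t)" using H t(1) by blast
    qed
  qed
  have "velocity \<A> I \<gamma> (\<tau> 0) \<in> slit_tangent_space \<A> (\<gamma> (\<tau> 0))"
    using \<open>timelike_curve \<A> L I \<gamma>\<close> \<tau>(1)[OF z] unfolding timelike_curve_def timelike_vec_def by blast
  \<comment> \<open>\<gamma> is timelike, hence its velocity is nonzero: the regularity that the
    inverse function theorem needs.\<close>
  from slit_component_nonzero[OF atlas this k k1] have H0: "dird H 1 (\<tau> 0) \<noteq> 0" by (simp add: \<gamma>')
  have cont: "isCont \<tau> 0" using lhs_meaningful by (simp add: \<tau>_def[abs_def])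
  then have "(\<tau> \<longlongrightarrow> \<tau> 0) (nhds 0)" by (simp add: isCont_def tendsto_at_iff_tendsto_nhds)
  \<comment> \<open>Continuity keeps the arrival time in \<open>Q\<close>, where \<open>H\<close>
    represents \<gamma>.\<close>
  then have "\<forall>\<^sub>F e in nhds 0. \<tau> e \<in> Q" by (rule topological_tendstoD[OF _ Q(1,2)])
  moreover have "\<forall>\<^sub>F e in nhds 0. e \<in> ball (0::real) d"
    by (rule eventually_nhds_in_open[OF open_ball zero_ball])
  ultimately have eq: "\<forall>\<^sub>F e in nhds 0. X (e, 1) = H (\<tau> e)"
  proof eventually_elim
    case (elim e)
    then show ?case
      using frame[OF elim(2) one s0_ball] H[OF elim(1) \<tau>(1)[OF eps[OF elim(2)]]] \<tau>(2)[OF eps[OF elim(2)]]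
      by simp
  qed
  have "smooth_in (ball 0 d) (\<lambda>e. (e, 1::real))"
    by (intro smooth_in_Pair smooth_in_bounded_linear bounded_linear_ident smooth_in_const open_ball)
  then have sX: "smooth_in (ball 0 d) (\<lambda>e. X (e, 1))"
    by (rule smooth_in_compose[OF smooth_X _ open_ball open_P]) (use s0_ball in auto)
  obtain \<tau>' D2 where t': "\<forall>\<^sub>F e in nhds 0. (\<tau> has_real_derivative \<tau>' e) (at e)"
    and t'': "(\<tau>' has_real_derivative D2) (at 0)"
    using curve_parameter_twice_differentiable[OF Q(1,3,2) H0 open_ball sX zero_ball cont eq] by blast
  have den: "fund_tensor \<A> L (\<mu> 1) (velocity \<A> {0..1} \<mu> 1)
      (velocity \<A> I \<gamma> (time_arrival I \<gamma> \<mu>)) (velocity \<A> {0..1} \<mu> 1) =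
      G (Z (0, 1)) (dird H 1 (\<tau> 0)) (snd (Z (0, 1)))"
    using fund_tensor_eq Z_eq[OF zero_ball one s0_ball]
    by (simp add: k_def[symmetric] \<tau>0 \<gamma>' Vel_base[OF one])
  note ends = endpoint[OF refl Q(1,3,2) eq t' t'']
  \<comment> \<open>\<open>Psi 0 1\<close> is both 0 and \<tau>'(0) times the denominator, which is
    nonzero by \<open>rhs_meaningful\<close>.\<close>
  have "\<tau>' 0 = 0" using ends(1) rhs_meaningful by (simp add: Psi_end den)
  from ends(2)[OF this] have "phi 1 = D2 * G (Z (0, 1)) (dird H 1 (\<tau> 0)) (snd (Z (0, 1)))" .
  then have "D2 = index_form \<A> L \<mu> (variation_field \<A> \<epsilon>0 \<Lambda>) (variation_field \<A> \<epsilon>0 \<Lambda>) /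
      fund_tensor \<A> L (\<mu> 1) (velocity \<A> {0..1} \<mu> 1)
        (velocity \<A> I \<gamma> (time_arrival I \<gamma> \<mu>)) (velocity \<A> {0..1} \<mu> 1)"
    using rhs_meaningful by (simp add: index_form_eq boundary_start den)
  then show ?thesis
    using t' t'' unfolding has_second_derivative_def \<tau>_def[abs_def] by blast
qed

end
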